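(* For ${\rm t}\in\{{\rm loc},{\rm q},{\rm qa},{\rm qc},{\rm ns}\}$, the relation $\to_{\rm t}$ on hypergraphs is a quasi-order (reflexive and transitive), and the relation $\simeq_{\rm t}$ on hypergraphs is an equivalence relation.
   Context: A hypergraph is a subset $E\subseteq V\times W$ with $V,W$ finite sets. $\mathcal D_V$ is the algebra of complex diagonal $V\times V$ matrices with diagonal matrix units $\epsilon_{v,v}$; $VW=V\times W$. A channel is a positive trace-preserving linear map $\mathcal E:\mathcal D_V\to\mathcal D_W$; $\mathcal E(w|v)$ is the $(w,w)$ entry of $\mathcal E(\epsilon_{v,v})$. A POVM is a finite family of positive operators on a Hilbert space summing to $I$. **Correlations.** An NS correlation over a quadruple $(V_2,W_1,V_1,W_2)$ of finite sets is a channel $\Gamma:\mathcal D_{V_2W_1}\to\mathcal D_{V_1W_2}$ such that $\sum_{w_2}\Gamma(v_1,w_2|v_2,w_1)$ does not depend on $w_1$ and $\sum_{v_1}\Gamma(v_1,w_2|v_2,w_1)$ does not depend on $v_2$. $\Gamma$ is: qc if there are a Hilbert space $H$, a unit vector $\xi\in H$ and POVMs $(E_{v_2,v_1})_{v_1}$, $(F_{w_1,w_2})_{w_2}$ on $H$ with $E_{v_2,v_1}F_{w_1,w_2}=F_{w_1,w_2}E_{v_2,v_1}$ and $\Gamma(v_1,w_2|v_2,w_1)=\langle E_{v_2,v_1}F_{w_1,w_2}\xi,\xi\rangle$; q if moreover $H=H_V\otimes H_W$ with $H_V,H_W$ finite dimensional, $E_{v_2,v_1}=E'_{v_2,v_1}\otimes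 I$, $F_{w_1,w_2}=I\otimes F'_{w_1,w_2}$; qa if it is a limit of quantum correlations; loc if it is a convex combination of $\Phi\otimes\Psi$ with channels $\Phi:\mathcal D_{V_2}\to\mathcal D_{V_1}$, $\Psi:\mathcal D_{W_1}\to\mathcal D_{W_2}$. $\mathcal C_{\rm t}$ is the set of those of type ${\rm t}$ (ns = all). **Bicorrelations.** Let $V_1=V_2=V$, $W_1=W_2=W$. An NS bicorrelation is an NS correlation $\Gamma$ that is unital ($\Gamma(I)=I$) and for which $\Gamma^*(v_2,w_1|v_1,w_2):=\Gamma(v_1,w_2|v_2,w_1)$ is an NS correlation over $(V_1,W_2,V_2,W_1)$. A quantum magic square is a square matrix of positive operators on a Hilbert space, each row and column of which sums to $I$. An NS bicorrelation is qc if $\Gamma(v_1,w_2|v_2,w_1)=\langle E_{v_2,v_1}F_{w_1,w_2}\xi,\xi\rangle$ for a unit vector $\xi\in H$ and quantum magic squares $(E_{v_2,v_1})$, $(F_{w_1,w_2})$ on $H$ with $E_{v_2,v_1}F_{w_1,w_2}=F_{w_1,w_2}E_{v_2,v_1}$; q if moreover $H=H_A\otimes H_B$ with $H_A,H_B$ finite dimensional, $E_{v_2,v_1}=E'_{v_2,v_1}\otimes I$, $F_{w_1,w_2}=I\otimes F'_{w_1,w_2}$; qa if it is a limit of quantum bicorrelations; loc if it is a convex combination of $p^{(1)}(v_1|v_2)p^{(2)}(w_2|w_1)$ with scalar bistochastic matrices $(p^{(1)}(v_1|v_2))$, $(p^{(2)}(w_2|w_1))$. $\mathcal C^{\rm bi}_{\rm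 t}$ is the set of bicorrelations of type ${\rm t}$. **Relations.** For hypergraphs $E_i\subseteq V_i\times W_i$, $i=1,2$, $E_1\leftrightarrow E_2=\{(v_2,w_1,v_1,w_2):(v_1,w_1)\in E_1\Leftrightarrow(v_2,w_2)\in E_2\}$, and $\Gamma$ fits $E_1\leftrightarrow E_2$ if $\Gamma(v_1,w_2|v_2,w_1)=0$ whenever $(v_2,w_1,v_1,w_2)\notin E_1\leftrightarrow E_2$. $E_1\to_{\rm t}E_2$ means that some $\Gamma\in\mathcal C_{\rm t}$ over $(V_2,W_1,V_1,W_2)$ fits $E_1\leftrightarrow E_2$; $E_1\simeq_{\rm t}E_2$ means that $V_1=V_2$, $W_1=W_2$ and some $\Gamma\in\mathcal C^{\rm bi}_{\rm t}$ fits $E_1\leftrightarrow E_2$.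
   Formalization: The quasi-order is stated for hypergraphs with V, W not both empty, since through the hypergraph with V = W = ∅ the relation →_ns is not transitive; Hilbert spaces are taken with underlying set inside an arbitrary fixed type of at least continuum size. *)

theory Defs
  imports
    Complex_Main
    "HOL-Library.Nonpos_Ints"
    "HOL-Library.Equipollence"
    "HOL-Algebra.Module"
begin

section \<open>Complex Hilbert spaces and operators\<close>

text \<open>
  Hilbert spaces are carrier-based, because the definitions below quantify existentially over them.
  The inner product is linear in the first argument. The fields \<open>mult\<close> and \<open>one\<close>, which the record
  for modules inherits from the record for rings, play no role.
\<close>

definition complex_ring :: "complex ring" where
  "complex_ring = \<lparr>carrier = UNIV, mult = (*), one = 1, zero = 0, add = (+)\<rparr>"

record 'h hilbert = "(complex, 'h) module" +
  hinner :: "'h \<Rightarrow> 'h \<Rightarrow> complex"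

definition hnorm :: "'h hilbert \<Rightarrow> 'h \<Rightarrow> real" where
  "hnorm H x = sqrt (Re (hinner H x x))"

locale hilbert_space = Module.module complex_ring H
  for H :: "'h hilbert" (structure) +
  assumes inner_add_left:
      "\<lbrakk>x \<in> carrier H; y \<in> carrier H; z \<in> carrier H\<rbrakk> \<Longrightarrow>
       hinner H (x \<oplus>\<^bsub>H\<^esub> y) z = hinner H x z + hinner H y z"
    and inner_smult_left:
      "\<lbrakk>x \<in> carrier H; y \<in> carrier H\<rbrakk> \<Longrightarrow> hinner H (c \<odot>\<^bsub>H\<^esub> x) y = c * hinner H x y"
    and inner_commute:
      "\<lbrakk>x \<in> carrier H; y \<in> carrier H\<rbrakk> \<Longrightarrow> hinner H x y = cnj (hinner H y x)"
    and inner_nonneg: "x \<in> carrier H \<Longrightarrow> hinner H x x \<in> \<real>\<^sub>\<ge>\<^sub>0"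
    and inner_definite: "\<lbrakk>x \<in> carrier H; hinner H x x = 0\<rbrakk> \<Longrightarrow> x = \<zero>\<^bsub>H\<^esub>"
    and complete:
      "\<lbrakk>\<And>n. s n \<in> carrier H;
        \<And>e. e > 0 \<Longrightarrow> \<exists>N. \<forall>m\<ge>N. \<forall>n\<ge>N. hnorm H (s m \<ominus>\<^bsub>H\<^esub> s n) < e\<rbrakk> \<Longrightarrow>
       \<exists>x\<in>carrier H. (\<lambda>n::nat. hnorm H (s n \<ominus>\<^bsub>H\<^esub> x)) \<longlonglongrightarrow> 0"

definition bounded_op :: "'h hilbert \<Rightarrow> ('h \<Rightarrow> 'h) \<Rightarrow> bool" where
  "bounded_op H T \<longleftrightarrow>
     T \<in> carrier H \<rightarrow> carrier H \<and>
     (\<forall>x\<in>carrier H. \<forall>y\<in>carrier H. T (x \<oplus>\<^bsub>H\<^esub> y) = T x \<oplus>\<^bsub>H\<^esub> T y) \<and>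
     (\<forall>c. \<forall>x\<in>carrier H. T (c \<odot>\<^bsub>H\<^esub> x) = c \<odot>\<^bsub>H\<^esub> T x) \<and>
     (\<exists>B. \<forall>x\<in>carrier H. hnorm H (T x) \<le> B * hnorm H x)"

definition positive_op :: "'h hilbert \<Rightarrow> ('h \<Rightarrow> 'h) \<Rightarrow> bool" where
  "positive_op H T \<longleftrightarrow> bounded_op H T \<and> (\<forall>x\<in>carrier H. hinner H (T x) x \<in> \<real>\<^sub>\<ge>\<^sub>0)"

definition povm :: "'h hilbert \<Rightarrow> 'i set \<Rightarrow> ('i \<Rightarrow> 'h \<Rightarrow> 'h) \<Rightarrow> bool" where
  "povm H I E \<longleftrightarrow> finite I \<and> (\<forall>i\<in>I. positive_op H (E i)) \<and>
     (\<forall>x\<in>carrier H. (\<Oplus>\<^bsub>H\<^esub>i\<in>I. E i x) = x)"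

definition quantum_magic_square :: "'h hilbert \<Rightarrow> 'i set \<Rightarrow> ('i \<Rightarrow> 'i \<Rightarrow> 'h \<Rightarrow> 'h) \<Rightarrow> bool" where
  "quantum_magic_square H I E \<longleftrightarrow>
     finite I \<and>
     (\<forall>i\<in>I. \<forall>j\<in>I. positive_op H (E i j)) \<and>
     (\<forall>i\<in>I. \<forall>x\<in>carrier H. (\<Oplus>\<^bsub>H\<^esub>j\<in>I. E i j x) = x) \<and>
     (\<forall>j\<in>I. \<forall>x\<in>carrier H. (\<Oplus>\<^bsub>H\<^esub>i\<in>I. E i j x) = x)"

definition finite_dimensional :: "'h hilbert \<Rightarrow> bool" where
  "finite_dimensional H \<longleftrightarrow>
     (\<exists>(n::nat) b. (\<forall>i<n. b i \<in> carrier H) \<and>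
        (\<forall>x\<in>carrier H. \<exists>c. x = (\<Oplus>\<^bsub>H\<^esub>i\<in>{..<n}. c i \<odot>\<^bsub>H\<^esub> b i)))"

text \<open>
  \<open>H\<close>, with the elementary tensors \<open>\<tau> x y\<close>, is the Hilbert space tensor product of the finite
  dimensional Hilbert spaces \<open>K\<close> and \<open>L\<close>; the algebraic span of the elementary tensors is then
  already complete.
\<close>

definition fd_tensor :: "'h hilbert \<Rightarrow> 'h hilbert \<Rightarrow> 'h hilbert \<Rightarrow> ('h \<Rightarrow> 'h \<Rightarrow> 'h) \<Rightarrow> bool" where
  "fd_tensor K L H \<tau> \<longleftrightarrow>
     (\<forall>x\<in>carrier K. \<forall>y\<in>carrier L. \<tau> x y \<in> carrier H) \<and>
     (\<forall>x\<in>carrier K. \<forall>x'\<in>carrier K. \<forall>y\<in>carrier L. \<tau> (x \<oplus>\<^bsub>K\<^esub> x') y = \<tau> x y \<oplus>\<^bsub>H\<^esub> \<tau> x' y) \<and>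
     (\<forall>x\<in>carrier K. \<forall>y\<in>carrier L. \<forall>y'\<in>carrier L. \<tau> x (y \<oplus>\<^bsub>L\<^esub> y') = \<tau> x y \<oplus>\<^bsub>H\<^esub> \<tau> x y') \<and>
     (\<forall>c. \<forall>x\<in>carrier K. \<forall>y\<in>carrier L.
        \<tau> (c \<odot>\<^bsub>K\<^esub> x) y = c \<odot>\<^bsub>H\<^esub> \<tau> x y \<and> \<tau> x (c \<odot>\<^bsub>L\<^esub> y) = c \<odot>\<^bsub>H\<^esub> \<tau> x y) \<and>
     (\<forall>x\<in>carrier K. \<forall>x'\<in>carrier K. \<forall>y\<in>carrier L. \<forall>y'\<in>carrier L.
        hinner H (\<tau> x y) (\<tau> x' y') = hinner K x x' * hinner L y y') \<and>
     (\<forall>z\<in>carrier H. \<exists>(n::nat) x y. (\<forall>i<n. x i \<in> carrier K \<and> y i \<in> carrier L) \<and>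
        z = (\<Oplus>\<^bsub>H\<^esub>i\<in>{..<n}. \<tau> (x i) (y i)))"

text \<open>
  \<open>H\<close> is a tensor product \<open>K \<otimes> L\<close> of finite dimensional Hilbert spaces, \<open>E i j = E' i j \<otimes> I\<close> and
  \<open>F k l = I \<otimes> F' k l\<close>. A linear operator is determined by its values on elementary tensors.
\<close>

definition tensor_split ::
  "'h hilbert \<Rightarrow> 'i set \<Rightarrow> 'j set \<Rightarrow> ('i \<Rightarrow> 'j \<Rightarrow> 'h \<Rightarrow> 'h) \<Rightarrow>
   'k set \<Rightarrow> 'l set \<Rightarrow> ('k \<Rightarrow> 'l \<Rightarrow> 'h \<Rightarrow> 'h) \<Rightarrow> bool" where
  "tensor_split H I J E K' L' F \<longleftrightarrow>
     (\<exists>(K::'h hilbert) (L::'h hilbert) \<tau> E' F'.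
        hilbert_space K \<and> finite_dimensional K \<and> hilbert_space L \<and> finite_dimensional L \<and>
        fd_tensor K L H \<tau> \<and>
        (\<forall>i\<in>I. \<forall>j\<in>J. bounded_op K (E' i j) \<and>
           (\<forall>x\<in>carrier K. \<forall>y\<in>carrier L. E i j (\<tau> x y) = \<tau> (E' i j x) y)) \<and>
        (\<forall>k\<in>K'. \<forall>l\<in>L'. bounded_op L (F' k l) \<and>
           (\<forall>x\<in>carrier K. \<forall>y\<in>carrier L. F k l (\<tau> x y) = \<tau> x (F' k l y))))"


section \<open>Diagonal matrices and channels\<close>

text \<open>A diagonal \<open>X \<times> X\<close> matrix is represented by its diagonal, a function that vanishes off \<open>X\<close>.\<close>

definition diag :: "'x set \<Rightarrow> ('x \<Rightarrow> complex) set" where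
  "diag X = {a. \<forall>x. x \<notin> X \<longrightarrow> a x = 0}"

definition diag_unit :: "'x \<Rightarrow> 'x \<Rightarrow> complex" where
  "diag_unit x = (\<lambda>y. if y = x then 1 else 0)"

definition diag_one :: "'x set \<Rightarrow> 'x \<Rightarrow> complex" where
  "diag_one X = (\<lambda>y. if y \<in> X then 1 else 0)"

definition channel :: "'x set \<Rightarrow> 'y set \<Rightarrow> (('x \<Rightarrow> complex) \<Rightarrow> ('y \<Rightarrow> complex)) \<Rightarrow> bool" where
  "channel X Y \<Phi> \<longleftrightarrow>
     \<Phi> \<in> diag X \<rightarrow> diag Y \<and>
     (\<forall>a\<in>diag X. \<forall>b\<in>diag X. \<Phi> (\<lambda>x. a x + b x) = (\<lambda>y. \<Phi> a y + \<Phi> b y)) \<and>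
     (\<forall>c. \<forall>a\<in>diag X. \<Phi> (\<lambda>x. c * a x) = (\<lambda>y. c * \<Phi> a y)) \<and>
     (\<forall>a\<in>diag X. (\<forall>x\<in>X. a x \<in> \<real>\<^sub>\<ge>\<^sub>0) \<longrightarrow> (\<forall>y\<in>Y. \<Phi> a y \<in> \<real>\<^sub>\<ge>\<^sub>0)) \<and>
     (\<forall>a\<in>diag X. (\<Sum>y\<in>Y. \<Phi> a y) = (\<Sum>x\<in>X. a x))"

text \<open>\<open>entry \<Phi> y x\<close> is \<open>\<Phi>(y|x)\<close>.\<close>

definition entry :: "(('x \<Rightarrow> complex) \<Rightarrow> ('y \<Rightarrow> complex)) \<Rightarrow> 'y \<Rightarrow> 'x \<Rightarrow> complex" where
  "entry \<Phi> y x = \<Phi> (diag_unit x) y"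

text \<open>The linear map from \<open>diag Y\<close> to \<open>diag X\<close> with entries \<open>\<Phi>\<^sup>*(x|y) = \<Phi>(y|x)\<close>.\<close>

definition dual_map ::
  "'x set \<Rightarrow> 'y set \<Rightarrow> (('x \<Rightarrow> complex) \<Rightarrow> ('y \<Rightarrow> complex)) \<Rightarrow> (('y \<Rightarrow> complex) \<Rightarrow> ('x \<Rightarrow> complex))" where
  "dual_map X Y \<Phi> = (\<lambda>b x. if x \<in> X then \<Sum>y\<in>Y. entry \<Phi> y x * b y else 0)"


section \<open>Correlations\<close>

type_synonym ('v, 'w) corr_map = "('v \<times> 'w \<Rightarrow> complex) \<Rightarrow> ('v \<times> 'w \<Rightarrow> complex)"

datatype corr_type = T_loc | T_q | T_qa | T_qc | T_ns

definition ns_corr :: "'v set \<Rightarrow> 'w set \<Rightarrow> 'v set \<Rightarrow> 'w set \<Rightarrow> ('v, 'w) corr_map set" where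
  "ns_corr V2 W1 V1 W2 =
     {\<Gamma>. channel (V2 \<times> W1) (V1 \<times> W2) \<Gamma> \<and>
        (\<forall>v2\<in>V2. \<forall>v1\<in>V1. \<forall>w1\<in>W1. \<forall>w1'\<in>W1.
           (\<Sum>w2\<in>W2. entry \<Gamma> (v1, w2) (v2, w1)) = (\<Sum>w2\<in>W2. entry \<Gamma> (v1, w2) (v2, w1'))) \<and>
        (\<forall>w1\<in>W1. \<forall>w2\<in>W2. \<forall>v2\<in>V2. \<forall>v2'\<in>V2.
           (\<Sum>v1\<in>V1. entry \<Gamma> (v1, w2) (v2, w1)) = (\<Sum>v1\<in>V1. entry \<Gamma> (v1, w2) (v2', w1)))}"

definition commuting_model ::
  "'h hilbert \<Rightarrow> 'h \<Rightarrow> 'v set \<Rightarrow> 'w set \<Rightarrow> 'v set \<Rightarrow> 'w set \<Rightarrow>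
   ('v \<Rightarrow> 'v \<Rightarrow> 'h \<Rightarrow> 'h) \<Rightarrow> ('w \<Rightarrow> 'w \<Rightarrow> 'h \<Rightarrow> 'h) \<Rightarrow> ('v, 'w) corr_map \<Rightarrow> bool" where
  "commuting_model H \<xi> V2 W1 V1 W2 E F \<Gamma> \<longleftrightarrow>
     hilbert_space H \<and> \<xi> \<in> carrier H \<and> hnorm H \<xi> = 1 \<and>
     (\<forall>v2\<in>V2. \<forall>v1\<in>V1. \<forall>w1\<in>W1. \<forall>w2\<in>W2.
        (\<forall>x\<in>carrier H. E v2 v1 (F w1 w2 x) = F w1 w2 (E v2 v1 x)) \<and>
        entry \<Gamma> (v1, w2) (v2, w1) = hinner H (E v2 v1 (F w1 w2 \<xi>)) \<xi>)"

text \<open>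
  The type argument \<open>'h\<close> is the type that contains the carriers of the Hilbert spaces quantified
  over. By restricting to the closed subspace generated by the state vector, every quantum commuting
  correlation arises on a separable Hilbert space, so any \<open>'h\<close> with at least continuum many
  elements yields the same correlations.
\<close>

definition qc_corr ::
  "'h itself \<Rightarrow> 'v set \<Rightarrow> 'w set \<Rightarrow> 'v set \<Rightarrow> 'w set \<Rightarrow> ('v, 'w) corr_map set" where
  "qc_corr TYPE('h) V2 W1 V1 W2 =
     {\<Gamma> \<in> ns_corr V2 W1 V1 W2. \<exists>(H::'h hilbert) \<xi> E F.
        (\<forall>v2\<in>V2. povm H V1 (E v2)) \<and> (\<forall>w1\<in>W1. povm H W2 (F w1)) \<and>
        commuting_model H \<xi> V2 W1 V1 W2 E F \<Gamma>}"

definition q_corr ::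
  "'h itself \<Rightarrow> 'v set \<Rightarrow> 'w set \<Rightarrow> 'v set \<Rightarrow> 'w set \<Rightarrow> ('v, 'w) corr_map set" where
  "q_corr TYPE('h) V2 W1 V1 W2 =
     {\<Gamma> \<in> ns_corr V2 W1 V1 W2. \<exists>(H::'h hilbert) \<xi> E F.
        (\<forall>v2\<in>V2. povm H V1 (E v2)) \<and> (\<forall>w1\<in>W1. povm H W2 (F w1)) \<and>
        commuting_model H \<xi> V2 W1 V1 W2 E F \<Gamma> \<and> tensor_split H V2 V1 E W1 W2 F}"

text \<open>Convergence in a finite dimensional space of maps is convergence of all entries.\<close>

definition corr_limits ::
  "'v set \<Rightarrow> 'w set \<Rightarrow> 'v set \<Rightarrow> 'w set \<Rightarrow> ('v, 'w) corr_map set \<Rightarrow> ('v, 'w) corr_map set" where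
  "corr_limits V2 W1 V1 W2 C =
     {\<Gamma>. \<exists>\<Gamma>s. (\<forall>n::nat. \<Gamma>s n \<in> C) \<and>
        (\<forall>v2\<in>V2. \<forall>w1\<in>W1. \<forall>v1\<in>V1. \<forall>w2\<in>W2.
           (\<lambda>n. entry (\<Gamma>s n) (v1, w2) (v2, w1)) \<longlonglongrightarrow> entry \<Gamma> (v1, w2) (v2, w1))}"

definition loc_corr :: "'v set \<Rightarrow> 'w set \<Rightarrow> 'v set \<Rightarrow> 'w set \<Rightarrow> ('v, 'w) corr_map set" where
  "loc_corr V2 W1 V1 W2 =
     {\<Gamma> \<in> ns_corr V2 W1 V1 W2. \<exists>(n::nat) (l::nat \<Rightarrow> real) \<Phi> \<Psi>.
        (\<forall>i<n. l i \<ge> 0) \<and> (\<Sum>i<n. l i) = 1 \<and>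
        (\<forall>i<n. channel V2 V1 (\<Phi> i) \<and> channel W1 W2 (\<Psi> i)) \<and>
        (\<forall>v2\<in>V2. \<forall>w1\<in>W1. \<forall>v1\<in>V1. \<forall>w2\<in>W2.
           entry \<Gamma> (v1, w2) (v2, w1) =
             (\<Sum>i<n. complex_of_real (l i) * (entry (\<Phi> i) v1 v2 * entry (\<Psi> i) w2 w1)))}"

fun corr ::
  "'h itself \<Rightarrow> corr_type \<Rightarrow> 'v set \<Rightarrow> 'w set \<Rightarrow> 'v set \<Rightarrow> 'w set \<Rightarrow> ('v, 'w) corr_map set" where
  "corr h T_loc V2 W1 V1 W2 = loc_corr V2 W1 V1 W2"
| "corr h T_q V2 W1 V1 W2 = q_corr h V2 W1 V1 W2"
| "corr h T_qa V2 W1 V1 W2 =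
     ns_corr V2 W1 V1 W2 \<inter> corr_limits V2 W1 V1 W2 (q_corr h V2 W1 V1 W2)"
| "corr h T_qc V2 W1 V1 W2 = qc_corr h V2 W1 V1 W2"
| "corr h T_ns V2 W1 V1 W2 = ns_corr V2 W1 V1 W2"


section \<open>Bicorrelations\<close>

definition ns_bicorr :: "'v set \<Rightarrow> 'w set \<Rightarrow> ('v, 'w) corr_map set" where
  "ns_bicorr V W =
     {\<Gamma> \<in> ns_corr V W V W. \<Gamma> (diag_one (V \<times> W)) = diag_one (V \<times> W) \<and>
        dual_map (V \<times> W) (V \<times> W) \<Gamma> \<in> ns_corr V W V W}"

definition qc_bicorr :: "'h itself \<Rightarrow> 'v set \<Rightarrow> 'w set \<Rightarrow> ('v, 'w) corr_map set" where
  "qc_bicorr TYPE('h) V W =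
     {\<Gamma> \<in> ns_bicorr V W. \<exists>(H::'h hilbert) \<xi> E F.
        quantum_magic_square H V E \<and> quantum_magic_square H W F \<and>
        commuting_model H \<xi> V W V W E F \<Gamma>}"

definition q_bicorr :: "'h itself \<Rightarrow> 'v set \<Rightarrow> 'w set \<Rightarrow> ('v, 'w) corr_map set" where
  "q_bicorr TYPE('h) V W =
     {\<Gamma> \<in> ns_bicorr V W. \<exists>(H::'h hilbert) \<xi> E F.
        quantum_magic_square H V E \<and> quantum_magic_square H W F \<and>
        commuting_model H \<xi> V W V W E F \<Gamma> \<and> tensor_split H V V E W W F}"

definition bistochastic :: "'i set \<Rightarrow> ('i \<Rightarrow> 'i \<Rightarrow> real) \<Rightarrow> bool" where
  "bistochastic I p \<longleftrightarrow>
     (\<forall>i\<in>I. \<forall>j\<in>I. p i j \<ge> 0) \<and>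
     (\<forall>i\<in>I. (\<Sum>j\<in>I. p i j) = 1) \<and> (\<forall>j\<in>I. (\<Sum>i\<in>I. p i j) = 1)"

definition loc_bicorr :: "'v set \<Rightarrow> 'w set \<Rightarrow> ('v, 'w) corr_map set" where
  "loc_bicorr V W =
     {\<Gamma> \<in> ns_bicorr V W. \<exists>(n::nat) (l::nat \<Rightarrow> real) p p'.
        (\<forall>i<n. l i \<ge> 0) \<and> (\<Sum>i<n. l i) = 1 \<and>
        (\<forall>i<n. bistochastic V (p i) \<and> bistochastic W (p' i)) \<and>
        (\<forall>v2\<in>V. \<forall>w1\<in>W. \<forall>v1\<in>V. \<forall>w2\<in>W.
           entry \<Gamma> (v1, w2) (v2, w1) = complex_of_real (\<Sum>i<n. l i * (p i v1 v2 * p' i w2 w1)))}"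

fun bicorr :: "'h itself \<Rightarrow> corr_type \<Rightarrow> 'v set \<Rightarrow> 'w set \<Rightarrow> ('v, 'w) corr_map set" where
  "bicorr h T_loc V W = loc_bicorr V W"
| "bicorr h T_q V W = q_bicorr h V W"
| "bicorr h T_qa V W = ns_bicorr V W \<inter> corr_limits V W V W (q_bicorr h V W)"
| "bicorr h T_qc V W = qc_bicorr h V W"
| "bicorr h T_ns V W = ns_bicorr V W"


section \<open>Hypergraphs and the relations between them\<close>

record ('v, 'w) hypergraph =
  vset :: "'v set"
  wset :: "'w set"
  edges :: "('v \<times> 'w) set"

definition is_hypergraph :: "('v, 'w) hypergraph \<Rightarrow> bool" where
  "is_hypergraph G \<longleftrightarrow> finite (vset G) \<and> finite (wset G) \<and> edges G \<subseteq> vset G \<times> wset G"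

text \<open>
  The hypergraph with \<open>vset = {}\<close> and \<open>wset = {}\<close> has to be left out of the quasi-order: for this
  \<open>G\<close>, the zero map is vacuously a no-signalling correlation over the quadruples \<open>({}, W1, V1, {})\<close>
  and \<open>(V3, {}, {}, W3)\<close>, so that \<open>G1 \<rightarrow>\<^sub>n\<^sub>s G \<rightarrow>\<^sub>n\<^sub>s G3\<close> for all \<open>G1\<close> and \<open>G3\<close>.
\<close>

definition nonvoid :: "('v, 'w) hypergraph \<Rightarrow> bool" where
  "nonvoid G \<longleftrightarrow> vset G \<noteq> {} \<or> wset G \<noteq> {}"

definition iff_relation ::
  "('v, 'w) hypergraph \<Rightarrow> ('v, 'w) hypergraph \<Rightarrow> ('v \<times> 'w \<times> 'v \<times> 'w) set" where
  "iff_relation G1 G2 =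
     {(v2, w1, v1, w2). v2 \<in> vset G2 \<and> w1 \<in> wset G1 \<and> v1 \<in> vset G1 \<and> w2 \<in> wset G2 \<and>
        ((v1, w1) \<in> edges G1 \<longleftrightarrow> (v2, w2) \<in> edges G2)}"

definition fits ::
  "('v, 'w) corr_map \<Rightarrow> ('v, 'w) hypergraph \<Rightarrow> ('v, 'w) hypergraph \<Rightarrow> bool" where
  "fits \<Gamma> G1 G2 \<longleftrightarrow>
     (\<forall>v2\<in>vset G2. \<forall>w1\<in>wset G1. \<forall>v1\<in>vset G1. \<forall>w2\<in>wset G2.
        (v2, w1, v1, w2) \<notin> iff_relation G1 G2 \<longrightarrow> entry \<Gamma> (v1, w2) (v2, w1) = 0)"

definition arrow ::
  "'h itself \<Rightarrow> corr_type \<Rightarrow> ('v, 'w) hypergraph \<Rightarrow> ('v, 'w) hypergraph \<Rightarrow> bool" where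
  "arrow h t G1 G2 \<longleftrightarrow>
     (\<exists>\<Gamma> \<in> corr h t (vset G2) (wset G1) (vset G1) (wset G2). fits \<Gamma> G1 G2)"

definition bi_equiv ::
  "'h itself \<Rightarrow> corr_type \<Rightarrow> ('v, 'w) hypergraph \<Rightarrow> ('v, 'w) hypergraph \<Rightarrow> bool" where
  "bi_equiv h t G1 G2 \<longleftrightarrow>
     vset G1 = vset G2 \<and> wset G1 = wset G2 \<and>
     (\<exists>\<Gamma> \<in> bicorr h t (vset G1) (wset G1). fits \<Gamma> G1 G2)"

end

theory Submission
  imports Defs "HOL-Analysis.Analysis"
begin

text \<open>
  If \<open>\<Gamma>\<^sub>1\<close> fits \<open>E\<^sub>1 \<leftrightarrow> E\<^sub>2\<close> and \<open>\<Gamma>\<^sub>2\<close> fits \<open>E\<^sub>2 \<leftrightarrow> E\<^sub>3\<close>, then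
  \<open>\<Gamma>(v\<^sub>1,w\<^sub>3|v\<^sub>3,w\<^sub>1) = (\<Sum>v\<^sub>2 w\<^sub>2. \<Gamma>\<^sub>2(v\<^sub>2,w\<^sub>3|v\<^sub>3,w\<^sub>2) \<Gamma>\<^sub>1(v\<^sub>1,w\<^sub>2|v\<^sub>2,w\<^sub>1))\<close> fits
  \<open>E\<^sub>1 \<leftrightarrow> E\<^sub>3\<close>. It is realised on the tensor product of the two Hilbert spaces by the operators
  \<open>\<Sum>v\<^sub>2. E\<^sub>2 v\<^sub>3 v\<^sub>2 \<otimes> E\<^sub>1 v\<^sub>2 v\<^sub>1\<close> and \<open>\<Sum>w\<^sub>2. F\<^sub>2 w\<^sub>2 w\<^sub>3 \<otimes> F\<^sub>1 w\<^sub>1 w\<^sub>2\<close>. Symmetry of the bicorrelation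
  relation is the passage to \<open>\<Gamma>\<^sup>*\<close>, which transposes the quantum magic squares.

  To keep the tensor product inside the given type, realisations are replaced by matrices. The
  images of the state vector under words in the operators are countably many, and orthonormalising
  them yields an orthonormal system whose finite linear span is invariant under the positive
  operators in question. The resulting matrices have finitely many nonzero entries in each column
  and, being Hermitian, in each row, so that their products and Kronecker products are finite sums;
  conversely they act by contractions on the square summable families. Positivity of Kronecker
  products is the Schur product theorem.
\<close>

section \<open>Positive semidefinite matrices\<close>

text \<open>The composite is not a composition of channels: its wiring is a loop, in which
  \<open>v\<close> runs from the second correlation into the first and \<open>w\<close> from the
  first into the second. That the total mass is 1 therefore rests on the no-signalling conditions of
  both. If both middle sets are empty, the sum collapses to 0; this is the degenerate case to be
  excluded for correlations. For bicorrelations all sets coincide and the case is harmless.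

  A model has to be known only on the span of the orbit of its state, so a countable index set
  suffices however large \<open>H\<close> is, and pairs of indices remain countable. Complex
  families over a countable set have the cardinality of the continuum, which is the origin of the
  size condition on \<open>'h\<close>. Boundedness on the completed space is not transported from
  \<open>H\<close>: the elements of a POVM sum to the identity, hence lie between 0 and 1. In the
  tensor product case the local operators are only assumed bounded, and their positivity is read off
  from a block of \<open>A \<otimes> I\<close>. Limits are handled by continuity, since composed
  entries are polynomials in the given ones.\<close>

type_synonym 'i cmat = "'i \<Rightarrow> 'i \<Rightarrow> complex"

text \<open>Row- and column-finite matrices. Entries vanish outside \<open>N \<times> N\<close>, so
  that equality of matrices is equality of functions and \<open>idm N\<close> is the unit even if
  \<open>N\<close> is not the whole type.\<close>

definition rcf :: "'i set \<Rightarrow> 'i cmat \<Rightarrow> bool" where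
  "rcf N A \<longleftrightarrow> (\<forall>i j. A i j \<noteq> 0 \<longrightarrow> i \<in> N \<and> j \<in> N) \<and>
     (\<forall>i. finite {j. A i j \<noteq> 0}) \<and> (\<forall>j. finite {i. A i j \<noteq> 0})"

definition qform :: "'i set \<Rightarrow> 'i cmat \<Rightarrow> ('i \<Rightarrow> complex) \<Rightarrow> complex" where
  "qform S A x = (\<Sum>i\<in>S. \<Sum>j\<in>S. cnj (x i) * A i j * x j)"

text \<open>Testing on finitely supported vectors keeps the form a finite sum;
  \<open>iprod_mapp_nonneg\<close> later extends positivity to square summable vectors by a
  limit.\<close>

definition psd :: "'i cmat \<Rightarrow> bool" where
  "psd A \<longleftrightarrow> (\<forall>S x. finite S \<longrightarrow> qform S A x \<in> \<real>\<^sub>\<ge>\<^sub>0)"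

definition idm :: "'i set \<Rightarrow> 'i cmat" where
  "idm N i j = (if i = j \<and> i \<in> N then 1 else 0)"

definition kron :: "'i cmat \<Rightarrow> 'j cmat \<Rightarrow> 'i \<times> 'j \<Rightarrow> 'i \<times> 'j \<Rightarrow> complex" where
  "kron A B p q = A (fst p) (fst q) * B (snd p) (snd q)"

text \<open>Running over the support of row \<open>i\<close> makes this a finite sum whenever
  \<open>A\<close> is row-finite.\<close>

definition mmul :: "'i cmat \<Rightarrow> 'i cmat \<Rightarrow> 'i cmat" where
  "mmul A B i k = (\<Sum>j | A i j \<noteq> 0. A i j * B j k)"

definition mpovm :: "'i set \<Rightarrow> 'k set \<Rightarrow> ('k \<Rightarrow> 'i cmat) \<Rightarrow> bool" where
  "mpovm N I A \<longleftrightarrow> finite I \<and> (\<forall>k\<in>I. rcf N (A k) \<and> psd (A k)) \<and>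
     (\<forall>i j. (\<Sum>k\<in>I. A k i j) = idm N i j)"

text \<open>The flag adds the column condition: \<open>False\<close> stands for families of POVMs, \<open>True\<close> for
  quantum magic squares.\<close>

definition mfam :: "bool \<Rightarrow> 'i set \<Rightarrow> 'x set \<Rightarrow> 'y set \<Rightarrow> ('x \<Rightarrow> 'y \<Rightarrow> 'i cmat) \<Rightarrow> bool" where
  "mfam b N X Y A \<longleftrightarrow> (\<forall>x\<in>X. mpovm N Y (A x)) \<and> (b \<longrightarrow> (\<forall>y\<in>Y. mpovm N X (\<lambda>x. A x y)))"

definition compose_fam ::
  "'y set \<Rightarrow> ('x \<Rightarrow> 'y \<Rightarrow> 'i cmat) \<Rightarrow> ('y \<Rightarrow> 'z \<Rightarrow> 'j cmat) \<Rightarrow>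
   'x \<Rightarrow> 'z \<Rightarrow> 'i \<times> 'j \<Rightarrow> 'i \<times> 'j \<Rightarrow> complex" where
  "compose_fam Y A B x z p q = (\<Sum>y\<in>Y. kron (A x y) (B y z) p q)"

lemma mmul_superset:
  assumes "finite S" "{j. A i j \<noteq> 0} \<subseteq> S"
  shows "mmul A B i k = (\<Sum>j\<in>S. A i j * B j k)"
  unfolding mmul_def using assms by (intro sum.mono_neutral_left) auto

lemma rcf_sum:
  assumes "finite K" "\<And>k. k \<in> K \<Longrightarrow> rcf N (A k)"
  shows "rcf N (\<lambda>i j. \<Sum>k\<in>K. A k i j)"
proof -
  have nz: "\<exists>k\<in>K. A k i j \<noteq> 0" if "(\<Sum>k\<in>K. A k i j) \<noteq> 0" for i j
    using that by (meson sum.neutral)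
  have "finite {j. (\<Sum>k\<in>K. A k i j) \<noteq> 0}" for i
    by (rule finite_subset[of _ "\<Union>k\<in>K. {j. A k i j \<noteq> 0}"]) (use assms nz in \<open>auto simp: rcf_def\<close>)
  moreover have "finite {i. (\<Sum>k\<in>K. A k i j) \<noteq> 0}" for j
    by (rule finite_subset[of _ "\<Union>k\<in>K. {i. A k i j \<noteq> 0}"]) (use assms nz in \<open>auto simp: rcf_def\<close>)
  moreover have "i \<in> N \<and> j \<in> N" if "(\<Sum>k\<in>K. A k i j) \<noteq> 0" for i j
    using nz[OF that] assms unfolding rcf_def by blast
  ultimately show ?thesis
    unfolding rcf_def by blast
qed

lemma rcf_idm [simp]: "rcf N (idm N)"
  by (auto simp: rcf_def idm_def)

lemma rcf_kron:
  assumes "rcf N A" "rcf M B"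
  shows "rcf (N \<times> M) (kron A B)"
proof -
  have "finite {q. kron A B p q \<noteq> 0}" for p
    by (rule finite_subset[of _ "{j. A (fst p) j \<noteq> 0} \<times> {j. B (snd p) j \<noteq> 0}"])
       (use assms in \<open>auto simp: rcf_def kron_def\<close>)
  moreover have "finite {p. kron A B p q \<noteq> 0}" for q
    by (rule finite_subset[of _ "{i. A i (fst q) \<noteq> 0} \<times> {i. B i (snd q) \<noteq> 0}"])
       (use assms in \<open>auto simp: rcf_def kron_def\<close>)
  ultimately show ?thesis
    using assms by (auto simp: rcf_def kron_def)
qed

section \<open>Quadratic forms, Gram decompositions and the Schur product theorem\<close>

lemma qform_superset:
  assumes "finite S" "T \<subseteq> S" "\<And>i. i \<in> S - T \<Longrightarrow> x i = 0"
  shows "qform T A x = qform S A x"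
proof -
  have "qform T A x = (\<Sum>i\<in>T. \<Sum>j\<in>S. cnj (x i) * A i j * x j)"
    unfolding qform_def using assms by (intro sum.cong sum.mono_neutral_left) auto
  also have "\<dots> = qform S A x"
    unfolding qform_def using assms by (intro sum.mono_neutral_left) auto
  finally show ?thesis .
qed

lemma qform_sum: "qform S (\<lambda>i j. \<Sum>k\<in>K. A k i j) x = (\<Sum>k\<in>K. qform S (A k) x)"
proof -
  have "qform S (\<lambda>i j. \<Sum>k\<in>K. A k i j) x = (\<Sum>i\<in>S. \<Sum>j\<in>S. \<Sum>k\<in>K. cnj (x i) * A k i j * x j)"
    by (simp add: qform_def sum_distrib_left sum_distrib_right)
  also have "\<dots> = (\<Sum>i\<in>S. \<Sum>k\<in>K. \<Sum>j\<in>S. cnj (x i) * A k i j * x j)"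
    by (intro sum.cong refl sum.swap)
  also have "\<dots> = (\<Sum>k\<in>K. qform S (A k) x)"
    unfolding qform_def by (rule sum.swap)
  finally show ?thesis .
qed

lemma nonneg_Reals_sum: "(\<And>i. i \<in> I \<Longrightarrow> (f i :: complex) \<in> \<real>\<^sub>\<ge>\<^sub>0) \<Longrightarrow> sum f I \<in> \<real>\<^sub>\<ge>\<^sub>0"
  by (induction I rule: infinite_finite_induct) (auto intro: nonneg_Reals_add_I)

lemma psd_sum: "(\<And>k. k \<in> K \<Longrightarrow> psd (A k)) \<Longrightarrow> psd (\<lambda>i j. \<Sum>k\<in>K. A k i j)"
  by (simp add: psd_def qform_sum nonneg_Reals_sum)

text \<open>Complex polarization: that the form is real at the vectors (1, 1) and (1, \<i>) on two
  coordinates fixes the imaginary and the real part of the off-diagonal entry.\<close>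

lemma psd_hermitian:
  assumes "psd A"
  shows "A j i = cnj (A i j)"
proof -
  have d: "A i i \<in> \<real>\<^sub>\<ge>\<^sub>0" for i
    using assms[unfolded psd_def, rule_format, of "{i}" "\<lambda>_. 1"] by (simp add: qform_def)
  show ?thesis
  proof (cases "i = j")
    case True
    with d[of i] show ?thesis
      by (simp add: complex_nonneg_Reals_iff complex_eq_iff)
  next
    case False
    have *: "cnj a * A i i * a + cnj a * A i j * b + (cnj b * A j i * a + cnj b * A j j * b) \<in> \<real>\<^sub>\<ge>\<^sub>0" for a b
      using assms[unfolded psd_def, rule_format, of "{i,j}" "(\<lambda>_. b)(i := a)"] False
      by (simp add: qform_def)
    have "Im (A i i) = 0" "Im (A j j) = 0"
      using d[of i] d[of j] by (simp_all add: complex_nonneg_Reals_iff)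
    moreover have "Im (A i j) + Im (A j i) = 0"
      using *[of 1 1] calculation by (simp add: complex_nonneg_Reals_iff)
    moreover have "Re (A i j) = Re (A j i)"
      using *[of 1 \<i>] calculation by (simp add: complex_nonneg_Reals_iff)
    ultimately show ?thesis
      by (simp add: complex_eq_iff)
  qed
qed

lemma complex_nonneg_of_real: "(z::complex) \<in> \<real>\<^sub>\<ge>\<^sub>0 \<Longrightarrow> z = of_real (Re z) \<and> Re z \<ge> 0"
  by (simp add: complex_nonneg_Reals_iff complex_eq_iff)

lemma qform_insert:
  assumes "finite S" "a \<notin> S"
  shows "qform (insert a S) A x = cnj (x a) * A a a * x a + cnj (x a) * (\<Sum>j\<in>S. A a j * x j)
    + (\<Sum>i\<in>S. cnj (x i) * A i a) * x a + qform S A x"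
  using assms
  by (simp add: qform_def sum.distrib sum_distrib_left sum_distrib_right algebra_simps)

text \<open>Cholesky decomposition, by Schur complements.\<close>

lemma psd_on_gram:
  fixes A :: "'i cmat"
  assumes "finite S" "\<And>x. qform S A x \<in> \<real>\<^sub>\<ge>\<^sub>0" "\<And>i j. A j i = cnj (A i j)"
  shows "\<exists>(n::nat) g. \<forall>i\<in>S. \<forall>j\<in>S. A i j = (\<Sum>k<n. g k i * cnj (g k j))"
  using assms
proof (induction S arbitrary: A rule: finite_induct)
  case empty
  show ?case by simp
next
  case (insert a S)
  note ps = insert.prems(1) and herm = insert.prems(2)
  have q: "cnj t * A a a * t + cnj t * (\<Sum>j\<in>S. A a j * x j)
    + (\<Sum>i\<in>S. cnj (x i) * A i a) * t + qform S A x \<in> \<real>\<^sub>\<ge>\<^sub>0" for t x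
  proof -
    have "qform S A (x(a := t)) = qform S A x" "(\<Sum>j\<in>S. A a j * (x(a := t)) j) = (\<Sum>j\<in>S. A a j * x j)"
       "(\<Sum>i\<in>S. cnj ((x(a := t)) i) * A i a) = (\<Sum>i\<in>S. cnj (x i) * A i a)"
      using insert.hyps unfolding qform_def by (auto intro!: sum.cong)
    with ps[of "x(a := t)"] show ?thesis
      by (simp add: qform_insert[OF insert.hyps] add.assoc del: fun_upd_apply)
        (simp add: fun_upd_def)
  qed
  have conj: "(\<Sum>i\<in>S. cnj (x i) * A i a) = cnj (\<Sum>j\<in>S. A a j * x j)" for x
  proof -
    have "A i a = cnj (A a i)" for i
      by (rule herm)
    then show ?thesis
      by (simp only: cnj_sum complex_cnj_mult mult.commute)
  qed
  have daa: "A a a = of_real (Re (A a a))" "Re (A a a) \<ge> 0"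
    using q[of 1 "\<lambda>_. 0"] complex_nonneg_of_real by (auto simp: qform_def)
  show ?case
  proof (cases "A a a = 0")
    case True
    \<comment> \<open>A zero pivot forces a zero row: with coordinate \<open>t\<close> at
      \<open>a\<close> and 1 at \<open>j\<close>, the form is real-affine in \<open>t\<close>, hence
      unbounded below unless \<open>A a j = 0\<close>.\<close>
    have zero: "A a j = 0" if "j \<in> S" for j
    proof (rule ccontr)
      assume nz: "A a j \<noteq> 0"
      define c where "c = A a j"
      define r where "r = Re (A j j)"
      have xs: "(\<Sum>l\<in>S. A a l * (if l = j then 1 else 0)) = c"
        using that insert.hyps by (simp add: c_def if_distrib[of "\<lambda>t. _ * t"] cong: if_cong)
      have qs: "qform S A (\<lambda>l. if l = j then 1 else 0) = A j j"
        using that insert.hyps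
        by (simp add: qform_def if_distrib[of "\<lambda>t. _ * t"] if_distrib[of cnj] if_distrib[of "\<lambda>t. t * _"] cong: if_cong)
      have "cnj t * c + cnj c * t + A j j \<in> \<real>\<^sub>\<ge>\<^sub>0" for t
        using q[of t "\<lambda>l. if l = j then 1 else 0"] unfolding conj xs qs True by simp
      note ge = this
      \<comment> \<open>This \<open>s\<close> makes the mixed term equal to - 2 (|r| + 1), which
        outweighs the remaining term \<open>r\<close>.\<close>
      define s where "s = (\<bar>r\<bar> + 1) / (cmod c)\<^sup>2"
      define t where "t = - of_real s * c"
      have "cnj t * c + cnj c * t = - of_real (2 * s) * (c * cnj c)"
        by (simp add: t_def algebra_simps)
      also have "\<dots> = of_real (- (2 * (\<bar>r\<bar> + 1)))"
        using nz unfolding complex_norm_square[symmetric] s_def c_def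
        by (simp flip: of_real_mult of_real_power)
      finally have "of_real (- (2 * (\<bar>r\<bar> + 1))) + A j j \<in> \<real>\<^sub>\<ge>\<^sub>0"
        using ge[of t] by metis
      then have "2 * (\<bar>r\<bar> + 1) \<le> r"
        by (simp add: complex_nonneg_Reals_iff r_def)
      then show False
        by simp
    qed
    have zero': "A j a = 0" if "j \<in> S" for j
      using zero[OF that] herm[of j a] by (metis complex_cnj_zero_iff)
    have "qform S A x \<in> \<real>\<^sub>\<ge>\<^sub>0" for x
      using q[of 0 x] by simp
    then obtain n g where g: "\<forall>i\<in>S. \<forall>j\<in>S. A i j = (\<Sum>k<n::nat. g k i * cnj (g k j))"
      using insert.IH[of A] herm by blast
    have "\<forall>i\<in>insert a S. \<forall>j\<in>insert a S. A i j = (\<Sum>k<n. (if i = a then 0 else g k i) * cnj (if j = a then 0 else g k j))"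
      using g True zero zero' insert.hyps by auto (rule sum.cong, auto)
    then show ?thesis
      by (intro exI[of _ n] exI[of _ "\<lambda>k i. if i = a then 0 else g k i"])
  next
    case False
    define d where "d = Re (A a a)"
    have d: "d > 0" "A a a = of_real d"
      using False daa by (auto simp: d_def complex_eq_iff less_le)
    define B where "B i j = A i j - A i a * A a j / d" for i j
    have "qform S B x \<in> \<real>\<^sub>\<ge>\<^sub>0" for x
    proof -
      define s where "s = (\<Sum>j\<in>S. A a j * x j)"
      have "qform S B x = qform S A x - (\<Sum>i\<in>S. cnj (x i) * A i a) * s / d"
        unfolding qform_def B_def s_def sum_product sum_divide_distrib sum_subtractf[symmetric]
        by (intro sum.cong refl) (simp add: algebra_simps)
      \<comment> \<open>Completing the square: at \<open>t = - s / d\<close> the form of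
        \<open>A\<close> on \<open>insert a S\<close> takes its minimum over \<open>t\<close>, and
        this minimum is the form of \<open>B\<close>.\<close>
      also have "\<dots> = cnj (- s / d) * A a a * (- s / d) + cnj (- s / d) * s + cnj s * (- s / d) + qform S A x"
        using d conj by (simp add: s_def field_simps)
      also have "\<dots> \<in> \<real>\<^sub>\<ge>\<^sub>0"
        using q[of "- s / d" x] unfolding conj s_def .
      finally show ?thesis .
    qed
    moreover have "B j i = cnj (B i j)" for i j
      using herm[of i j] herm[of i a] herm[of a j] by (simp add: B_def mult.commute)
    ultimately obtain n g where g: "\<forall>i\<in>S. \<forall>j\<in>S. B i j = (\<Sum>k<n::nat. g k i * cnj (g k j))"
      using insert.IH[of B] by blast
    \<comment> \<open>The new index \<open>n\<close> carries the normalised pivot column. The old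
      vectors are set to 0 at \<open>a\<close>, where the induction hypothesis says nothing about
      them.\<close>
    define h where "h k i = (if k = n then A i a / sqrt d else if i = a then 0 else g k i)" for k i
    have "A i j = (\<Sum>k<Suc n. h k i * cnj (h k j))" if ij: "i \<in> insert a S" "j \<in> insert a S" for i j
    proof -
      have "h n i * cnj (h n j) = A i a * A a j / d"
        using d herm[of j a] by (simp add: h_def power2_eq_square[symmetric] of_real_power[symmetric] del: of_real_power)
      moreover have "(\<Sum>k<n. h k i * cnj (h k j)) = B i j"
      proof (cases "i = a \<or> j = a")
        case True
        then have "(\<Sum>k<n. h k i * cnj (h k j)) = 0"
          by (intro sum.neutral) (auto simp: h_def)
        also have "0 = B i j"
          using True d by (auto simp: B_def)
        finally show ?thesis .
      next
        case False
        then show ?thesis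
          using ij g by (auto simp: h_def)
      qed
      ultimately show ?thesis
        by (simp add: B_def)
    qed
    then show ?thesis by blast
  qed
qed

text \<open>The Schur product theorem in Kronecker form: a Gram decomposition of \<open>B\<close> turns the
  quadratic form of the product into a sum of quadratic forms of \<open>A\<close>.\<close>

lemma psd_kron:
  assumes A: "psd A" and B: "psd B"
  shows "psd (kron A B)"
  unfolding psd_def
proof (intro allI impI)
  fix S :: "('a \<times> 'b) set" and x :: "'a \<times> 'b \<Rightarrow> complex"
  assume S: "finite S"
  define S1 S2 where "S1 = fst ` S" and "S2 = snd ` S"
  have fin: "finite S1" "finite S2" and sub: "S \<subseteq> S1 \<times> S2"
    using S by (auto simp: S1_def S2_def image_iff intro: fst_conv snd_conv) force+
  \<comment> \<open>Extension by 0 replaces the arbitrary finite set \<open>S\<close> by a rectangle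
    containing it.\<close>
  define y where "y p = (if p \<in> S then x p else 0)" for p
  have "\<And>z. qform S2 B z \<in> \<real>\<^sub>\<ge>\<^sub>0"
    using B fin unfolding psd_def by blast
  then obtain n g where g: "\<forall>i\<in>S2. \<forall>j\<in>S2. B i j = (\<Sum>k<n::nat. g k i * cnj (g k j))"
    using psd_on_gram[OF fin(2), of B] psd_hermitian[OF B] by blast
  \<comment> \<open>Contracting the second index of \<open>y\<close> with the \<open>k\<close>-th
    Gram vector of \<open>B\<close> gives the vector at which the form of \<open>A\<close> is taken;
    the chain below only reorders sums.\<close>
  define z where "z k i = (\<Sum>j\<in>S2. cnj (g k j) * y (i, j))" for k i
  let ?t = "\<lambda>i j i' j' k. cnj (cnj (g k j) * y (i, j)) * A i i' * (cnj (g k j') * y (i', j'))"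
  have "qform S (kron A B) x = qform S (kron A B) y"
    by (simp add: qform_def y_def)
  also have "\<dots> = qform (S1 \<times> S2) (kron A B) y"
    using fin sub by (intro qform_superset) (auto simp: y_def)
  also have "\<dots> = (\<Sum>i\<in>S1. \<Sum>j\<in>S2. \<Sum>i'\<in>S1. \<Sum>j'\<in>S2. \<Sum>k<n. ?t i j i' j' k)"
    using g
    by (auto simp: qform_def kron_def sum.cartesian_product' sum_distrib_left sum_distrib_right
        algebra_simps intro!: sum.cong)
  also have "\<dots> = (\<Sum>i\<in>S1. \<Sum>j\<in>S2. \<Sum>i'\<in>S1. \<Sum>k<n. \<Sum>j'\<in>S2. ?t i j i' j' k)"
    by (intro sum.cong refl sum.swap)
  also have "\<dots> = (\<Sum>i\<in>S1. \<Sum>j\<in>S2. \<Sum>k<n. \<Sum>i'\<in>S1. \<Sum>j'\<in>S2. ?t i j i' j' k)"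
    by (intro sum.cong refl sum.swap)
  also have "\<dots> = (\<Sum>i\<in>S1. \<Sum>k<n. \<Sum>j\<in>S2. \<Sum>i'\<in>S1. \<Sum>j'\<in>S2. ?t i j i' j' k)"
    by (intro sum.cong refl sum.swap)
  also have "\<dots> = (\<Sum>k<n. \<Sum>i\<in>S1. \<Sum>j\<in>S2. \<Sum>i'\<in>S1. \<Sum>j'\<in>S2. ?t i j i' j' k)"
    by (rule sum.swap)
  also have "\<dots> = (\<Sum>k<n. \<Sum>i\<in>S1. \<Sum>i'\<in>S1. \<Sum>j\<in>S2. \<Sum>j'\<in>S2. ?t i j i' j' k)"
    by (intro sum.cong refl sum.swap)
  also have "\<dots> = (\<Sum>k<n. qform S1 A (z k))"
    unfolding qform_def z_def
    by (simp only: cnj_sum sum_distrib_left sum_distrib_right) (intro sum.cong refl sum.swap)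
  also have "\<dots> \<in> \<real>\<^sub>\<ge>\<^sub>0"
    using A fin by (intro nonneg_Reals_sum) (auto simp: psd_def)
  finally show "qform S (kron A B) x \<in> \<real>\<^sub>\<ge>\<^sub>0" .
qed

section \<open>Kronecker composition of POVM families\<close>

lemma kron_idm: "kron (idm N) (idm M) = idm (N \<times> M)"
  by (auto simp: fun_eq_iff kron_def idm_def)

lemma kron_sum_right: "(\<Sum>k\<in>K. kron A (B k) p q) = kron A (\<lambda>i j. \<Sum>k\<in>K. B k i j) p q"
  by (simp add: kron_def sum_distrib_left)

lemma kron_sum_left: "(\<Sum>k\<in>K. kron (A k) B p q) = kron (\<lambda>i j. \<Sum>k\<in>K. A k i j) B p q"
  by (simp add: kron_def sum_distrib_right)

lemma qform_idm:
  assumes "finite S"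
  shows "qform S (idm N) x = (\<Sum>i\<in>S. if i \<in> N then cnj (x i) * x i else 0)"
  unfolding qform_def
proof (intro sum.cong refl)
  fix i assume "i \<in> S"
  then have "(\<Sum>j\<in>S. cnj (x i) * idm N i j * x j) = (\<Sum>j\<in>S. if i = j then (if i \<in> N then cnj (x i) * x i else 0) else 0)"
    by (intro sum.cong) (auto simp: idm_def)
  with assms \<open>i \<in> S\<close> show "(\<Sum>j\<in>S. cnj (x i) * idm N i j * x j) = (if i \<in> N then cnj (x i) * x i else 0)"
    by simp
qed

lemma psd_idm [simp]: "psd (idm N)"
  by (auto simp: psd_def qform_idm intro!: nonneg_Reals_sum) (simp add: complex_nonneg_Reals_iff)

text \<open>Summing over \<open>z\<close> first collapses each row of \<open>B\<close> to the
  identity; the remaining sum over \<open>y\<close> then collapses row \<open>x\<close> of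
  \<open>A\<close>.\<close>

lemma compose_fam_mpovm_rows:
  assumes A: "mpovm N Y (A x)" and B: "\<And>y. y \<in> Y \<Longrightarrow> mpovm M Z (B y)" and Z: "finite Z"
  shows "mpovm (N \<times> M) Z (compose_fam Y A B x)"
proof -
  have "finite Y" using A by (simp add: mpovm_def)
  have "rcf (N \<times> M) (compose_fam Y A B x z)" "psd (compose_fam Y A B x z)" if "z \<in> Z" for z
    using A B \<open>finite Y\<close> that unfolding compose_fam_def[abs_def] mpovm_def
    by (auto intro!: rcf_sum psd_sum rcf_kron psd_kron)
  moreover have "(\<Sum>z\<in>Z. compose_fam Y A B x z p q) = idm (N \<times> M) p q" for p q
  proof -
    have "(\<Sum>z\<in>Z. compose_fam Y A B x z p q) = (\<Sum>y\<in>Y. \<Sum>z\<in>Z. kron (A x y) (B y z) p q)"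
      unfolding compose_fam_def by (rule sum.swap)
    also have "\<dots> = (\<Sum>y\<in>Y. kron (A x y) (idm M) p q)"
      using B unfolding kron_sum_right by (intro sum.cong refl) (simp add: mpovm_def)
    also have "\<dots> = kron (idm N) (idm M) p q"
      using A unfolding kron_sum_left by (simp add: mpovm_def)
    finally show ?thesis by (simp add: kron_idm)
  qed
  ultimately show ?thesis using Z by (auto simp: mpovm_def)
qed

text \<open>Here the sum over \<open>x\<close> comes first and uses the columns of \<open>A\<close>;
  the column \<open>z\<close> of \<open>B\<close> finishes it.\<close>

lemma compose_fam_mpovm_cols:
  assumes B: "mpovm M Y (\<lambda>y. B y z)" and A: "\<And>y. y \<in> Y \<Longrightarrow> mpovm N X (\<lambda>x. A x y)" and X: "finite X"
  shows "mpovm (N \<times> M) X (\<lambda>x. compose_fam Y A B x z)"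
proof -
  have "finite Y" using B by (simp add: mpovm_def)
  have "rcf (N \<times> M) (compose_fam Y A B x z)" "psd (compose_fam Y A B x z)" if "x \<in> X" for x
    using A B \<open>finite Y\<close> that unfolding compose_fam_def[abs_def] mpovm_def
    by (auto intro!: rcf_sum psd_sum rcf_kron psd_kron)
  moreover have "(\<Sum>x\<in>X. compose_fam Y A B x z p q) = idm (N \<times> M) p q" for p q
  proof -
    have "(\<Sum>x\<in>X. compose_fam Y A B x z p q) = (\<Sum>y\<in>Y. \<Sum>x\<in>X. kron (A x y) (B y z) p q)"
      unfolding compose_fam_def by (rule sum.swap)
    also have "\<dots> = (\<Sum>y\<in>Y. kron (idm N) (B y z) p q)"
      using A unfolding kron_sum_left by (intro sum.cong refl) (simp add: mpovm_def)
    also have "\<dots> = kron (idm N) (idm M) p q"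
      using B unfolding kron_sum_right by (simp add: mpovm_def)
    finally show ?thesis by (simp add: kron_idm)
  qed
  ultimately show ?thesis using X by (auto simp: mpovm_def)
qed

lemma mfam_compose:
  assumes "finite X" "finite Z" "mfam b N X Y A" "mfam b M Y Z B"
  shows "mfam b (N \<times> M) X Z (compose_fam Y A B)"
  using assms unfolding mfam_def
  by (auto intro!: compose_fam_mpovm_rows compose_fam_mpovm_cols)

section \<open>Square summable families and matrices acting on them\<close>

definition sq_summable :: "'i set \<Rightarrow> ('i \<Rightarrow> complex) set" where
  "sq_summable N = {f. (\<forall>i. i \<notin> N \<longrightarrow> f i = 0) \<and> (\<lambda>i. (cmod (f i))\<^sup>2) summable_on UNIV}"

definition iprod :: "('i \<Rightarrow> complex) \<Rightarrow> ('i \<Rightarrow> complex) \<Rightarrow> complex" where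
  "iprod f g = (\<Sum>\<^sub>\<infinity>i. f i * cnj (g i))"

definition sqnorm :: "('i \<Rightarrow> complex) \<Rightarrow> real" where
  "sqnorm f = (\<Sum>\<^sub>\<infinity>i. (cmod (f i))\<^sup>2)"

lemma sq_summableI:
  assumes "\<And>i. i \<notin> N \<Longrightarrow> f i = 0" "\<And>F. finite F \<Longrightarrow> (\<Sum>i\<in>F. (cmod (f i))\<^sup>2) \<le> B"
  shows "f \<in> sq_summable N" and "sqnorm f \<le> B"
proof -
  have "(\<lambda>i. (cmod (f i))\<^sup>2) summable_on UNIV"
    using assms(2) by (intro nonneg_bdd_above_summable_on bdd_aboveI[of _ B]) auto
  then show "f \<in> sq_summable N" "sqnorm f \<le> B"
    using assms by (auto simp: sq_summable_def sqnorm_def intro!: infsum_le_finite_sums)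
qed

lemma sum_le_sqnorm: "f \<in> sq_summable N \<Longrightarrow> finite F \<Longrightarrow> (\<Sum>i\<in>F. (cmod (f i))\<^sup>2) \<le> sqnorm f"
  unfolding sqnorm_def sq_summable_def by (intro finite_sum_le_infsum) auto

lemma sqnorm_nonneg: "sqnorm f \<ge> 0"
  unfolding sqnorm_def by (intro infsum_nonneg) auto

lemma norm_le_sqnorm: "f \<in> sq_summable N \<Longrightarrow> (cmod (f i))\<^sup>2 \<le> sqnorm f"
  using sum_le_sqnorm[of f N "{i}"] by simp

lemma sq_summable_zero: "(\<lambda>_. 0) \<in> sq_summable N"
  by (simp add: sq_summable_def)

lemma sq_summable_smult: "f \<in> sq_summable N \<Longrightarrow> (\<lambda>i. c * f i) \<in> sq_summable N"
  unfolding sq_summable_def by (auto simp: norm_mult power_mult_distrib intro: summable_on_cmult_right)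

lemma sq_summable_add:
  assumes "f \<in> sq_summable N" "g \<in> sq_summable N"
  shows "(\<lambda>i. f i + g i) \<in> sq_summable N"
proof -
  have "(cmod (f i + g i))\<^sup>2 \<le> 2 * (cmod (f i))\<^sup>2 + 2 * (cmod (g i))\<^sup>2" for i
  proof -
    have "(cmod (f i + g i))\<^sup>2 \<le> (cmod (f i) + cmod (g i))\<^sup>2"
      by (intro power_mono norm_triangle_ineq) auto
    also have "\<dots> \<le> 2 * (cmod (f i))\<^sup>2 + 2 * (cmod (g i))\<^sup>2"
      using sum_squares_bound[of "cmod (f i)" "cmod (g i)"] by (simp add: power2_sum)
    finally show ?thesis .
  qed
  then have "(\<Sum>i\<in>F. (cmod (f i + g i))\<^sup>2) \<le> 2 * sqnorm f + 2 * sqnorm g" if "finite F" for F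
  proof -
    have "(\<Sum>i\<in>F. (cmod (f i + g i))\<^sup>2) \<le> (\<Sum>i\<in>F. 2 * (cmod (f i))\<^sup>2 + 2 * (cmod (g i))\<^sup>2)"
      using \<open>\<And>i. (cmod (f i + g i))\<^sup>2 \<le> 2 * (cmod (f i))\<^sup>2 + 2 * (cmod (g i))\<^sup>2\<close> by (intro sum_mono)
    also have "\<dots> \<le> 2 * sqnorm f + 2 * sqnorm g"
      using sum_le_sqnorm[OF assms(1) that] sum_le_sqnorm[OF assms(2) that]
      by (simp add: sum.distrib sum_distrib_left[symmetric])
    finally show ?thesis .
  qed
  then show ?thesis
    using assms by (intro sq_summableI(1)) (auto simp: sq_summable_def)
qed

lemma sq_summable_diff:
  assumes "f \<in> sq_summable N" "g \<in> sq_summable N"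
  shows "(\<lambda>i. f i - g i) \<in> sq_summable N"
  using sq_summable_add[OF assms(1) sq_summable_smult[OF assms(2), of "-1"]] by simp

lemma sq_summable_finite: "finite S \<Longrightarrow> S \<subseteq> N \<Longrightarrow> (\<And>i. i \<notin> S \<Longrightarrow> f i = 0) \<Longrightarrow> f \<in> sq_summable N"
  unfolding sq_summable_def
  by (auto intro!: finite_nonzero_values_imp_summable_on finite_subset[of _ S]) metis

lemma iprod_summable:
  assumes "f \<in> sq_summable N" "g \<in> sq_summable N"
  shows "(\<lambda>i. f i * cnj (g i)) summable_on UNIV"
proof -
  have "(\<lambda>i. norm (f i * f i)) summable_on UNIV" "(\<lambda>i. norm (cnj (g i) * cnj (g i))) summable_on UNIV"
    using assms by (auto simp: sq_summable_def norm_mult power2_eq_square)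
  from abs_summable_product[OF this] show ?thesis
    by (rule abs_summable_summable)
qed

lemma iprod_add_left:
  "f \<in> sq_summable N \<Longrightarrow> f' \<in> sq_summable N \<Longrightarrow> g \<in> sq_summable N \<Longrightarrow>
   iprod (\<lambda>i. f i + f' i) g = iprod f g + iprod f' g"
  unfolding iprod_def using iprod_summable[of f N g] iprod_summable[of f' N g]
  by (simp add: distrib_right infsum_add)

lemma iprod_smult_left: "iprod (\<lambda>i. c * f i) g = c * iprod f g"
  unfolding iprod_def by (simp add: mult.assoc infsum_cmult_right')

lemma iprod_commute: "iprod f g = cnj (iprod g f)"
  unfolding iprod_def by (simp add: mult.commute flip: infsum_cnj)

lemma iprod_self:
  assumes "f \<in> sq_summable N"
  shows "iprod f f = of_real (sqnorm f)"
proof -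
  have "iprod f f = (\<Sum>\<^sub>\<infinity>i. of_real ((cmod (f i))\<^sup>2))"
    unfolding iprod_def by (intro infsum_cong) (simp add: complex_norm_square del: of_real_power)
  also have "\<dots> = of_real (sqnorm f)"
    unfolding sqnorm_def using assms
    by (intro infsumI has_sum_of_real has_sum_infsum) (simp add: sq_summable_def)
  finally show ?thesis .
qed

lemma iprod_finite:
  assumes "finite S" "\<And>i. i \<notin> S \<Longrightarrow> f i = 0 \<or> g i = 0"
  shows "iprod f g = (\<Sum>i\<in>S. f i * cnj (g i))"
proof -
  have "iprod f g = (\<Sum>\<^sub>\<infinity>i\<in>S. f i * cnj (g i))"
    unfolding iprod_def using assms(2) by (intro infsum_cong_neutral) auto
  then show ?thesis using assms(1) by simp
qed

abbreviation coords :: "(('i \<Rightarrow> complex) \<Rightarrow> 'h) \<Rightarrow> 'h \<Rightarrow> 'i \<Rightarrow> complex" where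
  "coords \<equiv> inv_into UNIV"

text \<open>The Hilbert space of square summable families on \<open>N\<close>, carried into
  \<open>'h\<close> along an injection \<open>\<iota>\<close> because the definitions of the
  correlation types quantify over carriers inside \<open>'h\<close>. All operations are computed on
  coordinates and carried back.\<close>

definition ell2 :: "(('i \<Rightarrow> complex) \<Rightarrow> 'h) \<Rightarrow> 'i set \<Rightarrow> 'h hilbert" where
  "ell2 \<iota> N = \<lparr>carrier = \<iota> ` sq_summable N, monoid.mult = undefined, one = undefined,
     zero = \<iota> (\<lambda>_. 0), add = (\<lambda>x y. \<iota> (\<lambda>i. coords \<iota> x i + coords \<iota> y i)),
     module.smult = (\<lambda>c x. \<iota> (\<lambda>i. c * coords \<iota> x i)), hinner = (\<lambda>x y. iprod (coords \<iota> x) (coords \<iota> y))\<rparr>"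

text \<open>With finite rows this needs no convergence and makes sense on all functions; square
  summability matters only for norms and inner products.\<close>

definition mapp :: "'i cmat \<Rightarrow> ('i \<Rightarrow> complex) \<Rightarrow> 'i \<Rightarrow> complex" where
  "mapp A f i = (\<Sum>j | A i j \<noteq> 0. A i j * f j)"

definition mop :: "(('i \<Rightarrow> complex) \<Rightarrow> 'h) \<Rightarrow> 'i cmat \<Rightarrow> 'h \<Rightarrow> 'h" where
  "mop \<iota> A x = \<iota> (mapp A (coords \<iota> x))"

section \<open>Row-finite matrices as operators\<close>

lemma cring_complex_ring: "cring complex_ring"
proof (rule cringI)
  show "abelian_group complex_ring"
  proof (rule abelian_groupI)
    fix x :: complex
    show "\<exists>y\<in>carrier complex_ring. y \<oplus>\<^bsub>complex_ring\<^esub> x = \<zero>\<^bsub>complex_ring\<^esub>"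
      by (auto simp: complex_ring_def intro: exI[of _ "- x"])
  qed (auto simp: complex_ring_def)
  show "Group.comm_monoid complex_ring"
    by (rule comm_monoidI) (auto simp: complex_ring_def)
qed (auto simp: complex_ring_def algebra_simps)

lemma mapp_superset:
  assumes "finite S" "{j. A i j \<noteq> 0} \<subseteq> S"
  shows "mapp A f i = (\<Sum>j\<in>S. A i j * f j)"
  unfolding mapp_def using assms by (intro sum.mono_neutral_left) auto

lemma mapp_support:
  assumes "finite S" "finite {j. A i j \<noteq> 0}" "\<And>j. j \<notin> S \<Longrightarrow> f j = 0"
  shows "mapp A f i = (\<Sum>j\<in>S. A i j * f j)"
proof -
  have "mapp A f i = (\<Sum>j\<in>S \<union> {j. A i j \<noteq> 0}. A i j * f j)"
    using assms by (intro mapp_superset) auto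
  also have "\<dots> = (\<Sum>j\<in>S. A i j * f j)"
    using assms by (intro sum.mono_neutral_right) auto
  finally show ?thesis .
qed

lemma mapp_add: "mapp A (\<lambda>j. f j + g j) = (\<lambda>i. mapp A f i + mapp A g i)"
  by (simp add: mapp_def fun_eq_iff distrib_left sum.distrib)

lemma mapp_diff: "mapp A (\<lambda>j. f j - g j) = (\<lambda>i. mapp A f i - mapp A g i)"
  by (simp add: mapp_def fun_eq_iff right_diff_distrib sum_subtractf)

lemma mapp_smult: "mapp A (\<lambda>j. c * f j) = (\<lambda>i. c * mapp A f i)"
  by (simp add: mapp_def fun_eq_iff sum_distrib_left algebra_simps)

lemma mapp_zero_outside: "rcf N A \<Longrightarrow> i \<notin> N \<Longrightarrow> mapp A f i = 0"
  unfolding mapp_def rcf_def by (intro sum.neutral) auto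

lemma mmul_nonzero: "mmul A B i k \<noteq> 0 \<Longrightarrow> \<exists>j. A i j \<noteq> 0 \<and> B j k \<noteq> 0"
  unfolding mmul_def by (auto elim!: sum.not_neutral_contains_not_neutral)

lemma mmul_row_finite:
  assumes "rcf N A" "rcf N B"
  shows "finite {k. mmul A B i k \<noteq> 0}"
proof (rule finite_subset)
  show "{k. mmul A B i k \<noteq> 0} \<subseteq> (\<Union>j\<in>{j. A i j \<noteq> 0}. {k. B j k \<noteq> 0})"
    using mmul_nonzero by fastforce
  show "finite (\<Union>j\<in>{j. A i j \<noteq> 0}. {k. B j k \<noteq> 0})"
    using assms by (auto simp: rcf_def)
qed

lemma mapp_mmul:
  assumes "rcf N A" "rcf N B"
  shows "mapp A (mapp B f) = mapp (mmul A B) f"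
proof
  fix i
  define S where "S = {j. A i j \<noteq> 0}"
  \<comment> \<open>The supports of all rows of \<open>B\<close> reached from row \<open>i\<close>
    of \<open>A\<close>, so that both sums run over fixed finite sets and can be exchanged.\<close>
  define T where "T = (\<Union>j\<in>S. {k. B j k \<noteq> 0})"
  have fin: "finite S" "finite T"
    using assms by (auto simp: S_def T_def rcf_def)
  have "mapp A (mapp B f) i = (\<Sum>j\<in>S. A i j * (\<Sum>k\<in>T. B j k * f k))"
    unfolding mapp_def[of A] S_def[symmetric]
    using fin by (intro sum.cong refl arg_cong2[of _ _ _ _ "(*)"] mapp_superset) (auto simp: T_def)
  also have "\<dots> = (\<Sum>j\<in>S. \<Sum>k\<in>T. A i j * B j k * f k)"
    by (simp add: sum_distrib_left mult.assoc)
  also have "\<dots> = (\<Sum>k\<in>T. \<Sum>j\<in>S. A i j * B j k * f k)"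
    by (rule sum.swap)
  also have "\<dots> = (\<Sum>k\<in>T. mmul A B i k * f k)"
    by (simp add: mmul_def S_def sum_distrib_right)
  also have "\<dots> = mapp (mmul A B) f i"
    using fin mmul_nonzero[of A B i] by (intro mapp_superset[symmetric]) (fastforce simp: T_def S_def)+
  finally show "mapp A (mapp B f) i = mapp (mmul A B) f i" .
qed

lemma qform_idm_le:
  assumes "finite T"
  shows "Re (qform T (idm N) f) \<le> (\<Sum>i\<in>T. (cmod (f i))\<^sup>2)"
  unfolding qform_idm[OF assms] Re_sum
  by (intro sum_mono) (auto simp: cmod_power2, simp add: power2_eq_square)

text \<open>With \<open>g = A f\<close>, positivity of \<open>A\<close> at \<open>f - g\<close> reads
  \<open>2 \<parallel>g\<parallel>\<^sup>2 \<le> \<langle>A f, f\<rangle> + \<langle>A g, g\<rangle> \<le> \<parallel>f\<parallel>\<^sup>2 + \<parallel>g\<parallel>\<^sup>2\<close>.\<close>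

lemma psd_contraction_finite:
  fixes A :: "'i cmat"
  assumes A: "psd A" and c: "psd (\<lambda>i j. idm N i j - A i j)" and T: "finite T"
  shows "(\<Sum>i\<in>T. (cmod (\<Sum>j\<in>T. A i j * f j))\<^sup>2) \<le> (\<Sum>i\<in>T. (cmod (f i))\<^sup>2)"
proof -
  define g where "g i = (\<Sum>j\<in>T. A i j * f j)" for i
  have le: "Re (qform T A h) \<le> (\<Sum>i\<in>T. (cmod (h i))\<^sup>2)" for h
  proof -
    have "qform T (\<lambda>i j. idm N i j - A i j) h = qform T (idm N) h - qform T A h"
      by (simp add: qform_def algebra_simps sum_subtractf)
    moreover have "qform T (\<lambda>i j. idm N i j - A i j) h \<in> \<real>\<^sub>\<ge>\<^sub>0"
      using c T by (simp add: psd_def)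
    ultimately show ?thesis
      using qform_idm_le[OF T, of N h] by (simp add: complex_nonneg_Reals_iff)
  qed
  have gf: "(\<Sum>i\<in>T. \<Sum>j\<in>T. cnj (g i) * A i j * f j) = of_real (\<Sum>i\<in>T. (cmod (g i))\<^sup>2)"
    unfolding of_real_sum
  proof (intro sum.cong refl)
    fix i
    have "(\<Sum>j\<in>T. cnj (g i) * A i j * f j) = cnj (g i) * g i"
      by (simp add: g_def sum_distrib_left mult.assoc)
    then show "(\<Sum>j\<in>T. cnj (g i) * A i j * f j) = of_real ((cmod (g i))\<^sup>2)"
      by (simp add: complex_norm_square mult.commute del: of_real_power)
  qed
  have "(\<Sum>i\<in>T. \<Sum>j\<in>T. cnj (f i) * A i j * g j) = (\<Sum>j\<in>T. \<Sum>i\<in>T. cnj (f i) * A i j * g j)"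
    by (rule sum.swap)
  also have "\<dots> = cnj (\<Sum>j\<in>T. \<Sum>i\<in>T. cnj (g j) * A j i * f i)"
    unfolding cnj_sum
    by (intro sum.cong refl) (simp add: psd_hermitian[OF A, symmetric] mult.commute mult.left_commute)
  finally have fg: "(\<Sum>i\<in>T. \<Sum>j\<in>T. cnj (f i) * A i j * g j) = of_real (\<Sum>i\<in>T. (cmod (g i))\<^sup>2)"
    unfolding gf by simp
  have "qform T A (\<lambda>i. f i - g i) = qform T A f + qform T A g
      - (\<Sum>i\<in>T. \<Sum>j\<in>T. cnj (g i) * A i j * f j) - (\<Sum>i\<in>T. \<Sum>j\<in>T. cnj (f i) * A i j * g j)"
    by (simp add: qform_def algebra_simps sum_subtractf sum.distrib)
  moreover have "qform T A (\<lambda>i. f i - g i) \<in> \<real>\<^sub>\<ge>\<^sub>0"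
    using A T by (simp add: psd_def)
  ultimately have "2 * (\<Sum>i\<in>T. (cmod (g i))\<^sup>2) \<le> Re (qform T A f) + Re (qform T A g)"
    unfolding gf fg by (simp add: complex_nonneg_Reals_iff del: of_real_sum of_real_power)
  also have "\<dots> \<le> (\<Sum>i\<in>T. (cmod (f i))\<^sup>2) + (\<Sum>i\<in>T. (cmod (g i))\<^sup>2)"
    by (intro add_mono le)
  finally show ?thesis by (simp add: g_def)
qed

text \<open>Matrices with \<open>0 \<le> A \<le> I\<close> in the sense of quadratic forms. By
  \<open>mpovm_contraction\<close> these include all elements of matrix POVMs.\<close>

locale psd_contraction =
  fixes N :: "'i set" and A :: "'i cmat"
  assumes rcf: "rcf N A" and psd: "psd A" and psd_compl: "psd (\<lambda>i j. idm N i j - A i j)"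
begin

lemma sum_mapp_le:
  assumes f: "f \<in> sq_summable M" and F: "finite F"
  shows "(\<Sum>i\<in>F. (cmod (mapp A f i))\<^sup>2) \<le> sqnorm f"
proof -
  \<comment> \<open>Enlarging \<open>F\<close> by the supports of its rows makes the finite block on
    \<open>T\<close> compute \<open>A f\<close> exactly on \<open>F\<close>, so the finite
    dimensional contraction estimate applies.\<close>
  define T where "T = F \<union> (\<Union>i\<in>F. {j. A i j \<noteq> 0})"
  have T: "finite T" "F \<subseteq> T"
    using F rcf by (auto simp: T_def rcf_def)
  have "(\<Sum>i\<in>F. (cmod (mapp A f i))\<^sup>2) = (\<Sum>i\<in>F. (cmod (\<Sum>j\<in>T. A i j * f j))\<^sup>2)"
    using T by (intro sum.cong refl arg_cong[of _ _ "\<lambda>z. (cmod z)\<^sup>2"] mapp_superset) (auto simp: T_def)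
  also have "\<dots> \<le> (\<Sum>i\<in>T. (cmod (\<Sum>j\<in>T. A i j * f j))\<^sup>2)"
    using T by (intro sum_mono2) auto
  also have "\<dots> \<le> (\<Sum>i\<in>T. (cmod (f i))\<^sup>2)"
    using psd_contraction_finite[OF psd psd_compl T(1)] .
  also have "\<dots> \<le> sqnorm f"
    using sum_le_sqnorm[OF f T(1)] .
  finally show ?thesis .
qed

lemma mapp_sq_summable: "f \<in> sq_summable M \<Longrightarrow> mapp A f \<in> sq_summable N"
  and sqnorm_mapp_le: "f \<in> sq_summable M \<Longrightarrow> sqnorm (mapp A f) \<le> sqnorm f"
  using mapp_zero_outside[OF rcf] by (auto intro!: sq_summableI[OF _ sum_mapp_le])

text \<open>The quadratic forms of the truncations of \<open>f\<close> converge to \<open>\<langle>A f, f\<rangle>\<close>.\<close>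

lemma iprod_mapp_nonneg:
  assumes f: "f \<in> sq_summable M"
  shows "iprod (mapp A f) f \<in> \<real>\<^sub>\<ge>\<^sub>0"
proof -
  let ?L = "finite_subsets_at_top (UNIV :: 'i set)"
  define tr where "tr F i = (if i \<in> F then f i else 0)" for F i
  define s where "s F = (\<Sum>i\<in>F. mapp A f i * cnj (f i))" for F
  have fM: "f \<in> sq_summable UNIV"
    using f by (auto simp: sq_summable_def)
  have mA: "mapp A f \<in> sq_summable UNIV"
    using mapp_sq_summable[OF f] by (auto simp: sq_summable_def)
  have s_lim: "(s \<longlongrightarrow> iprod (mapp A f) f) ?L"
    using iprod_summable[OF mA fM]
    unfolding s_def iprod_def using has_sum_def has_sum_infsum by blast
  have n_lim: "((\<lambda>F. \<Sum>i\<in>F. (cmod (f i))\<^sup>2) \<longlongrightarrow> sqnorm f) ?L"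
    using f unfolding sq_summable_def sqnorm_def using has_sum_def has_sum_infsum by blast
  \<comment> \<open>The difference is the pairing over \<open>F\<close> of \<open>A h\<close> with
    \<open>f\<close>, where \<open>h\<close> is the tail of \<open>f\<close> outside
    \<open>F\<close>. Cauchy-Schwarz and the contraction bound for \<open>A h\<close> give the
    product of the norms of the tail and of \<open>f\<close>.\<close>
  have err: "cmod (s F - qform F A f) \<le> sqrt (sqnorm f - (\<Sum>i\<in>F. (cmod (f i))\<^sup>2)) * sqrt (sqnorm f)"
    if F: "finite F" for F
  proof -
    define h where "h i = f i - tr F i" for i
    have "(\<Sum>i\<in>G. (cmod (h i))\<^sup>2) \<le> sqnorm f - (\<Sum>i\<in>F. (cmod (f i))\<^sup>2)" if "finite G" for G
    proof -
      have "(\<Sum>i\<in>G. (cmod (h i))\<^sup>2) = (\<Sum>i\<in>G-F. (cmod (f i))\<^sup>2)"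
        using that by (intro sum.mono_neutral_cong_right) (auto simp: h_def tr_def)
      also have "\<dots> = (\<Sum>i\<in>G \<union> F. (cmod (f i))\<^sup>2) - (\<Sum>i\<in>F. (cmod (f i))\<^sup>2)"
        using sum.subset_diff[of F "G \<union> F" "\<lambda>i. (cmod (f i))\<^sup>2"] F that by (simp add: Un_Diff)
      finally show ?thesis
        using sum_le_sqnorm[OF fM, of "G \<union> F"] F that by simp
    qed
    then have h: "h \<in> sq_summable UNIV" "sqnorm h \<le> sqnorm f - (\<Sum>i\<in>F. (cmod (f i))\<^sup>2)"
      using sq_summableI[of UNIV h] by auto
    have "mapp A (tr F) i = (\<Sum>j\<in>F. A i j * f j)" for i
      using mapp_support[of F A i "tr F"] F rcf by (simp add: tr_def rcf_def)
    then have "qform F A f = (\<Sum>i\<in>F. mapp A (tr F) i * cnj (f i))"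
      unfolding qform_def by (intro sum.cong refl) (simp add: sum_distrib_right sum_distrib_left algebra_simps)
    then have "s F - qform F A f = (\<Sum>i\<in>F. mapp A h i * cnj (f i))"
      unfolding s_def h_def mapp_diff by (simp add: sum_subtractf algebra_simps)
    also have "cmod \<dots> \<le> (\<Sum>i\<in>F. cmod (mapp A h i) * cmod (f i))"
      by (rule order_trans[OF norm_sum]) (simp add: norm_mult)
    also have "\<dots> \<le> L2_set (\<lambda>i. cmod (mapp A h i)) F * L2_set (\<lambda>i. cmod (f i)) F"
      using L2_set_mult_ineq[of "\<lambda>i. cmod (mapp A h i)" "\<lambda>i. cmod (f i)" F] by simp
    also have "\<dots> \<le> sqrt (sqnorm f - (\<Sum>i\<in>F. (cmod (f i))\<^sup>2)) * sqrt (sqnorm f)"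
      unfolding L2_set_def using sum_mapp_le[OF h(1) F] h(2) sum_le_sqnorm[OF f F]
      by (intro mult_mono) (auto simp: sum_nonneg sqnorm_nonneg)
    finally show ?thesis .
  qed
  have "((\<lambda>F. sqrt (sqnorm f - (\<Sum>i\<in>F. (cmod (f i))\<^sup>2)) * sqrt (sqnorm f)) \<longlongrightarrow> sqrt (sqnorm f - sqnorm f) * sqrt (sqnorm f)) ?L"
    by (intro tendsto_intros n_lim)
  then have "((\<lambda>F. sqrt (sqnorm f - (\<Sum>i\<in>F. (cmod (f i))\<^sup>2)) * sqrt (sqnorm f)) \<longlongrightarrow> 0) ?L"
    by simp
  then have "((\<lambda>F. s F - qform F A f) \<longlongrightarrow> 0) ?L"
    by (rule Lim_null_comparison[rotated]) (auto intro!: eventually_finite_subsets_at_top_weakI err)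
  from tendsto_diff[OF s_lim this] have "((\<lambda>F. qform F A f) \<longlongrightarrow> iprod (mapp A f) f) ?L"
    by simp
  then show ?thesis
    using psd unfolding psd_def
    by (rule_tac Lim_in_closed_set[OF closed_nonneg_Reals_complex])
       (auto intro!: eventually_finite_subsets_at_top_weakI)
qed

end

section \<open>The Hilbert space of square summable families\<close>

lemma hnorm_ell2:
  assumes "inj \<iota>" "f \<in> sq_summable N"
  shows "hnorm (ell2 \<iota> N) (\<iota> f) = sqrt (sqnorm f)"
  using assms by (simp add: hnorm_def ell2_def iprod_self)

lemma abelian_group_ell2:
  fixes \<iota> :: "('i \<Rightarrow> complex) \<Rightarrow> 'h"
  assumes \<iota>: "inj \<iota>"
  shows "abelian_group (ell2 \<iota> N)"
proof (rule abelian_groupI)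
  fix x assume "x \<in> carrier (ell2 \<iota> N)"
  then obtain f where f: "f \<in> sq_summable N" "x = \<iota> f"
    by (auto simp: ell2_def)
  have "\<iota> (\<lambda>i. - f i) \<in> carrier (ell2 \<iota> N)"
    using sq_summable_smult[OF f(1), of "-1"] by (simp add: ell2_def)
  moreover have "\<iota> (\<lambda>i. - f i) \<oplus>\<^bsub>ell2 \<iota> N\<^esub> x = \<zero>\<^bsub>ell2 \<iota> N\<^esub>"
    using \<iota> f by (simp add: ell2_def)
  ultimately show "\<exists>y\<in>carrier (ell2 \<iota> N). y \<oplus>\<^bsub>ell2 \<iota> N\<^esub> x = \<zero>\<^bsub>ell2 \<iota> N\<^esub>"
    by blast
qed (use \<iota> in \<open>auto simp: ell2_def sq_summable_zero sq_summable_add add_ac\<close>)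

lemma module_ell2:
  fixes \<iota> :: "('i \<Rightarrow> complex) \<Rightarrow> 'h"
  assumes \<iota>: "inj \<iota>"
  shows "Module.module complex_ring (ell2 \<iota> N)"
  using \<iota> by (intro Module.module.intro module_axioms.intro cring_complex_ring abelian_group_ell2)
    (auto simp: ell2_def complex_ring_def sq_summable_smult algebra_simps)

text \<open>Subtraction in the module goes through an abstractly described additive inverse, so it
  is identified by cancellation instead of by unfolding.\<close>

lemma minus_ell2:
  assumes \<iota>: "inj \<iota>" and f: "f \<in> sq_summable N" and g: "g \<in> sq_summable N"
  shows "\<iota> f \<ominus>\<^bsub>ell2 \<iota> N\<^esub> \<iota> g = \<iota> (\<lambda>i. f i - g i)"
proof -
  interpret Module.module complex_ring "ell2 \<iota> N"
    by (rule module_ell2[OF \<iota>])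
  have c: "\<iota> f \<in> carrier (ell2 \<iota> N)" "\<iota> g \<in> carrier (ell2 \<iota> N)" "\<iota> (\<lambda>i. f i - g i) \<in> carrier (ell2 \<iota> N)"
    using f g sq_summable_diff[OF f g] by (auto simp: ell2_def)
  have "\<iota> f = \<iota> (\<lambda>i. f i - g i) \<oplus>\<^bsub>ell2 \<iota> N\<^esub> \<iota> g"
    using \<iota> by (simp add: ell2_def)
  then have "\<iota> f \<ominus>\<^bsub>ell2 \<iota> N\<^esub> \<iota> g = (\<iota> (\<lambda>i. f i - g i) \<oplus>\<^bsub>ell2 \<iota> N\<^esub> \<iota> g) \<ominus>\<^bsub>ell2 \<iota> N\<^esub> \<iota> g"
    by (rule arg_cong)
  also have "\<dots> = \<iota> (\<lambda>i. f i - g i)"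
    using c by (simp add: M.minus_eq M.a_assoc M.r_neg)
  finally show ?thesis .
qed

lemma finsum_ell2:
  assumes \<iota>: "inj \<iota>" and "finite K" "\<And>k. k \<in> K \<Longrightarrow> f k \<in> sq_summable N"
  shows "(\<Oplus>\<^bsub>ell2 \<iota> N\<^esub>k\<in>K. \<iota> (f k)) = \<iota> (\<lambda>i. \<Sum>k\<in>K. f k i)"
proof -
  interpret Module.module complex_ring "ell2 \<iota> N"
    by (rule module_ell2[OF \<iota>])
  show ?thesis
    using assms(2,3)
  proof (induction K rule: finite_induct)
    case empty
    show ?case by (subst M.finsum_empty) (simp add: ell2_def)
  next
    case (insert a K)
    have "(\<lambda>k. \<iota> (f k)) \<in> K \<rightarrow> carrier (ell2 \<iota> N)" "\<iota> (f a) \<in> carrier (ell2 \<iota> N)"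
      using insert.prems by (auto simp: ell2_def)
    with insert have "(\<Oplus>\<^bsub>ell2 \<iota> N\<^esub>k\<in>insert a K. \<iota> (f k)) = \<iota> (f a) \<oplus>\<^bsub>ell2 \<iota> N\<^esub> \<iota> (\<lambda>i. \<Sum>k\<in>K. f k i)"
      by (simp add: M.finsum_insert)
    with insert.hyps \<iota> show ?case
      by (simp add: ell2_def)
  qed
qed

text \<open>The limit is taken coordinatewise. On each finite set of coordinates the Cauchy bound
  survives the limit in \<open>n\<close>, and the resulting bound does not depend on that set, so it
  passes to the norm.\<close>

lemma ell2_complete:
  fixes s :: "nat \<Rightarrow> 'i \<Rightarrow> complex"
  assumes s: "\<And>n. s n \<in> sq_summable N"
    and Cauchy: "\<And>e. e > 0 \<Longrightarrow> \<exists>K. \<forall>m\<ge>K. \<forall>n\<ge>K. sqrt (sqnorm (\<lambda>i. s m i - s n i)) < e"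
  shows "\<exists>g\<in>sq_summable N. (\<lambda>n. sqrt (sqnorm (\<lambda>i. s n i - g i))) \<longlonglongrightarrow> 0"
proof -
  have d: "(\<lambda>i. s m i - s n i) \<in> sq_summable N" for m n
    by (intro sq_summable_diff s)
  have "convergent (\<lambda>n. s n i)" for i
  proof (rule Cauchy_convergent, rule CauchyI)
    fix e :: real assume "e > 0"
    then obtain K where K: "\<forall>m\<ge>K. \<forall>n\<ge>K. sqrt (sqnorm (\<lambda>i. s m i - s n i)) < e"
      using Cauchy by blast
    have "norm (s m i - s n i) \<le> sqrt (sqnorm (\<lambda>i. s m i - s n i))" for m n
      using norm_le_sqnorm[OF d[of m n], of i] by (simp add: real_le_rsqrt)
    with K show "\<exists>K. \<forall>m\<ge>K. \<forall>n\<ge>K. norm (s m i - s n i) < e"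
      by (meson order_le_less_trans)
  qed
  then obtain g where g: "\<And>i. (\<lambda>n. s n i) \<longlonglongrightarrow> g i"
    unfolding convergent_def by metis
  have close: "(\<lambda>i. s m i - g i) \<in> sq_summable N \<and> sqnorm (\<lambda>i. s m i - g i) \<le> e\<^sup>2"
    if K: "\<forall>m\<ge>K. \<forall>n\<ge>K. sqrt (sqnorm (\<lambda>i. s m i - s n i)) < e" and m: "m \<ge> K" and e: "e > 0" for K m e
  proof -
    have zero: "s m i - g i = 0" if "i \<notin> N" for i
      using that s g[of i] by (simp add: sq_summable_def LIMSEQ_const_iff)
    have "(\<Sum>i\<in>F. (cmod (s m i - g i))\<^sup>2) \<le> e\<^sup>2" if F: "finite F" for F
    proof (rule LIMSEQ_le_const2)
      show "(\<lambda>n. \<Sum>i\<in>F. (cmod (s m i - s n i))\<^sup>2) \<longlonglongrightarrow> (\<Sum>i\<in>F. (cmod (s m i - g i))\<^sup>2)"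
        by (intro tendsto_intros g)
      have "(\<Sum>i\<in>F. (cmod (s m i - s n i))\<^sup>2) \<le> e\<^sup>2" if "n \<ge> K" for n
      proof -
        have "sqrt (sqnorm (\<lambda>i. s m i - s n i)) < e"
          using K m that by blast
        then have "sqnorm (\<lambda>i. s m i - s n i) \<le> e\<^sup>2"
          using e by (meson less_eq_real_def real_less_lsqrt sqrt_le_D)
        with sum_le_sqnorm[OF d F] show ?thesis
          by (rule order_trans)
      qed
      then show "\<exists>K. \<forall>n\<ge>K. (\<Sum>i\<in>F. (cmod (s m i - s n i))\<^sup>2) \<le> e\<^sup>2"
        by blast
    qed
    with zero show ?thesis
      using sq_summableI[of N "\<lambda>i. s m i - g i" "e\<^sup>2"] by blast
  qed
  show ?thesis
  proof
    obtain K where K: "\<forall>m\<ge>K. \<forall>n\<ge>K. sqrt (sqnorm (\<lambda>i. s m i - s n i)) < 1"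
      using Cauchy[of 1] by auto
    have "(\<lambda>i. s K i - g i) \<in> sq_summable N"
      using close[OF K, of K] by simp
    from sq_summable_diff[OF s[of K] this] show "g \<in> sq_summable N" by simp
    show "(\<lambda>n. sqrt (sqnorm (\<lambda>i. s n i - g i))) \<longlonglongrightarrow> 0"
    proof (rule LIMSEQ_I)
      fix r :: real assume "r > 0"
      then obtain K where K: "\<forall>m\<ge>K. \<forall>n\<ge>K. sqrt (sqnorm (\<lambda>i. s m i - s n i)) < r / 2"
        using Cauchy[of "r / 2"] by auto
      have "sqrt (sqnorm (\<lambda>i. s n i - g i)) \<le> r / 2" if "n \<ge> K" for n
        using close[OF K that] \<open>r > 0\<close> by (intro real_le_lsqrt) auto
      with \<open>r > 0\<close> show "\<exists>K. \<forall>n\<ge>K. norm (sqrt (sqnorm (\<lambda>i. s n i - g i)) - 0) < r"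
        by (intro exI[of _ K]) (fastforce simp: sqnorm_nonneg)
    qed
  qed
qed

lemma hilbert_space_ell2:
  fixes \<iota> :: "('i \<Rightarrow> complex) \<Rightarrow> 'h"
  assumes \<iota>: "inj \<iota>"
  shows "hilbert_space (ell2 \<iota> N)"
proof (rule hilbert_space.intro[OF module_ell2[OF \<iota>]], unfold_locales)
  fix s :: "nat \<Rightarrow> 'h"
  assume "\<And>n. s n \<in> carrier (ell2 \<iota> N)"
  then have "\<forall>n. \<exists>f. f \<in> sq_summable N \<and> s n = \<iota> f"
    by (auto simp: ell2_def)
  then obtain f where f: "\<And>n. f n \<in> sq_summable N" and s: "s = (\<lambda>n. \<iota> (f n))"
    by metis
  have diff: "hnorm (ell2 \<iota> N) (\<iota> g \<ominus>\<^bsub>ell2 \<iota> N\<^esub> \<iota> h) = sqrt (sqnorm (\<lambda>i. g i - h i))"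
    if "g \<in> sq_summable N" "h \<in> sq_summable N" for g h
    using \<iota> that by (simp add: minus_ell2 hnorm_ell2 sq_summable_diff)
  assume "\<And>e. e > 0 \<Longrightarrow> \<exists>K. \<forall>m\<ge>K. \<forall>n\<ge>K. hnorm (ell2 \<iota> N) (s m \<ominus>\<^bsub>ell2 \<iota> N\<^esub> s n) < e"
  then have "\<exists>g\<in>sq_summable N. (\<lambda>n. sqrt (sqnorm (\<lambda>i. f n i - g i))) \<longlonglongrightarrow> 0"
    unfolding s diff[OF f f] by (rule ell2_complete[OF f])
  then obtain g where g: "g \<in> sq_summable N" "(\<lambda>n. sqrt (sqnorm (\<lambda>i. f n i - g i))) \<longlonglongrightarrow> 0"
    by blast
  then show "\<exists>x\<in>carrier (ell2 \<iota> N). (\<lambda>n. hnorm (ell2 \<iota> N) (s n \<ominus>\<^bsub>ell2 \<iota> N\<^esub> x)) \<longlonglongrightarrow> 0"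
    by (intro bexI[of _ "\<iota> g"]) (simp_all add: s diff f, simp add: ell2_def)
next
  fix x assume "x \<in> carrier (ell2 \<iota> N)"
  then show "hinner (ell2 \<iota> N) x x \<in> \<real>\<^sub>\<ge>\<^sub>0"
    using \<iota> by (auto simp: ell2_def iprod_self sqnorm_nonneg)
next
  fix x assume "x \<in> carrier (ell2 \<iota> N)" "hinner (ell2 \<iota> N) x x = 0"
  then obtain f where f: "f \<in> sq_summable N" "x = \<iota> f" "sqnorm f = 0"
    using \<iota> by (auto simp: ell2_def iprod_self)
  then have "f i = 0" for i
    using norm_le_sqnorm[OF f(1), of i] by simp
  then have "f = (\<lambda>_. 0)" by auto
  with f show "x = \<zero>\<^bsub>ell2 \<iota> N\<^esub>"
    by (simp add: ell2_def)
next
  fix x y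
  show "hinner (ell2 \<iota> N) x y = cnj (hinner (ell2 \<iota> N) y x)"
    by (simp add: ell2_def iprod_commute[of "coords \<iota> x"])
qed (use \<iota> in \<open>auto simp: ell2_def iprod_add_left iprod_smult_left\<close>)

lemma positive_op_mop:
  assumes \<iota>: "inj \<iota>" and "psd_contraction N A"
  shows "positive_op (ell2 \<iota> N) (mop \<iota> A)"
proof -
  interpret psd_contraction N A by fact
  have "bounded_op (ell2 \<iota> N) (mop \<iota> A)"
    unfolding bounded_op_def
  proof (intro conjI)
    show "\<exists>B. \<forall>x\<in>carrier (ell2 \<iota> N). hnorm (ell2 \<iota> N) (mop \<iota> A x) \<le> B * hnorm (ell2 \<iota> N) x"
    proof (intro exI[of _ 1] ballI)
      fix x assume "x \<in> carrier (ell2 \<iota> N)"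
      then obtain f where f: "f \<in> sq_summable N" "x = \<iota> f"
        by (auto simp: ell2_def)
      then have "mop \<iota> A x = \<iota> (mapp A f)"
        using \<iota> by (simp add: mop_def)
      then show "hnorm (ell2 \<iota> N) (mop \<iota> A x) \<le> 1 * hnorm (ell2 \<iota> N) x"
        using \<iota> f by (simp add: hnorm_ell2 mapp_sq_summable sqnorm_mapp_le)
    qed
  qed (use \<iota> in \<open>auto simp: ell2_def mop_def mapp_sq_summable mapp_add mapp_smult\<close>)
  with \<iota> iprod_mapp_nonneg show ?thesis
    by (auto simp: positive_op_def ell2_def mop_def)
qed

text \<open>The complement \<open>I - A k\<close> is the sum of the other elements of the POVM,
  hence positive. This is the source of boundedness for the operators built from matrices.\<close>

lemma mpovm_contraction:
  assumes "mpovm N I A" "k \<in> I"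
  shows "psd_contraction N (A k)"
proof
  have "(\<lambda>i j. idm N i j - A k i j) = (\<lambda>i j. \<Sum>l\<in>I - {k}. A l i j)"
    using assms by (simp add: mpovm_def fun_eq_iff sum_diff1)
  then show "psd (\<lambda>i j. idm N i j - A k i j)"
    using assms by (auto simp: mpovm_def intro!: psd_sum)
qed (use assms in \<open>auto simp: mpovm_def\<close>)

lemma mapp_sum_idm:
  assumes A: "mpovm N I A" and f: "f \<in> sq_summable N"
  shows "(\<Sum>k\<in>I. mapp (A k) f i) = f i"
proof -
  \<comment> \<open>Inserting \<open>i\<close> guarantees that the diagonal entry of
    \<open>idm N\<close> is met, even when row \<open>i\<close> is zero.\<close>
  define S where "S = insert i (\<Union>k\<in>I. {j. A k i j \<noteq> 0})"
  have S: "finite S" "i \<in> S"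
    using A by (auto simp: S_def mpovm_def rcf_def)
  have "(\<Sum>k\<in>I. mapp (A k) f i) = (\<Sum>k\<in>I. \<Sum>j\<in>S. A k i j * f j)"
    using S by (intro sum.cong refl mapp_superset) (auto simp: S_def)
  also have "\<dots> = (\<Sum>j\<in>S. \<Sum>k\<in>I. A k i j * f j)"
    by (rule sum.swap)
  also have "\<dots> = (\<Sum>j\<in>S. idm N i j * f j)"
    using A by (simp add: mpovm_def flip: sum_distrib_right)
  also have "\<dots> = (\<Sum>j\<in>S. if i = j then f i else 0)"
    using f by (intro sum.cong) (auto simp: idm_def sq_summable_def)
  also have "\<dots> = f i"
    using S by simp
  finally show ?thesis .
qed

lemma mapp_mpovm_sq_summable: "mpovm N I A \<Longrightarrow> k \<in> I \<Longrightarrow> f \<in> sq_summable N \<Longrightarrow> mapp (A k) f \<in> sq_summable N"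
  by (meson mpovm_contraction psd_contraction.mapp_sq_summable)

lemma povm_ell2:
  assumes \<iota>: "inj \<iota>" and A: "mpovm N I A"
  shows "povm (ell2 \<iota> N) I (\<lambda>k. mop \<iota> (A k))"
  unfolding povm_def
proof (intro conjI ballI)
  show fin: "finite I"
    using A by (simp add: mpovm_def)
  fix x assume "x \<in> carrier (ell2 \<iota> N)"
  then obtain f where f: "f \<in> sq_summable N" "x = \<iota> f"
    by (auto simp: ell2_def)
  then have "(\<Oplus>\<^bsub>ell2 \<iota> N\<^esub>k\<in>I. mop \<iota> (A k) x) = (\<Oplus>\<^bsub>ell2 \<iota> N\<^esub>k\<in>I. \<iota> (mapp (A k) f))"
    using \<iota> by (simp add: mop_def)
  also have "\<dots> = \<iota> (\<lambda>i. \<Sum>k\<in>I. mapp (A k) f i)"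
    using mapp_mpovm_sq_summable[OF A _ f(1)] by (intro finsum_ell2 \<iota> fin)
  also have "\<dots> = x"
    using mapp_sum_idm[OF A f(1)] f by simp
  finally show "(\<Oplus>\<^bsub>ell2 \<iota> N\<^esub>k\<in>I. mop \<iota> (A k) x) = x" .
qed (use positive_op_mop[OF \<iota> mpovm_contraction[OF A]] in auto)

text \<open>Operator counterpart of \<open>mfam\<close> with the same flag, so that correlations and
  bicorrelations are treated together.\<close>

definition hfam :: "bool \<Rightarrow> 'h hilbert \<Rightarrow> 'x set \<Rightarrow> 'y set \<Rightarrow> ('x \<Rightarrow> 'y \<Rightarrow> 'h \<Rightarrow> 'h) \<Rightarrow> bool" where
  "hfam b H X Y E \<longleftrightarrow> (\<forall>x\<in>X. povm H Y (E x)) \<and> (b \<longrightarrow> (\<forall>y\<in>Y. povm H X (\<lambda>x. E x y)))"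

lemma quantum_magic_square_hfam:
  "quantum_magic_square H V E \<longleftrightarrow> finite V \<and> hfam True H V V E"
  unfolding quantum_magic_square_def hfam_def povm_def by blast

lemma hfam_ell2: "inj \<iota> \<Longrightarrow> mfam b N X Y A \<Longrightarrow> hfam b (ell2 \<iota> N) X Y (\<lambda>x y. mop \<iota> (A x y))"
  by (auto simp: hfam_def mfam_def povm_ell2)

lemma hinner_mop_mop:
  assumes \<iota>: "inj \<iota>" and "rcf N A" "rcf N B" and S: "finite S" "\<And>i. i \<notin> S \<Longrightarrow> f i = 0"
  shows "hinner (ell2 \<iota> N) (mop \<iota> A (mop \<iota> B (\<iota> f))) (\<iota> f) = qform S (mmul A B) f"
proof -
  have "hinner (ell2 \<iota> N) (mop \<iota> A (mop \<iota> B (\<iota> f))) (\<iota> f) = iprod (mapp (mmul A B) f) f"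
    using \<iota> mapp_mmul[OF assms(2,3)] by (simp add: ell2_def mop_def)
  also have "\<dots> = (\<Sum>i\<in>S. mapp (mmul A B) f i * cnj (f i))"
    using S by (intro iprod_finite) auto
  also have "\<dots> = (\<Sum>i\<in>S. (\<Sum>j\<in>S. mmul A B i j * f j) * cnj (f i))"
    using mmul_row_finite[OF assms(2,3)] S by (simp add: mapp_support[OF S(1)])
  also have "\<dots> = qform S (mmul A B) f"
    by (simp add: qform_def sum_distrib_left sum_distrib_right algebra_simps)
  finally show ?thesis .
qed

lemma commuting_model_ell2:
  assumes \<iota>: "inj \<iota>"
    and A: "\<forall>x\<in>V2. mpovm N V1 (A x)" and B: "\<forall>x\<in>W1. mpovm N W2 (B x)"
    and comm: "\<And>v2 v1 w1 w2. v2 \<in> V2 \<Longrightarrow> v1 \<in> V1 \<Longrightarrow> w1 \<in> W1 \<Longrightarrow> w2 \<in> W2 \<Longrightarrow>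
      mmul (A v2 v1) (B w1 w2) = mmul (B w1 w2) (A v2 v1)"
    and S: "finite S" "S \<subseteq> N" "\<And>i. i \<notin> S \<Longrightarrow> f i = 0" and unit: "(\<Sum>i\<in>S. (cmod (f i))\<^sup>2) = 1"
    and val: "\<And>v2 v1 w1 w2. v2 \<in> V2 \<Longrightarrow> v1 \<in> V1 \<Longrightarrow> w1 \<in> W1 \<Longrightarrow> w2 \<in> W2 \<Longrightarrow>
      entry \<Gamma> (v1, w2) (v2, w1) = qform S (mmul (A v2 v1) (B w1 w2)) f"
  shows "commuting_model (ell2 \<iota> N) (\<iota> f) V2 W1 V1 W2
    (\<lambda>x y. mop \<iota> (A x y)) (\<lambda>x y. mop \<iota> (B x y)) \<Gamma>"
proof -
  have rcf: "rcf N (A v2 v1)" "rcf N (B w1 w2)"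
    if "v2 \<in> V2" "v1 \<in> V1" "w1 \<in> W1" "w2 \<in> W2" for v2 v1 w1 w2
    using A B that by (auto simp: mpovm_def)
  have f: "f \<in> sq_summable N"
    using S by (intro sq_summable_finite)
  moreover have "iprod f f = (\<Sum>i\<in>S. of_real ((cmod (f i))\<^sup>2))"
    using S by (subst iprod_finite[of S]) (auto simp: complex_norm_square simp del: of_real_power)
  then have "iprod f f = 1"
    using unit by (simp flip: of_real_sum of_real_power)
  then have "hnorm (ell2 \<iota> N) (\<iota> f) = 1"
    using \<iota> by (simp add: hnorm_def ell2_def)
  moreover have "mop \<iota> (A v2 v1) (mop \<iota> (B w1 w2) x) = mop \<iota> (B w1 w2) (mop \<iota> (A v2 v1) x)"
    if "v2 \<in> V2" "v1 \<in> V1" "w1 \<in> W1" "w2 \<in> W2" for v2 v1 w1 w2 x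
    using \<iota> comm[OF that] mapp_mmul[OF rcf(1)[OF that] rcf(2)[OF that]]
      mapp_mmul[OF rcf(2)[OF that] rcf(1)[OF that]] by (simp add: mop_def)
  moreover have "entry \<Gamma> (v1, w2) (v2, w1) =
    hinner (ell2 \<iota> N) (mop \<iota> (A v2 v1) (mop \<iota> (B w1 w2) (\<iota> f))) (\<iota> f)"
    if "v2 \<in> V2" "v1 \<in> V1" "w1 \<in> W1" "w2 \<in> W2" for v2 v1 w1 w2
    using val[OF that] hinner_mop_mop[OF \<iota> rcf[OF that] S(1,3)] by simp
  ultimately show ?thesis
    unfolding commuting_model_def using hilbert_space_ell2[OF \<iota>]
    by (auto simp: ell2_def)
qed

section \<open>Matrix models of correlations\<close>

type_synonym ('v, 'w) entries = "'v \<times> 'w \<Rightarrow> 'v \<times> 'w \<Rightarrow> complex"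

text \<open>The state may be required to have finite support because the frames used below span it
  algebraically. The table of entries \<open>p\<close> is separated from any map, so models can be
  composed before a channel is built.\<close>

definition qc_model ::
  "bool \<Rightarrow> 'i set \<Rightarrow> 'i set \<Rightarrow> ('i \<Rightarrow> complex) \<Rightarrow> 'v set \<Rightarrow> 'w set \<Rightarrow> 'v set \<Rightarrow> 'w set \<Rightarrow>
   ('v \<Rightarrow> 'v \<Rightarrow> 'i cmat) \<Rightarrow> ('w \<Rightarrow> 'w \<Rightarrow> 'i cmat) \<Rightarrow>
   ('v, 'w) entries \<Rightarrow> bool" where
  "qc_model b N S x V2 W1 V1 W2 A B p \<longleftrightarrow>
     mfam b N V2 V1 A \<and> mfam b N W1 W2 B \<and> finite S \<and> S \<subseteq> N \<and> (\<forall>i. i \<notin> S \<longrightarrow> x i = 0) \<and>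
     (\<Sum>i\<in>S. (cmod (x i))\<^sup>2) = 1 \<and>
     (\<forall>v2\<in>V2. \<forall>v1\<in>V1. \<forall>w1\<in>W1. \<forall>w2\<in>W2.
        mmul (A v2 v1) (B w1 w2) = mmul (B w1 w2) (A v2 v1) \<and>
        p (v1, w2) (v2, w1) = qform S (mmul (A v2 v1) (B w1 w2)) x)"

text \<open>The two parties have separate finite index sets; commutation is built into the Kronecker
  product, whose factors act on different coordinates.\<close>

definition q_model ::
  "bool \<Rightarrow> 'i set \<Rightarrow> 'j set \<Rightarrow> ('i \<times> 'j \<Rightarrow> complex) \<Rightarrow> 'v set \<Rightarrow> 'w set \<Rightarrow> 'v set \<Rightarrow> 'w set \<Rightarrow>
   ('v \<Rightarrow> 'v \<Rightarrow> 'i cmat) \<Rightarrow> ('w \<Rightarrow> 'w \<Rightarrow> 'j cmat) \<Rightarrow>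
   ('v, 'w) entries \<Rightarrow> bool" where
  "q_model b N M x V2 W1 V1 W2 A B p \<longleftrightarrow>
     mfam b N V2 V1 A \<and> mfam b M W1 W2 B \<and> finite N \<and> finite M \<and>
     (\<forall>i. i \<notin> N \<times> M \<longrightarrow> x i = 0) \<and> (\<Sum>i\<in>N \<times> M. (cmod (x i))\<^sup>2) = 1 \<and>
     (\<forall>v2\<in>V2. \<forall>v1\<in>V1. \<forall>w1\<in>W1. \<forall>w2\<in>W2.
        p (v1, w2) (v2, w1) = qform (N \<times> M) (kron (A v2 v1) (B w1 w2)) x)"

text \<open>With \<open>a = (v1, w3)\<close> and \<open>c = (v3, w1)\<close>: \<open>p2\<close>
  turns \<open>v3\<close> into \<open>v2\<close>, which is an input of \<open>p1\<close>, while
  \<open>p1\<close> turns \<open>w1\<close> into \<open>w2\<close>, which is an input of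
  \<open>p2\<close>. Both inner variables are summed over.\<close>

definition compose_entries ::
  "'v set \<Rightarrow> 'w set \<Rightarrow> ('v, 'w) entries \<Rightarrow> ('v, 'w) entries \<Rightarrow>
   'v \<times> 'w \<Rightarrow> 'v \<times> 'w \<Rightarrow> complex" where
  "compose_entries V2 W2 p2 p1 a c =
     (\<Sum>v2\<in>V2. \<Sum>w2\<in>W2. p2 (v2, snd a) (fst c, w2) * p1 (fst a, w2) (v2, snd c))"

text \<open>On the \<open>W\<close> side the first correlation acts first, but its matrices must
  stay in the second Kronecker factor, where the \<open>V\<close> side of \<open>compose_fam\<close>
  puts the first correlation as well. Hence the chain order \<open>x\<close>, \<open>y\<close>,
  \<open>z\<close> is kept while the factors are exchanged.\<close>

definition compose_fam_rev ::
  "'y set \<Rightarrow> ('y \<Rightarrow> 'z \<Rightarrow> 'i cmat) \<Rightarrow> ('x \<Rightarrow> 'y \<Rightarrow> 'j cmat) \<Rightarrow>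
   'x \<Rightarrow> 'z \<Rightarrow> 'i \<times> 'j \<Rightarrow> 'i \<times> 'j \<Rightarrow> complex" where
  "compose_fam_rev Y B A x z p q = (\<Sum>y\<in>Y. kron (B y z) (A x y) p q)"

text \<open>Transposing both families turns this into \<open>compose_fam\<close>, with rows and
  columns exchanging their roles.\<close>

lemma mfam_compose_rev:
  assumes "finite X" "finite Z" "mfam b N Y Z B" "mfam b M X Y A"
  shows "mfam b (N \<times> M) X Z (compose_fam_rev Y B A)"
proof -
  have eq: "compose_fam_rev Y B A = (\<lambda>x z. compose_fam Y (\<lambda>z y. B y z) (\<lambda>y x. A x y) z x)"
    by (simp add: fun_eq_iff compose_fam_def compose_fam_rev_def)
  have "mpovm (N \<times> M) Z (compose_fam_rev Y B A x)" if "x \<in> X" for x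
    using assms that compose_fam_mpovm_cols[of M Y "\<lambda>y x. A x y" x N Z "\<lambda>z y. B y z"]
    by (simp add: mfam_def eq)
  moreover have "mpovm (N \<times> M) X (\<lambda>x. compose_fam_rev Y B A x z)" if "z \<in> Z" b for z
    using assms that compose_fam_mpovm_rows[of N Y "\<lambda>z y. B y z" z M X "\<lambda>y x. A x y"]
    by (simp add: mfam_def eq)
  ultimately show ?thesis by (simp add: mfam_def)
qed

text \<open>The mixed product rule
  \<open>(A \<otimes> B) (C \<otimes> D) = A C \<otimes> B D\<close>, summed bilinearly. One finite
  box \<open>S1 \<times> S2\<close> contains the relevant row supports for all \<open>y\<close> at
  once.\<close>

lemma mmul_sum_kron:
  assumes "finite Y" "\<And>y. y \<in> Y \<Longrightarrow> rcf N (A y)" "\<And>y. y \<in> Y \<Longrightarrow> rcf M (B y)"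
  shows "mmul (\<lambda>p q. \<Sum>y\<in>Y. kron (A y) (B y) p q) (\<lambda>p q. \<Sum>w\<in>W. kron (C w) (D w) p q) p r =
    (\<Sum>y\<in>Y. \<Sum>w\<in>W. kron (mmul (A y) (C w)) (mmul (B y) (D w)) p r)"
proof -
  define S1 where "S1 = (\<Union>y\<in>Y. {i. A y (fst p) i \<noteq> 0})"
  define S2 where "S2 = (\<Union>y\<in>Y. {i. B y (snd p) i \<noteq> 0})"
  have fin: "finite S1" "finite S2"
    using assms by (auto simp: S1_def S2_def rcf_def)
  have "mmul (\<lambda>p q. \<Sum>y\<in>Y. kron (A y) (B y) p q) (\<lambda>p q. \<Sum>w\<in>W. kron (C w) (D w) p q) p r =
    (\<Sum>q\<in>S1 \<times> S2. (\<Sum>y\<in>Y. kron (A y) (B y) p q) * (\<Sum>w\<in>W. kron (C w) (D w) q r))"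
    using fin
    by (intro mmul_superset)
       (auto simp: S1_def S2_def kron_def elim!: sum.not_neutral_contains_not_neutral)
  also have "\<dots> = (\<Sum>q\<in>S1 \<times> S2. \<Sum>y\<in>Y. \<Sum>w\<in>W. kron (A y) (B y) p q * kron (C w) (D w) q r)"
    by (simp add: sum_product)
  also have "\<dots> = (\<Sum>y\<in>Y. \<Sum>q\<in>S1 \<times> S2. \<Sum>w\<in>W. kron (A y) (B y) p q * kron (C w) (D w) q r)"
    by (rule sum.swap)
  also have "\<dots> = (\<Sum>y\<in>Y. \<Sum>w\<in>W. \<Sum>q\<in>S1 \<times> S2. kron (A y) (B y) p q * kron (C w) (D w) q r)"
    by (intro sum.cong refl sum.swap)
  also have "\<dots> = (\<Sum>y\<in>Y. \<Sum>w\<in>W. kron (mmul (A y) (C w)) (mmul (B y) (D w)) p r)"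
  proof (intro sum.cong refl)
    fix y w assume "y \<in> Y" "w \<in> W"
    have "(\<Sum>q\<in>S1 \<times> S2. kron (A y) (B y) p q * kron (C w) (D w) q r) =
      (\<Sum>i\<in>S1. \<Sum>j\<in>S2. (A y (fst p) i * C w i (fst r)) * (B y (snd p) j * D w j (snd r)))"
      by (simp add: sum.cartesian_product' kron_def mult_ac)
    also have "\<dots> = (\<Sum>i\<in>S1. A y (fst p) i * C w i (fst r)) * (\<Sum>j\<in>S2. B y (snd p) j * D w j (snd r))"
      by (rule sum_product[symmetric])
    also have "\<dots> = mmul (A y) (C w) (fst p) (fst r) * mmul (B y) (D w) (snd p) (snd r)"
      using fin \<open>y \<in> Y\<close> by (intro arg_cong2[of _ _ _ _ "(*)"] mmul_superset[symmetric]) (auto simp: S1_def S2_def)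
    finally show "(\<Sum>q\<in>S1 \<times> S2. kron (A y) (B y) p q * kron (C w) (D w) q r) =
      kron (mmul (A y) (C w)) (mmul (B y) (D w)) p r"
      by (simp add: kron_def)
  qed
  finally show ?thesis .
qed

section \<open>Composition of commuting models and of tensor product models\<close>

lemma qform_kron:
  "qform (S \<times> T) (kron A B) (\<lambda>p. x (fst p) * y (snd p)) = qform S A x * qform T B y"
proof -
  have "qform (S \<times> T) (kron A B) (\<lambda>p. x (fst p) * y (snd p)) =
    (\<Sum>i\<in>S. \<Sum>j\<in>T. \<Sum>i'\<in>S. \<Sum>j'\<in>T. (cnj (x i) * A i i' * x i') * (cnj (y j) * B j j' * y j'))"
    by (simp add: qform_def sum.cartesian_product' kron_def mult_ac)
  also have "\<dots> = (\<Sum>i\<in>S. \<Sum>j\<in>T. (\<Sum>i'\<in>S. cnj (x i) * A i i' * x i') * (\<Sum>j'\<in>T. cnj (y j) * B j j' * y j'))"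
    by (simp only: sum_product)
  also have "\<dots> = qform S A x * qform T B y"
    by (simp only: sum_product qform_def)
  finally show ?thesis .
qed

lemma qform_reindex:
  assumes "bij_betw \<sigma> S T"
  shows "qform S (\<lambda>p q. A (\<sigma> p) (\<sigma> q)) (\<lambda>p. x (\<sigma> p)) = qform T A x"
proof -
  have "qform S (\<lambda>p q. A (\<sigma> p) (\<sigma> q)) (\<lambda>p. x (\<sigma> p)) = (\<Sum>p\<in>S. \<Sum>j\<in>T. cnj (x (\<sigma> p)) * A (\<sigma> p) j * x j)"
    unfolding qform_def
    by (intro sum.cong refl) (rule sum.reindex_bij_betw[OF assms])
  also have "\<dots> = qform T A x"
    unfolding qform_def by (rule sum.reindex_bij_betw[OF assms])
  finally show ?thesis .
qed

lemma sum_norm_tensor: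
  "(\<Sum>p\<in>S \<times> T. (cmod (x (fst p) * y (snd p)))\<^sup>2) = (\<Sum>i\<in>S. (cmod (x i))\<^sup>2) * (\<Sum>j\<in>T. (cmod (y j))\<^sup>2)"
  by (simp add: sum.cartesian_product' norm_mult power_mult_distrib sum_product)

text \<open>By the mixed product rule each summand of the product is a Kronecker product of two
  products, one per model. Commutation is inherited factor by factor, and at the product state the
  form factors into the entries of \<open>p2\<close> and \<open>p1\<close>.\<close>

lemma qc_model_compose:
  assumes fin: "finite V1" "finite W1" "finite V3" "finite W3" "finite V2" "finite W2"
    and m1: "qc_model b N1 S1 x1 V2 W1 V1 W2 A1 B1 p1" and m2: "qc_model b N2 S2 x2 V3 W2 V2 W3 A2 B2 p2"
  shows "qc_model b (N2 \<times> N1) (S2 \<times> S1) (\<lambda>p. x2 (fst p) * x1 (snd p)) V3 W1 V1 W3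
    (compose_fam V2 A2 A1) (compose_fam_rev W2 B2 B1) (compose_entries V2 W2 p2 p1)"
  unfolding qc_model_def
proof (intro conjI ballI)
  note m1 = m1[unfolded qc_model_def] and m2 = m2[unfolded qc_model_def]
  show "mfam b (N2 \<times> N1) V3 V1 (compose_fam V2 A2 A1)"
    using m1 m2 fin by (intro mfam_compose) auto
  show "mfam b (N2 \<times> N1) W1 W3 (compose_fam_rev W2 B2 B1)"
    using m1 m2 fin by (intro mfam_compose_rev) auto
  show "finite (S2 \<times> S1)" "S2 \<times> S1 \<subseteq> N2 \<times> N1" "\<forall>i. i \<notin> S2 \<times> S1 \<longrightarrow> x2 (fst i) * x1 (snd i) = 0"
    "(\<Sum>p\<in>S2 \<times> S1. (cmod (x2 (fst p) * x1 (snd p)))\<^sup>2) = 1"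
    using m1 m2 by (auto simp: sum_norm_tensor)
  fix v3 v1 w1 w3 assume *: "v3 \<in> V3" "v1 \<in> V1" "w1 \<in> W1" "w3 \<in> W3"
  have comm: "mmul (A2 v3 v2) (B2 w2 w3) = mmul (B2 w2 w3) (A2 v3 v2)"
    "mmul (A1 v2 v1) (B1 w1 w2) = mmul (B1 w1 w2) (A1 v2 v1)" if "v2 \<in> V2" "w2 \<in> W2" for v2 w2
    using m1 m2 * that by blast+
  have rcf': "rcf N2 (A2 v3 v2)" "rcf N1 (A1 v2 v1)" if "v2 \<in> V2" for v2
    using m1 m2 * that by (auto simp: mfam_def mpovm_def)
  have rcf'': "rcf N2 (B2 w2 w3)" "rcf N1 (B1 w1 w2)" if "w2 \<in> W2" for w2
    using m1 m2 * that by (auto simp: mfam_def mpovm_def)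
  have AB: "mmul (compose_fam V2 A2 A1 v3 v1) (compose_fam_rev W2 B2 B1 w1 w3) =
    (\<lambda>p r. \<Sum>v2\<in>V2. \<Sum>w2\<in>W2. kron (mmul (A2 v3 v2) (B2 w2 w3)) (mmul (A1 v2 v1) (B1 w1 w2)) p r)"
    unfolding compose_fam_def[abs_def] compose_fam_rev_def[abs_def]
    using mmul_sum_kron[OF fin(5), where A = "\<lambda>v2. A2 v3 v2" and N = N2 and B = "\<lambda>v2. A1 v2 v1" and M = N1] rcf' by (intro ext) simp
  have "mmul (compose_fam_rev W2 B2 B1 w1 w3) (compose_fam V2 A2 A1 v3 v1) =
    (\<lambda>p r. \<Sum>w2\<in>W2. \<Sum>v2\<in>V2. kron (mmul (B2 w2 w3) (A2 v3 v2)) (mmul (B1 w1 w2) (A1 v2 v1)) p r)"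
    unfolding compose_fam_def[abs_def] compose_fam_rev_def[abs_def]
    using mmul_sum_kron[OF fin(6), where A = "\<lambda>w2. B2 w2 w3" and N = N2 and B = "\<lambda>w2. B1 w1 w2" and M = N1] rcf'' by (intro ext) simp
  also have "\<dots> = (\<lambda>p r. \<Sum>w2\<in>W2. \<Sum>v2\<in>V2. kron (mmul (A2 v3 v2) (B2 w2 w3)) (mmul (A1 v2 v1) (B1 w1 w2)) p r)"
    by (intro ext sum.cong refl) (simp add: comm)
  also have "\<dots> = mmul (compose_fam V2 A2 A1 v3 v1) (compose_fam_rev W2 B2 B1 w1 w3)"
    unfolding AB by (intro ext sum.swap)
  finally show "mmul (compose_fam V2 A2 A1 v3 v1) (compose_fam_rev W2 B2 B1 w1 w3) =
    mmul (compose_fam_rev W2 B2 B1 w1 w3) (compose_fam V2 A2 A1 v3 v1)" ..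
  have "qform (S2 \<times> S1) (mmul (compose_fam V2 A2 A1 v3 v1) (compose_fam_rev W2 B2 B1 w1 w3)) (\<lambda>p. x2 (fst p) * x1 (snd p))
    = (\<Sum>v2\<in>V2. \<Sum>w2\<in>W2. qform S2 (mmul (A2 v3 v2) (B2 w2 w3)) x2 * qform S1 (mmul (A1 v2 v1) (B1 w1 w2)) x1)"
    unfolding AB by (simp add: qform_sum qform_kron)
  also have "\<dots> = compose_entries V2 W2 p2 p1 (v1, w3) (v3, w1)"
    unfolding compose_entries_def fst_conv snd_conv
    using m1 m2 * by (intro sum.cong refl) simp
  finally show "compose_entries V2 W2 p2 p1 (v1, w3) (v3, w1) =
    qform (S2 \<times> S1) (mmul (compose_fam V2 A2 A1 v3 v1) (compose_fam_rev W2 B2 B1 w1 w3)) (\<lambda>p. x2 (fst p) * x1 (snd p))" ..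
qed

text \<open>The exchange of the two middle tensor factors. The product state groups indices by
  model, whereas \<open>q_model\<close> has to group them by party.\<close>

definition interchange :: "('a \<times> 'b) \<times> ('c \<times> 'd) \<Rightarrow> ('a \<times> 'c) \<times> ('b \<times> 'd)" where
  "interchange p = ((fst (fst p), fst (snd p)), (snd (fst p), snd (snd p)))"

lemma bij_betw_interchange: "bij_betw interchange ((A \<times> B) \<times> (C \<times> D)) ((A \<times> C) \<times> (B \<times> D))"
  by (rule bij_betw_byWitness[of _ interchange]) (auto simp: interchange_def)

lemma q_model_compose:
  assumes fin: "finite V1" "finite W1" "finite V3" "finite W3" "finite V2" "finite W2"
    and m1: "q_model b N1 M1 x1 V2 W1 V1 W2 A1 B1 p1" and m2: "q_model b N2 M2 x2 V3 W2 V2 W3 A2 B2 p2"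
  shows "q_model b (N2 \<times> N1) (M2 \<times> M1) (\<lambda>p. x2 (fst (interchange p)) * x1 (snd (interchange p))) V3 W1 V1 W3
    (compose_fam V2 A2 A1) (compose_fam_rev W2 B2 B1) (compose_entries V2 W2 p2 p1)"
  unfolding q_model_def
proof (intro conjI ballI)
  note m1 = m1[unfolded q_model_def] and m2 = m2[unfolded q_model_def]
  let ?I = "(N2 \<times> N1) \<times> (M2 \<times> M1)" and ?J = "(N2 \<times> M2) \<times> (N1 \<times> M1)"
  let ?x = "\<lambda>p. x2 (fst p) * x1 (snd p)"
  show "mfam b (N2 \<times> N1) V3 V1 (compose_fam V2 A2 A1)"
    using m1 m2 fin by (intro mfam_compose) auto
  show "mfam b (M2 \<times> M1) W1 W3 (compose_fam_rev W2 B2 B1)"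
    using m1 m2 fin by (intro mfam_compose_rev) auto
  show "finite (N2 \<times> N1)" "finite (M2 \<times> M1)"
    using m1 m2 by auto
  show "\<forall>i. i \<notin> ?I \<longrightarrow> ?x (interchange i) = 0"
    using m1 m2 by (auto simp: interchange_def)
  have "(\<Sum>i\<in>?I. (cmod (?x (interchange i)))\<^sup>2) = (\<Sum>i\<in>?J. (cmod (?x i))\<^sup>2)"
    by (rule sum.reindex_bij_betw[OF bij_betw_interchange])
  then show "(\<Sum>i\<in>?I. (cmod (?x (interchange i)))\<^sup>2) = 1"
    using m1 m2 by (simp add: sum_norm_tensor)
  fix v3 v1 w1 w3 assume *: "v3 \<in> V3" "v1 \<in> V1" "w1 \<in> W1" "w3 \<in> W3"
  have "kron (compose_fam V2 A2 A1 v3 v1) (compose_fam_rev W2 B2 B1 w1 w3) =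
    (\<lambda>p q. \<Sum>v2\<in>V2. \<Sum>w2\<in>W2. kron (kron (A2 v3 v2) (B2 w2 w3)) (kron (A1 v2 v1) (B1 w1 w2)) (interchange p) (interchange q))"
    by (simp add: fun_eq_iff kron_def compose_fam_def compose_fam_rev_def interchange_def sum_product mult_ac)
  then have "qform ?I (kron (compose_fam V2 A2 A1 v3 v1) (compose_fam_rev W2 B2 B1 w1 w3)) (\<lambda>p. ?x (interchange p))
    = (\<Sum>v2\<in>V2. \<Sum>w2\<in>W2. qform ?J (kron (kron (A2 v3 v2) (B2 w2 w3)) (kron (A1 v2 v1) (B1 w1 w2))) ?x)"
    by (simp only: qform_sum qform_reindex[OF bij_betw_interchange, where x = ?x])
  also have "\<dots> = compose_entries V2 W2 p2 p1 (v1, w3) (v3, w1)"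
    unfolding compose_entries_def fst_conv snd_conv
    using m1 m2 * by (intro sum.cong refl) (simp add: qform_kron)
  finally show "compose_entries V2 W2 p2 p1 (v1, w3) (v3, w1) =
    qform ?I (kron (compose_fam V2 A2 A1 v3 v1) (compose_fam_rev W2 B2 B1 w1 w3)) (\<lambda>p. ?x (interchange p))" ..
qed

section \<open>From matrix models to Hilbert spaces inside the given type\<close>

definition qc_realizable ::
  "'h itself \<Rightarrow> bool \<Rightarrow> 'v set \<Rightarrow> 'w set \<Rightarrow> 'v set \<Rightarrow> 'w set \<Rightarrow> ('v, 'w) corr_map \<Rightarrow> bool" where
  "qc_realizable TYPE('h) b V2 W1 V1 W2 \<Gamma> \<longleftrightarrow> (\<exists>(H::'h hilbert) \<xi> E F.
     hfam b H V2 V1 E \<and> hfam b H W1 W2 F \<and> commuting_model H \<xi> V2 W1 V1 W2 E F \<Gamma>)"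

definition q_realizable ::
  "'h itself \<Rightarrow> bool \<Rightarrow> 'v set \<Rightarrow> 'w set \<Rightarrow> 'v set \<Rightarrow> 'w set \<Rightarrow> ('v, 'w) corr_map \<Rightarrow> bool" where
  "q_realizable TYPE('h) b V2 W1 V1 W2 \<Gamma> \<longleftrightarrow> (\<exists>(H::'h hilbert) \<xi> E F.
     hfam b H V2 V1 E \<and> hfam b H W1 W2 F \<and> commuting_model H \<xi> V2 W1 V1 W2 E F \<Gamma> \<and>
     tensor_split H V2 V1 E W1 W2 F)"

text \<open>A complex family is coded by the rational lower cuts of the real and imaginary parts of
  its values. For a countable index type this is a subset of a countable set, hence codes a real
  number and then an element of \<open>'h\<close>.\<close>

lemma ex_inj_of_countable:
  assumes "lepoll (UNIV :: complex set) (UNIV :: 'h set)"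
  shows "\<exists>\<iota> :: ('i::countable \<Rightarrow> complex) \<Rightarrow> 'h. inj \<iota>"
proof -
  define g :: "('i \<Rightarrow> complex) \<Rightarrow> ('i \<times> bool \<times> rat) set" where
    "g f = {(i, b, q). of_rat q < (if b then Re (f i) else Im (f i))}" for f
  have "inj g"
  proof (rule injI, rule ext)
    fix f f' and i assume eq: "g f = g f'"
    have *: "r = s" if "\<And>q::rat. of_rat q < r \<longleftrightarrow> of_rat q < s" for r s :: real
      using that by (metis linorder_neqE_linordered_idom of_rat_dense order_less_asym)
    have "of_rat q < (if b then Re (f i) else Im (f i)) \<longleftrightarrow> of_rat q < (if b then Re (f' i) else Im (f' i))" for b q
      using eq unfolding g_def set_eq_iff by auto
    from this[of _ True] this[of _ False] show "f i = f' i"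
      by (intro complex_eqI *) auto
  qed
  moreover have "inj ((`) to_nat :: ('i \<times> bool \<times> rat) set \<Rightarrow> nat set)"
    by (intro injI) (auto simp: inj_image_eq_iff)
  moreover obtain h :: "nat set \<Rightarrow> real" where "inj h"
    using nat_sets_eqpoll_reals eqpoll_imp_lepoll unfolding lepoll_def by blast
  moreover obtain k :: "complex \<Rightarrow> 'h" where "inj k"
    using assms by (auto simp: lepoll_def)
  moreover have "inj complex_of_real"
    by (rule injI) simp
  ultimately have "inj (k \<circ> complex_of_real \<circ> h \<circ> (`) to_nat \<circ> g)"
    by (intro inj_compose)
  then show ?thesis by blast
qed

lemma qc_realizableI:
  fixes N :: "'i::countable set"
  assumes "lepoll (UNIV :: complex set) (UNIV :: 'h set)" and m: "qc_model b N S x V2 W1 V1 W2 A B (entry \<Gamma>)"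
  shows "qc_realizable TYPE('h) b V2 W1 V1 W2 \<Gamma>"
proof -
  obtain \<iota> :: "('i \<Rightarrow> complex) \<Rightarrow> 'h" where \<iota>: "inj \<iota>"
    using ex_inj_of_countable[OF assms(1)] by blast
  note m = m[unfolded qc_model_def]
  have "commuting_model (ell2 \<iota> N) (\<iota> x) V2 W1 V1 W2
    (\<lambda>v2 v1. mop \<iota> (A v2 v1)) (\<lambda>w1 w2. mop \<iota> (B w1 w2)) \<Gamma>"
    using m by (intro commuting_model_ell2[OF \<iota>, of V2 N V1 A W1 W2 B S]) (auto simp: mfam_def)
  moreover have "hfam b (ell2 \<iota> N) V2 V1 (\<lambda>v2 v1. mop \<iota> (A v2 v1))"
    "hfam b (ell2 \<iota> N) W1 W2 (\<lambda>w1 w2. mop \<iota> (B w1 w2))"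
    using m by (simp_all add: hfam_ell2[OF \<iota>])
  ultimately show ?thesis
    unfolding qc_realizable_def by blast
qed

lemma finite_dimensional_ell2:
  fixes \<iota> :: "('i \<Rightarrow> complex) \<Rightarrow> 'h"
  assumes \<iota>: "inj \<iota>" and N: "finite N"
  shows "finite_dimensional (ell2 \<iota> N)"
proof -
  obtain h where h: "bij_betw h {..<card N} N"
    using ex_bij_betw_nat_finite[OF N] by (auto simp: atLeast0LessThan)
  define u where "u i = (\<lambda>j. if j = h i then 1 else 0 :: complex)" for i :: nat
  have u: "u i \<in> sq_summable N" if "i < card N" for i
    using bij_betwE[OF h] that by (intro sq_summable_finite[of "{h i}"]) (auto simp: u_def)
  have "\<exists>c. x = (\<Oplus>\<^bsub>ell2 \<iota> N\<^esub>i\<in>{..<card N}. c i \<odot>\<^bsub>ell2 \<iota> N\<^esub> \<iota> (u i))" if x: "x \<in> carrier (ell2 \<iota> N)" for x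
  proof -
    obtain f where f: "f \<in> sq_summable N" "x = \<iota> f"
      using x by (auto simp: ell2_def)
    have "(\<Oplus>\<^bsub>ell2 \<iota> N\<^esub>i\<in>{..<card N}. f (h i) \<odot>\<^bsub>ell2 \<iota> N\<^esub> \<iota> (u i)) =
      (\<Oplus>\<^bsub>ell2 \<iota> N\<^esub>i\<in>{..<card N}. \<iota> (\<lambda>j. f (h i) * u i j))"
      using \<iota> by (simp add: ell2_def[of \<iota>])
    also have "\<dots> = \<iota> (\<lambda>j. \<Sum>i<card N. f (h i) * u i j)"
      using u by (intro finsum_ell2[OF \<iota>]) (auto intro: sq_summable_smult)
    also have "(\<lambda>j. \<Sum>i<card N. f (h i) * u i j) = f"
    proof
      fix j
      have "(\<Sum>i<card N. f (h i) * u i j) = (\<Sum>i\<in>N. f i * (if j = i then 1 else 0))"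
        unfolding u_def by (rule sum.reindex_bij_betw[OF h])
      also have "\<dots> = f j"
        using N f by (auto simp: sq_summable_def if_distrib[of "\<lambda>t. _ * t"] cong: if_cong)
      finally show "(\<Sum>i<card N. f (h i) * u i j) = f j" .
    qed
    finally show ?thesis using f by metis
  qed
  moreover have "\<forall>i<card N. \<iota> (u i) \<in> carrier (ell2 \<iota> N)"
    using u by (simp add: ell2_def)
  ultimately show ?thesis
    unfolding finite_dimensional_def
    by (intro exI[of _ "card N"] exI[of _ "\<lambda>i. \<iota> (u i)"] conjI ballI)
qed

lemma fd_tensor_ell2:
  fixes \<iota> :: "('i \<Rightarrow> complex) \<Rightarrow> 'h" and \<kappa> :: "('j \<Rightarrow> complex) \<Rightarrow> 'h"
    and \<mu> :: "('i \<times> 'j \<Rightarrow> complex) \<Rightarrow> 'h"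
  assumes \<iota>: "inj \<iota>" and \<kappa>: "inj \<kappa>" and \<mu>: "inj \<mu>" and N: "finite N" and M: "finite M"
  shows "fd_tensor (ell2 \<iota> N) (ell2 \<kappa> M) (ell2 \<mu> (N \<times> M))
    (\<lambda>x y. \<mu> (\<lambda>p. coords \<iota> x (fst p) * coords \<kappa> y (snd p)))"
proof -
  have tens: "(\<lambda>p. f (fst p) * g (snd p)) \<in> sq_summable (N \<times> M)"
    if "f \<in> sq_summable N" "g \<in> sq_summable M" for f g
    using that N M by (intro sq_summable_finite[of "N \<times> M"]) (auto simp: sq_summable_def)
  have inner: "iprod (\<lambda>p. f (fst p) * g (snd p)) (\<lambda>p. f' (fst p) * g' (snd p)) = iprod f f' * iprod g g'"
    if "f \<in> sq_summable N" "g \<in> sq_summable M" for f f' g g'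
  proof -
    have "iprod (\<lambda>p. f (fst p) * g (snd p)) (\<lambda>p. f' (fst p) * g' (snd p)) =
      (\<Sum>p\<in>N \<times> M. (f (fst p) * g (snd p)) * cnj (f' (fst p) * g' (snd p)))"
      using that N M by (intro iprod_finite) (auto simp: sq_summable_def)
    also have "\<dots> = (\<Sum>i\<in>N. f i * cnj (f' i)) * (\<Sum>j\<in>M. g j * cnj (g' j))"
      by (simp add: sum.cartesian_product' sum_product mult_ac)
    also have "\<dots> = iprod f f' * iprod g g'"
      using that N M iprod_finite[of N f f'] iprod_finite[of M g g'] by (auto simp: sq_summable_def)
    finally show ?thesis .
  qed
  have span: "\<exists>(n::nat) x y. (\<forall>i<n. x i \<in> carrier (ell2 \<iota> N) \<and> y i \<in> carrier (ell2 \<kappa> M)) \<and>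
    z = (\<Oplus>\<^bsub>ell2 \<mu> (N \<times> M)\<^esub>i\<in>{..<n}. \<mu> (\<lambda>p. coords \<iota> (x i) (fst p) * coords \<kappa> (y i) (snd p)))"
    if z: "z \<in> carrier (ell2 \<mu> (N \<times> M))" for z
  proof -
    obtain f where f: "f \<in> sq_summable (N \<times> M)" "z = \<mu> f"
      using z by (auto simp: ell2_def)
    define n where "n = card (N \<times> M)"
    obtain h where h: "bij_betw h {..<n} (N \<times> M)"
      using ex_bij_betw_nat_finite[of "N \<times> M"] N M by (auto simp: atLeast0LessThan n_def)
    \<comment> \<open>In \<open>fd_tensor\<close> vectors are sums of elementary tensors without
      scalars, so the coefficient is absorbed into the left factor.\<close>
    define u where "u k = (\<lambda>i. if i = fst (h k) then f (h k) else 0)" for k :: nat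
    define v where "v k = (\<lambda>j. if j = snd (h k) then 1 else 0 :: complex)" for k :: nat
    have uv: "u k \<in> sq_summable N" "v k \<in> sq_summable M" if "k < n" for k
      using bij_betwE[OF h] that
      by (auto simp: u_def v_def intro!: sq_summable_finite[of "{fst (h k)}"] sq_summable_finite[of "{snd (h k)}"])
        (metis lessThan_iff mem_Times_iff)+
    have "(\<Oplus>\<^bsub>ell2 \<mu> (N \<times> M)\<^esub>k\<in>{..<n}. \<mu> (\<lambda>p. coords \<iota> (\<iota> (u k)) (fst p) * coords \<kappa> (\<kappa> (v k)) (snd p))) =
      (\<Oplus>\<^bsub>ell2 \<mu> (N \<times> M)\<^esub>k\<in>{..<n}. \<mu> (\<lambda>p. u k (fst p) * v k (snd p)))"
      using \<iota> \<kappa> by simp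
    also have "\<dots> = \<mu> (\<lambda>p. \<Sum>k<n. u k (fst p) * v k (snd p))"
      using uv by (intro finsum_ell2[OF \<mu>] tens) auto
    also have "(\<lambda>p. \<Sum>k<n. u k (fst p) * v k (snd p)) = f"
    proof
      fix p
      have "(\<Sum>k<n. u k (fst p) * v k (snd p)) = (\<Sum>k<n. if p = h k then f (h k) else 0)"
        by (intro sum.cong) (auto simp: u_def v_def prod_eq_iff)
      also have "\<dots> = (\<Sum>q\<in>N \<times> M. if p = q then f q else 0)"
        by (rule sum.reindex_bij_betw[OF h])
      also have "\<dots> = f p"
        using N M f by (cases p) (auto simp: sq_summable_def)
      finally show "(\<Sum>k<n. u k (fst p) * v k (snd p)) = f p" .
    qed
    finally have "z = (\<Oplus>\<^bsub>ell2 \<mu> (N \<times> M)\<^esub>k\<in>{..<n}. \<mu> (\<lambda>p. coords \<iota> (\<iota> (u k)) (fst p) * coords \<kappa> (\<kappa> (v k)) (snd p)))"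
      using f by simp
    moreover have "\<forall>k<n. \<iota> (u k) \<in> carrier (ell2 \<iota> N) \<and> \<kappa> (v k) \<in> carrier (ell2 \<kappa> M)"
      using uv by (simp add: ell2_def)
    ultimately show ?thesis
      by (rule_tac exI[of _ n], rule_tac exI[of _ "\<lambda>k. \<iota> (u k)"], rule_tac exI[of _ "\<lambda>k. \<kappa> (v k)"]) simp
  qed
  show ?thesis
    unfolding fd_tensor_def
  proof (intro conjI ballI allI span)
  qed (use \<iota> \<kappa> \<mu> tens inner in \<open>auto simp: ell2_def algebra_simps\<close>)
qed

lemma mapp_kron_idm_right:
  assumes "rcf N A" "\<And>j. j \<notin> M \<Longrightarrow> g j = 0"
  shows "mapp (kron A (idm M)) (\<lambda>p. f (fst p) * g (snd p)) = (\<lambda>p. mapp A f (fst p) * g (snd p))"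
proof
  fix p
  have "mapp (kron A (idm M)) (\<lambda>p. f (fst p) * g (snd p)) p =
    (\<Sum>q\<in>{i. A (fst p) i \<noteq> 0} \<times> {snd p}. kron A (idm M) p q * (f (fst q) * g (snd q)))"
    using assms by (intro mapp_superset) (auto simp: kron_def idm_def rcf_def split: if_splits)
  also have "\<dots> = mapp A f (fst p) * g (snd p)"
    using assms by (auto simp: sum.cartesian_product' kron_def idm_def mapp_def sum_distrib_left sum_distrib_right mult_ac)
  finally show "mapp (kron A (idm M)) (\<lambda>p. f (fst p) * g (snd p)) p = mapp A f (fst p) * g (snd p)" .
qed

lemma mapp_kron_idm_left:
  assumes "rcf M B" "\<And>i. i \<notin> N \<Longrightarrow> f i = 0"
  shows "mapp (kron (idm N) B) (\<lambda>p. f (fst p) * g (snd p)) = (\<lambda>p. f (fst p) * mapp B g (snd p))"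
proof
  fix p
  have "mapp (kron (idm N) B) (\<lambda>p. f (fst p) * g (snd p)) p =
    (\<Sum>q\<in>{fst p} \<times> {j. B (snd p) j \<noteq> 0}. kron (idm N) B p q * (f (fst q) * g (snd q)))"
    using assms by (intro mapp_superset) (auto simp: kron_def idm_def rcf_def split: if_splits)
  also have "\<dots> = f (fst p) * mapp B g (snd p)"
    using assms by (auto simp: sum.cartesian_product' kron_def idm_def mapp_def sum_distrib_left sum_distrib_right mult_ac)
  finally show "mapp (kron (idm N) B) (\<lambda>p. f (fst p) * g (snd p)) p = f (fst p) * mapp B g (snd p)" .
qed

lemma mmul_idm_right: "rcf N A \<Longrightarrow> mmul A (idm N) = A"
proof (intro ext)
  fix i k assume A: "rcf N A"
  have "mmul A (idm N) i k = (\<Sum>j | A i j \<noteq> 0. if j = k then A i k else 0)"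
    unfolding mmul_def using A by (intro sum.cong) (auto simp: idm_def rcf_def)
  also have "\<dots> = A i k"
    using A by (simp add: rcf_def)
  finally show "mmul A (idm N) i k = A i k" .
qed

lemma mmul_idm_left: "rcf N A \<Longrightarrow> mmul (idm N) A = A"
proof (intro ext)
  fix i k assume A: "rcf N A"
  have "mmul (idm N) A i k = (\<Sum>j\<in>{i}. idm N i j * A j k)"
    by (intro mmul_superset) (auto simp: idm_def)
  then show "mmul (idm N) A i k = A i k"
    using A by (auto simp: idm_def rcf_def)
qed

lemma mmul_kron: "rcf N A \<Longrightarrow> rcf M B \<Longrightarrow> mmul (kron A B) (kron C D) = kron (mmul A C) (mmul B D)"
  using mmul_sum_kron[of "{()}" N "\<lambda>_. A" M "\<lambda>_. B" "\<lambda>_. C" "\<lambda>_. D" "{()}"] by (simp add: fun_eq_iff)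

lemma mpovm_kron_right: "mpovm N I A \<Longrightarrow> mpovm (N \<times> M) I (\<lambda>k. kron (A k) (idm M))"
  by (auto simp: mpovm_def rcf_kron psd_kron kron_sum_left simp flip: kron_idm)

lemma mpovm_kron_left: "mpovm M I B \<Longrightarrow> mpovm (N \<times> M) I (\<lambda>k. kron (idm N) (B k))"
  by (auto simp: mpovm_def rcf_kron psd_kron kron_sum_right simp flip: kron_idm)

lemma bounded_op_mop: "inj \<iota> \<Longrightarrow> mpovm N I A \<Longrightarrow> k \<in> I \<Longrightarrow> bounded_op (ell2 \<iota> N) (mop \<iota> (A k))"
  using positive_op_mop[OF _ mpovm_contraction, of \<iota> N I A k] by (simp add: positive_op_def)

text \<open>The two local spaces and their tensor product have different index types, hence the
  three injections. The state and the operators \<open>A \<otimes> I\<close> and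
  \<open>I \<otimes> B\<close> live on the third space.\<close>

lemma q_realizableI:
  fixes N :: "'i::countable set" and M :: "'j::countable set"
  assumes "lepoll (UNIV :: complex set) (UNIV :: 'h set)" and m: "q_model b N M x V2 W1 V1 W2 A B (entry \<Gamma>)"
  shows "q_realizable TYPE('h) b V2 W1 V1 W2 \<Gamma>"
proof -
  obtain \<iota> :: "('i \<Rightarrow> complex) \<Rightarrow> 'h" where \<iota>: "inj \<iota>"
    using ex_inj_of_countable[OF assms(1)] by blast
  obtain \<kappa> :: "('j \<Rightarrow> complex) \<Rightarrow> 'h" where \<kappa>: "inj \<kappa>"
    using ex_inj_of_countable[OF assms(1)] by blast
  obtain \<mu> :: "('i \<times> 'j \<Rightarrow> complex) \<Rightarrow> 'h" where \<mu>: "inj \<mu>"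
    using ex_inj_of_countable[OF assms(1)] by blast
  note m = m[unfolded q_model_def]
  have rcf: "rcf N (A v2 v1)" "rcf M (B w1 w2)" if "v2 \<in> V2" "v1 \<in> V1" "w1 \<in> W1" "w2 \<in> W2" for v2 v1 w1 w2
    using m that by (auto simp: mfam_def mpovm_def)
  have comm: "mmul (kron (A v2 v1) (idm M)) (kron (idm N) (B w1 w2)) = kron (A v2 v1) (B w1 w2)"
    "mmul (kron (idm N) (B w1 w2)) (kron (A v2 v1) (idm M)) = kron (A v2 v1) (B w1 w2)"
    if "v2 \<in> V2" "v1 \<in> V1" "w1 \<in> W1" "w2 \<in> W2" for v2 v1 w1 w2
    using rcf[OF that] by (simp_all add: mmul_kron[of N _ M] mmul_idm_left mmul_idm_right)
  have fam: "mfam b (N \<times> M) V2 V1 (\<lambda>v2 v1. kron (A v2 v1) (idm M))"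
    "mfam b (N \<times> M) W1 W2 (\<lambda>w1 w2. kron (idm N) (B w1 w2))"
    using m by (simp_all add: mfam_def mpovm_kron_left mpovm_kron_right)
  let ?E = "\<lambda>v2 v1. mop \<mu> (kron (A v2 v1) (idm M))" and ?F = "\<lambda>w1 w2. mop \<mu> (kron (idm N) (B w1 w2))"
  let ?\<tau> = "\<lambda>x y. \<mu> (\<lambda>p. coords \<iota> x (fst p) * coords \<kappa> y (snd p))"
  have "commuting_model (ell2 \<mu> (N \<times> M)) (\<mu> x) V2 W1 V1 W2 ?E ?F \<Gamma>"
    using m fam comm by (intro commuting_model_ell2[OF \<mu>, where S = "N \<times> M"]) (auto simp: mfam_def)
  moreover have "hfam b (ell2 \<mu> (N \<times> M)) V2 V1 ?E" "hfam b (ell2 \<mu> (N \<times> M)) W1 W2 ?F"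
    using fam by (simp_all add: hfam_ell2[OF \<mu>])
  moreover have "tensor_split (ell2 \<mu> (N \<times> M)) V2 V1 ?E W1 W2 ?F"
    unfolding tensor_split_def
  proof (rule exI[of _ "ell2 \<iota> N"], rule exI[of _ "ell2 \<kappa> M"], rule exI[of _ ?\<tau>],
      rule exI[of _ "\<lambda>v2 v1. mop \<iota> (A v2 v1)"], rule exI[of _ "\<lambda>w1 w2. mop \<kappa> (B w1 w2)"],
      intro conjI ballI)
    show "fd_tensor (ell2 \<iota> N) (ell2 \<kappa> M) (ell2 \<mu> (N \<times> M)) ?\<tau>"
      using m by (intro fd_tensor_ell2 \<iota> \<kappa> \<mu>) auto
  next
    fix v2 v1 assume v: "v2 \<in> V2" "v1 \<in> V1"
    then show "bounded_op (ell2 \<iota> N) (mop \<iota> (A v2 v1))"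
      using m \<iota> by (intro bounded_op_mop[where I = V1 and A = "A v2"]) (auto simp: mfam_def)
    fix x y assume xy: "x \<in> carrier (ell2 \<iota> N)" "y \<in> carrier (ell2 \<kappa> M)"
    have "rcf N (A v2 v1)"
      using m v by (auto simp: mfam_def mpovm_def)
    with xy show "mop \<mu> (kron (A v2 v1) (idm M)) (?\<tau> x y) = ?\<tau> (mop \<iota> (A v2 v1) x) y"
      using \<iota> \<kappa> \<mu> by (auto simp: mop_def ell2_def sq_summable_def mapp_kron_idm_right)
  next
    fix w1 w2 assume w: "w1 \<in> W1" "w2 \<in> W2"
    then show "bounded_op (ell2 \<kappa> M) (mop \<kappa> (B w1 w2))"
      using m \<kappa> by (intro bounded_op_mop[where I = W2 and A = "B w1"]) (auto simp: mfam_def)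
    fix x y assume xy: "x \<in> carrier (ell2 \<iota> N)" "y \<in> carrier (ell2 \<kappa> M)"
    have "rcf M (B w1 w2)"
      using m w by (auto simp: mfam_def mpovm_def)
    with xy show "mop \<mu> (kron (idm N) (B w1 w2)) (?\<tau> x y) = ?\<tau> x (mop \<kappa> (B w1 w2) y)"
      using \<iota> \<kappa> \<mu> by (auto simp: mop_def ell2_def sq_summable_def mapp_kron_idm_left)
  qed (use m \<iota> \<kappa> in \<open>auto simp: hilbert_space_ell2 finite_dimensional_ell2\<close>)
  ultimately show ?thesis
    unfolding q_realizable_def by blast
qed

section \<open>Orthonormalisation\<close>

text \<open>For a positive operator \<open>T\<close>, the last two hypotheses are the expansions of
  its form at \<open>x + c y\<close> for \<open>c = 1\<close> and \<open>c = \<i>\<close>, with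
  \<open>z\<close> and \<open>w\<close> the two mixed terms.\<close>

lemma polarization_cnj:
  fixes z w :: complex
  assumes "a \<in> \<real>\<^sub>\<ge>\<^sub>0" "d \<in> \<real>\<^sub>\<ge>\<^sub>0" "a + z + w + d \<in> \<real>\<^sub>\<ge>\<^sub>0" "a - \<i> * z + \<i> * w + d \<in> \<real>\<^sub>\<ge>\<^sub>0"
  shows "z = cnj w"
  using assms by (auto simp: complex_nonneg_Reals_iff complex_eq_iff)

text \<open>The algebraic span, deliberately not closed: its elements keep finite expansions, which
  makes the columns of operator matrices finite.\<close>

inductive_set lspan :: "'h hilbert \<Rightarrow> 'h set \<Rightarrow> 'h set" for H X where
  zero: "\<zero>\<^bsub>H\<^esub> \<in> lspan H X"
| base: "x \<in> X \<Longrightarrow> x \<in> lspan H X"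
| add: "x \<in> lspan H X \<Longrightarrow> y \<in> lspan H X \<Longrightarrow> x \<oplus>\<^bsub>H\<^esub> y \<in> lspan H X"
| smult: "x \<in> lspan H X \<Longrightarrow> c \<odot>\<^bsub>H\<^esub> x \<in> lspan H X"

text \<open>If the residual \<open>u\<close> vanishes, the factor \<open>1 / 0 = 0\<close> yields
  the zero vector.\<close>

fun gram_schmidt :: "'h hilbert \<Rightarrow> (nat \<Rightarrow> 'h) \<Rightarrow> nat \<Rightarrow> 'h" where
  "gram_schmidt H x n =
     (let u = foldr (\<lambda>k y. y \<oplus>\<^bsub>H\<^esub> (- hinner H (x n) (gram_schmidt H x k)) \<odot>\<^bsub>H\<^esub> gram_schmidt H x k) [0..<n] (x n)
      in of_real (1 / hnorm H u) \<odot>\<^bsub>H\<^esub> u)"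

declare gram_schmidt.simps [simp del]

text \<open>Zero vectors are admitted so that linearly dependent sequences can be orthonormalised
  without reindexing.\<close>

definition orthonormal_or_zero :: "'h hilbert \<Rightarrow> ('i \<Rightarrow> 'h) \<Rightarrow> bool" where
  "orthonormal_or_zero H e \<longleftrightarrow> (\<forall>i. e i \<in> carrier H) \<and>
     (\<forall>i j. i \<noteq> j \<longrightarrow> hinner H (e i) (e j) = 0) \<and> (\<forall>i. hinner H (e i) (e i) = 1 \<or> e i = \<zero>\<^bsub>H\<^esub>)"

text \<open>Weak form of the identity between \<open>y\<close> and the sum of its components along
  \<open>e i\<close>, \<open>i \<in> S\<close>: testing against all \<open>z\<close> replaces module
  sums by sums of complex numbers.\<close>

definition expands :: "'h hilbert \<Rightarrow> ('i \<Rightarrow> 'h) \<Rightarrow> 'i set \<Rightarrow> 'h \<Rightarrow> bool" where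
  "expands H e S y \<longleftrightarrow> (\<forall>z\<in>carrier H. hinner H y z = (\<Sum>i\<in>S. hinner H y (e i) * hinner H (e i) z))"

text \<open>Since the inner product is linear in its first argument, column \<open>j\<close> holds
  the coefficients of \<open>T (e j)\<close>.\<close>

definition op_matrix :: "'h hilbert \<Rightarrow> ('i \<Rightarrow> 'h) \<Rightarrow> ('h \<Rightarrow> 'h) \<Rightarrow> 'i cmat" where
  "op_matrix H e T i j = hinner H (T (e j)) (e i)"

section \<open>Self-adjointness, spans and finite expansions\<close>

context hilbert_space
begin

lemma smult_closed' [simp]: "x \<in> carrier H \<Longrightarrow> c \<odot> x \<in> carrier H"
  using smult_closed[of c x] by (simp add: complex_ring_def)

lemma inner_add_right:
  "\<lbrakk>x \<in> carrier H; y \<in> carrier H; z \<in> carrier H\<rbrakk> \<Longrightarrow>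
   hinner H z (x \<oplus> y) = hinner H z x + hinner H z y"
  using inner_commute[of z "x \<oplus> y"] inner_commute[of z x] inner_commute[of z y]
  by (simp add: inner_add_left)

lemma inner_smult_right:
  "\<lbrakk>x \<in> carrier H; y \<in> carrier H\<rbrakk> \<Longrightarrow> hinner H x (c \<odot> y) = cnj c * hinner H x y"
  using inner_commute[of x "c \<odot> y"] inner_commute[of x y] by (simp add: inner_smult_left)

lemma smult_zero_left: "x \<in> carrier H \<Longrightarrow> 0 \<odot> x = \<zero>"
  using smult_l_null[of x] by (simp add: complex_ring_def)

lemma inner_zero_left [simp]: "x \<in> carrier H \<Longrightarrow> hinner H \<zero> x = 0"
  using inner_smult_left[of x x 0] smult_zero_left[of x] by simp

lemma inner_zero_right [simp]: "x \<in> carrier H \<Longrightarrow> hinner H x \<zero> = 0"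
  using inner_smult_right[of x x 0] smult_zero_left[of x] by simp

lemma inner_finsum_left:
  assumes "finite K" "\<And>k. k \<in> K \<Longrightarrow> f k \<in> carrier H" "z \<in> carrier H"
  shows "hinner H (\<Oplus>k\<in>K. f k) z = (\<Sum>k\<in>K. hinner H (f k) z)"
  using assms
proof (induction K rule: finite_induct)
  case (insert a K)
  then have "f \<in> K \<rightarrow> carrier H" "f a \<in> carrier H"
    by auto
  with insert show ?case
    by (simp add: M.finsum_insert M.finsum_closed inner_add_left)
qed simp

lemma inner_finsum_right:
  assumes "finite K" "\<And>k. k \<in> K \<Longrightarrow> f k \<in> carrier H" "z \<in> carrier H"
  shows "hinner H z (\<Oplus>k\<in>K. f k) = (\<Sum>k\<in>K. hinner H z (f k))"
proof -
  have c: "(\<Oplus>k\<in>K. f k) \<in> carrier H"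
    using assms by (intro M.finsum_closed) auto
  have "hinner H z (\<Oplus>k\<in>K. f k) = (\<Sum>k\<in>K. cnj (hinner H (f k) z))"
    using assms by (simp add: inner_commute[OF assms(3) c] inner_finsum_left)
  also have "\<dots> = (\<Sum>k\<in>K. hinner H z (f k))"
    using assms inner_commute by (intro sum.cong refl) metis
  finally show ?thesis .
qed

lemma positive_op_selfadjoint:
  assumes T: "positive_op H T" and xy: "x \<in> carrier H" "y \<in> carrier H"
  shows "hinner H (T x) y = hinner H x (T y)"
proof -
  have lin: "\<And>x. x \<in> carrier H \<Longrightarrow> T x \<in> carrier H"
    "\<And>x y. x \<in> carrier H \<Longrightarrow> y \<in> carrier H \<Longrightarrow> T (x \<oplus> y) = T x \<oplus> T y"
    "\<And>c x. x \<in> carrier H \<Longrightarrow> T (c \<odot> x) = c \<odot> T x"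
    and pos: "\<And>x. x \<in> carrier H \<Longrightarrow> hinner H (T x) x \<in> \<real>\<^sub>\<ge>\<^sub>0"
    using T by (auto simp: positive_op_def bounded_op_def)
  have *: "hinner H (T (x \<oplus> c \<odot> y)) (x \<oplus> c \<odot> y) =
    hinner H (T x) x + cnj c * hinner H (T x) y + c * hinner H (T y) x + c * cnj c * hinner H (T y) y" for c
    using xy lin by (simp add: inner_add_left inner_add_right inner_smult_left inner_smult_right algebra_simps)
  have "hinner H (T x) y = cnj (hinner H (T y) x)"
  proof (rule polarization_cnj[OF pos[OF xy(1)] pos[OF xy(2)]])
    show "hinner H (T x) x + hinner H (T x) y + hinner H (T y) x + hinner H (T y) y \<in> \<real>\<^sub>\<ge>\<^sub>0"
      using pos[of "x \<oplus> 1 \<odot> y"] xy unfolding *[of 1] by simp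
    show "hinner H (T x) x - \<i> * hinner H (T x) y + \<i> * hinner H (T y) x + hinner H (T y) y \<in> \<real>\<^sub>\<ge>\<^sub>0"
      using pos[of "x \<oplus> \<i> \<odot> y"] xy unfolding *[of \<i>] by simp
  qed
  then show ?thesis
    using inner_commute[OF xy(1) lin(1)[OF xy(2)]] by simp
qed

lemma lspan_closed: "X \<subseteq> carrier H \<Longrightarrow> x \<in> lspan H X \<Longrightarrow> x \<in> carrier H"
  by (rotate_tac 1, induction rule: lspan.induct) auto

lemma lspan_invariant:
  assumes X: "X \<subseteq> carrier H" and T: "bounded_op H T" "T ` X \<subseteq> X" and x: "x \<in> lspan H X"
  shows "T x \<in> lspan H X"
  using x
proof (induction rule: lspan.induct)
  case zero
  have "T (0 \<odot> \<zero>) = 0 \<odot> T \<zero>" "T \<zero> \<in> carrier H"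
    using T(1) unfolding bounded_op_def by blast+
  then have "T \<zero> = \<zero>"
    by (simp add: smult_zero_left)
  then show ?case by (simp add: lspan.zero)
next
  case (base x)
  then show ?case using T(2) by (auto intro: lspan.base)
next
  case (add x y)
  then show ?case
    using T(1) lspan_closed[OF X] by (auto simp: bounded_op_def intro: lspan.add)
next
  case (smult x c)
  then show ?case
    using T(1) lspan_closed[OF X] by (auto simp: bounded_op_def intro: lspan.smult)
qed

text \<open>Expand \<open>y\<close> against \<open>e i\<close>: every term contains the inner
  product of \<open>e i\<close> with a different frame vector. This is the reason for finite
  columns.\<close>

lemma expands_outside:
  assumes e: "orthonormal_or_zero H e" and y: "expands H e S y" and i: "i \<notin> S"
  shows "hinner H y (e i) = 0"
proof -
  have "hinner H y (e i) = (\<Sum>k\<in>S. hinner H y (e k) * hinner H (e k) (e i))"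
    using y e by (auto simp: expands_def orthonormal_or_zero_def)
  also have "\<dots> = 0"
  proof (intro sum.neutral ballI)
    fix k assume "k \<in> S"
    with i have "k \<noteq> i" by blast
    with e show "hinner H y (e k) * hinner H (e k) (e i) = 0"
      by (simp add: orthonormal_or_zero_def)
  qed
  finally show ?thesis .
qed

lemma expands_mono:
  assumes e: "orthonormal_or_zero H e" and y: "expands H e S y" and S: "finite T" "S \<subseteq> T"
  shows "expands H e T y"
  unfolding expands_def
proof
  fix z assume z: "z \<in> carrier H"
  have "hinner H y z = (\<Sum>i\<in>S. hinner H y (e i) * hinner H (e i) z)"
    using y z unfolding expands_def by blast
  also have "\<dots> = (\<Sum>i\<in>T. hinner H y (e i) * hinner H (e i) z)"
    using S expands_outside[OF e y] by (intro sum.mono_neutral_left) auto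
  finally show "hinner H y z = (\<Sum>i\<in>T. hinner H y (e i) * hinner H (e i) z)" .
qed

text \<open>Needed because the zero vectors of a frame lie outside the index set of its matrices,
  while the support of the state must lie inside.\<close>

lemma expands_nonzero:
  assumes e: "orthonormal_or_zero H e" and y: "expands H e S y" and S: "finite S"
  shows "expands H e {i \<in> S. e i \<noteq> \<zero>} y"
  unfolding expands_def
proof
  fix z assume z: "z \<in> carrier H"
  have "hinner H y z = (\<Sum>i\<in>S. hinner H y (e i) * hinner H (e i) z)"
    using y z unfolding expands_def by blast
  also have "\<dots> = (\<Sum>i\<in>{i \<in> S. e i \<noteq> \<zero>}. hinner H y (e i) * hinner H (e i) z)"
    using S z by (intro sum.mono_neutral_right) auto
  finally show "hinner H y z = (\<Sum>i\<in>{i \<in> S. e i \<noteq> \<zero>}. hinner H y (e i) * hinner H (e i) z)" .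
qed

lemma expands_zero: "orthonormal_or_zero H e \<Longrightarrow> expands H e S \<zero>"
  by (simp add: expands_def orthonormal_or_zero_def)

lemma expandsD: "expands H e S y \<Longrightarrow> z \<in> carrier H \<Longrightarrow>
    hinner H y z = (\<Sum>i\<in>S. hinner H y (e i) * hinner H (e i) z)"
  by (simp add: expands_def)

lemma expands_add:
  assumes "orthonormal_or_zero H e" "expands H e S x" "expands H e S y" "x \<in> carrier H" "y \<in> carrier H"
  shows "expands H e S (x \<oplus> y)"
  unfolding expands_def
proof
  fix z assume z: "z \<in> carrier H"
  have c: "e i \<in> carrier H" for i
    using assms(1) by (simp add: orthonormal_or_zero_def)
  show "hinner H (x \<oplus> y) z = (\<Sum>i\<in>S. hinner H (x \<oplus> y) (e i) * hinner H (e i) z)"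
    using assms(4,5) c z expandsD[OF assms(2) z] expandsD[OF assms(3) z]
    by (simp only: inner_add_left distrib_right sum.distrib)
qed

lemma expands_smult:
  assumes "orthonormal_or_zero H e" "expands H e S x" "x \<in> carrier H"
  shows "expands H e S (c \<odot> x)"
  unfolding expands_def
proof
  fix z assume z: "z \<in> carrier H"
  have "e i \<in> carrier H" for i
    using assms(1) by (simp add: orthonormal_or_zero_def)
  then show "hinner H (c \<odot> x) z = (\<Sum>i\<in>S. hinner H (c \<odot> x) (e i) * hinner H (e i) z)"
    using assms(3) z expandsD[OF assms(2) z]
    by (simp only: inner_smult_left mult.assoc sum_distrib_left[symmetric])
qed

lemma expands_finsum:
  assumes "orthonormal_or_zero H e" "finite K" "\<And>k. k \<in> K \<Longrightarrow> expands H e S (f k)" "\<And>k. k \<in> K \<Longrightarrow> f k \<in> carrier H"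
  shows "expands H e S (\<Oplus>k\<in>K. f k)"
  using assms(2-)
proof (induction K rule: finite_induct)
  case empty
  then show ?case using expands_zero[OF assms(1)] by simp
next
  case (insert a K)
  then have "f \<in> K \<rightarrow> carrier H" "f a \<in> carrier H"
    by auto
  with insert show ?case
    by (simp add: M.finsum_insert M.finsum_closed expands_add[OF assms(1)])
qed

lemma lspan_expands:
  assumes e: "orthonormal_or_zero H e" and X: "X \<subseteq> carrier H" "\<And>x. x \<in> X \<Longrightarrow> \<exists>S. finite S \<and> expands H e S x"
    and "x \<in> lspan H X"
  shows "\<exists>S. finite S \<and> expands H e S x"
  using assms(4)
proof (induction rule: lspan.induct)
  case zero
  then show ?case using expands_zero[OF e] by blast
next
  case (base x)
  then show ?case by (rule X(2))
next
  case (add x y)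
  then obtain S T where "finite S" "expands H e S x" "finite T" "expands H e T y"
    by blast
  then have "expands H e (S \<union> T) x" "expands H e (S \<union> T) y"
    using expands_mono[OF e, of _ _ "S \<union> T"] by auto
  with \<open>finite S\<close> \<open>finite T\<close> show ?case
    using expands_add[OF e] add.hyps lspan_closed[OF X(1)] by (intro exI[of _ "S \<union> T"]) auto
next
  case (smult x c)
  then show ?case
    using expands_smult[OF e] lspan_closed[OF X(1)] by blast
qed

lemma gram_schmidt_residual:
  assumes "\<And>k. k \<in> set ks \<Longrightarrow> g k \<in> carrier H" "x \<in> carrier H"
  shows "foldr (\<lambda>k y. y \<oplus> c k \<odot> g k) ks x \<in> carrier H"
    and "z \<in> carrier H \<Longrightarrow> hinner H (foldr (\<lambda>k y. y \<oplus> c k \<odot> g k) ks x) z =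
      hinner H x z + (\<Sum>k\<leftarrow>ks. c k * hinner H (g k) z)"
proof -
  have "foldr (\<lambda>k y. y \<oplus> c k \<odot> g k) ks x \<in> carrier H \<and>
    (z \<in> carrier H \<longrightarrow> hinner H (foldr (\<lambda>k y. y \<oplus> c k \<odot> g k) ks x) z =
      hinner H x z + (\<Sum>k\<leftarrow>ks. c k * hinner H (g k) z))"
    using assms by (induction ks) (auto simp: inner_add_left inner_smult_left)
  then show "foldr (\<lambda>k y. y \<oplus> c k \<odot> g k) ks x \<in> carrier H"
    "z \<in> carrier H \<Longrightarrow> hinner H (foldr (\<lambda>k y. y \<oplus> c k \<odot> g k) ks x) z =
      hinner H x z + (\<Sum>k\<leftarrow>ks. c k * hinner H (g k) z)"
    by blast+
qed

lemma lspan_foldr: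
  assumes "\<And>k. k \<in> set ks \<Longrightarrow> g k \<in> lspan H X" "x \<in> lspan H X"
  shows "foldr (\<lambda>k y. y \<oplus> c k \<odot> g k) ks x \<in> lspan H X"
  using assms by (induction ks) (auto intro: lspan.intros)

lemma inner_self_eq_hnorm: "x \<in> carrier H \<Longrightarrow> hinner H x x = of_real ((hnorm H x)\<^sup>2)"
  using inner_nonneg[of x] by (simp add: hnorm_def complex_nonneg_Reals_iff complex_eq_iff)

lemma gram_schmidt_properties:
  fixes x :: "nat \<Rightarrow> 'h"
  assumes x: "\<And>n. x n \<in> carrier H"
  defines "e \<equiv> gram_schmidt H x"
  shows "orthonormal_or_zero H e" and "expands H e {..n} (x n)" and "e n \<in> lspan H (range x)"
proof -
  have X: "range x \<subseteq> carrier H"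
    using x by auto
  have span: "e n \<in> lspan H (range x)" for n
  proof (induction n rule: less_induct)
    case (less n)
    then show ?case
      unfolding e_def gram_schmidt.simps[of H x n] Let_def
      by (intro lspan.smult lspan_foldr) (auto intro: lspan.base simp: e_def)
  qed
  then have c: "e n \<in> carrier H" for n
    using lspan_closed[OF X] by blast
  define u where "u n = foldr (\<lambda>k y. y \<oplus> (- hinner H (x n) (e k)) \<odot> e k) [0..<n] (x n)" for n
  define r where "r n = 1 / hnorm H (u n)" for n
  have eu: "e n = of_real (r n) \<odot> u n" for n
    unfolding e_def r_def u_def by (subst gram_schmidt.simps) (simp add: Let_def)
  have uc: "u n \<in> carrier H" for n
    unfolding u_def using c x by (intro gram_schmidt_residual(1))
  have ui: "hinner H (u n) z = hinner H (x n) z - (\<Sum>k<n. hinner H (x n) (e k) * hinner H (e k) z)"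
    if "z \<in> carrier H" for n z
    unfolding u_def
    using gram_schmidt_residual(2)[where g = e, OF c x that, where ks = "[0..<n]" and c = "\<lambda>k. - hinner H (x n) (e k)"]
    by (simp add: interv_sum_list_conv_sum_set_nat sum_negf atLeast0LessThan)
  \<comment> \<open>Either the residual vanishes, and with it \<open>e n\<close>, or
    \<open>r n\<close> really normalises.\<close>
  have zero: "u n = \<zero> \<or> r n * hnorm H (u n) = 1" for n
  proof (cases "hnorm H (u n) = 0")
    case True
    then have "hinner H (u n) (u n) = 0"
      using inner_self_eq_hnorm[OF uc] by simp
    then show ?thesis using inner_definite[OF uc] by simp
  qed (simp add: r_def)
  have ee: "hinner H (e n) (e n) = of_real ((r n * hnorm H (u n))\<^sup>2)" for n
  proof -
    have "hinner H (e n) (e n) = of_real (r n) * (of_real (r n) * hinner H (u n) (u n))"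
      unfolding eu using uc by (simp add: inner_smult_left inner_smult_right)
    then show ?thesis
      by (simp add: inner_self_eq_hnorm[OF uc] power2_eq_square)
  qed
  have unit: "hinner H (e n) (e n) = 1 \<or> e n = \<zero>" for n
    using zero[of n]
  proof
    assume "u n = \<zero>"
    then show ?thesis using eu[of n] smult_zero_left[of "\<zero>"]
      by (metis M.zero_closed r_def division_ring_divide_zero of_real_0 hnorm_def inner_zero_left zero_complex.simps(1) real_sqrt_zero)
  qed (simp add: ee)
  have orth: "\<forall>j<n. hinner H (e n) (e j) = 0" for n
  proof (induction n rule: less_induct)
    case (less n)
    show ?case
    proof (intro allI impI)
      fix j assume j: "j < n"
      \<comment> \<open>The induction hypothesis applies to the larger of \<open>k\<close> and
        \<open>j\<close>, both being below \<open>n\<close>; conjugate symmetry gives the other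
        order.\<close>
      have off: "hinner H (e k) (e j) = 0" if "k < n" "k \<noteq> j" for k
        using less.IH[of k] less.IH[of j] that j inner_commute[OF c c, of k j]
        by (cases "j < k") auto
      have "(\<Sum>k<n. hinner H (x n) (e k) * hinner H (e k) (e j)) =
        (\<Sum>k<n. if k = j then hinner H (x n) (e j) else 0)"
        using off unit[of j] c x by (intro sum.cong) auto
      then have "hinner H (u n) (e j) = 0"
        using j by (simp add: ui[OF c])
      then show "hinner H (e n) (e j) = 0"
        unfolding eu[of n] using uc c by (simp add: inner_smult_left)
    qed
  qed
  have orth': "hinner H (e i) (e j) = 0" if "i \<noteq> j" for i j
    using orth[of i] orth[of j] that inner_commute[OF c c, of i j] by (cases "j < i") auto
  show on: "orthonormal_or_zero H e"
    using c orth' unit by (simp add: orthonormal_or_zero_def)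
  show "e n \<in> lspan H (range x)" by (rule span)
  show "expands H e {..n} (x n)"
    unfolding expands_def
  proof
    fix z assume z: "z \<in> carrier H"
    \<comment> \<open>The vectors \<open>x n\<close> and \<open>u n\<close> differ by a combination
      of earlier frame vectors, all orthogonal to \<open>e n\<close>; so the \<open>n\<close>-th
      term of the expansion restores exactly the residual.\<close>
    have "(\<Sum>k<n. hinner H (x n) (e k) * hinner H (e k) (e n)) = 0"
      using orth' by (intro sum.neutral) auto
    then have "hinner H (x n) (e n) = hinner H (u n) (e n)"
      using ui[OF c, of n n] by simp
    also have "\<dots> = of_real (r n) * of_real ((hnorm H (u n))\<^sup>2)"
      unfolding eu[of n] using uc by (simp add: inner_smult_right inner_self_eq_hnorm)
    finally have "hinner H (x n) (e n) * hinner H (e n) z =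
      of_real ((r n * hnorm H (u n))\<^sup>2) * hinner H (u n) z"
      unfolding eu[of n] using uc z by (simp add: inner_smult_left power2_eq_square)
    also have "\<dots> = hinner H (u n) z"
      using zero[of n] z by (elim disjE) (simp_all del: of_real_mult of_real_power)
    finally show "hinner H (x n) z = (\<Sum>i\<le>n. hinner H (x n) (e i) * hinner H (e i) z)"
      using ui[OF z, of n] by (simp add: lessThan_Suc_atMost[symmetric])
  qed
qed

end

text \<open>\<open>D\<close> is a domain of finitely expandable vectors, to be mapped into itself by
  the operators considered. It is the span of the orbit of the state in the commuting case and the
  whole carrier in the finite dimensional case.\<close>

locale invariant_frame = hilbert_space H for H :: "'h hilbert" (structure) +
  fixes e :: "'i \<Rightarrow> 'h" and D :: "'h set"
  assumes onz: "orthonormal_or_zero H e"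
    and D_carrier: "D \<subseteq> carrier H" and e_D: "e i \<in> D"
    and D_expands: "y \<in> D \<Longrightarrow> \<exists>S. finite S \<and> expands H e S y"
begin

abbreviation "index \<equiv> {i. e i \<noteq> \<zero>}"

lemma e_carrier [simp]: "e i \<in> carrier H"
  using onz by (simp add: orthonormal_or_zero_def)

context
  fixes T assumes T: "positive_op H T" and TD: "T ` D \<subseteq> D"
begin

lemma T_carrier: "x \<in> carrier H \<Longrightarrow> T x \<in> carrier H"
  using T by (auto simp: positive_op_def bounded_op_def)

lemma T_zero: "T \<zero> = \<zero>"
proof -
  have "T (0 \<odot> \<zero>) = 0 \<odot> T \<zero>"
    using T unfolding positive_op_def bounded_op_def by blast
  then show ?thesis
    by (simp add: smult_zero_left T_carrier)
qed

lemma op_matrix_hermitian: "op_matrix H e T j i = cnj (op_matrix H e T i j)"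
  using positive_op_selfadjoint[OF T, of "e i" "e j"] inner_commute[of "T (e j)" "e i"] T_carrier
  by (simp add: op_matrix_def)

lemma rcf_op_matrix: "rcf index (op_matrix H e T)"
proof -
  have col: "finite {i. op_matrix H e T i j \<noteq> 0}" for j
  proof -
    obtain S where S: "finite S" "expands H e S (T (e j))"
      using D_expands TD e_D by blast
    then show ?thesis
      using expands_outside[OF onz S(2)] by (auto simp: op_matrix_def intro!: finite_subset[OF _ S(1)])
  qed
  moreover have "finite {j. op_matrix H e T i j \<noteq> 0}" for i
    using col[of i] op_matrix_hermitian[of _ i] by simp
  moreover have "e i \<noteq> \<zero> \<and> e j \<noteq> \<zero>" if "op_matrix H e T i j \<noteq> 0" for i j
    using that T_zero T_carrier[of "e j"] by (auto simp: op_matrix_def)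
  ultimately show ?thesis
    by (simp add: rcf_def)
qed

text \<open>The form of the matrix at \<open>c\<close> is the form of \<open>T\<close> at the
  combination of the frame vectors with coefficients \<open>c\<close>.\<close>

lemma psd_op_matrix: "psd (op_matrix H e T)"
  unfolding psd_def
proof (intro allI impI)
  fix S :: "'i set" and c assume S: "finite S"
  define y where "y = (\<Oplus>i\<in>S. c i \<odot> e i)"
  have y: "y \<in> carrier H"
    unfolding y_def by (intro M.finsum_closed) auto
  have "hinner H (T y) y = (\<Sum>i\<in>S. hinner H (T y) (c i \<odot> e i))"
    using S T_carrier[OF y] inner_finsum_right[of S "\<lambda>i. c i \<odot> e i" "T y"]
    by (simp add: y_def)
  also have "\<dots> = (\<Sum>i\<in>S. cnj (c i) * hinner H y (T (e i)))"
    using T_carrier y by (simp add: inner_smult_right positive_op_selfadjoint[OF T])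
  also have "\<dots> = (\<Sum>i\<in>S. cnj (c i) * (\<Sum>j\<in>S. c j * hinner H (e j) (T (e i))))"
    unfolding y_def using S T_carrier by (simp add: inner_finsum_left inner_smult_left)
  also have "\<dots> = qform S (op_matrix H e T) c"
    using positive_op_selfadjoint[OF T, symmetric]
    by (simp add: qform_def op_matrix_def sum_distrib_left mult_ac)
  finally show "qform S (op_matrix H e T) c \<in> \<real>\<^sub>\<ge>\<^sub>0"
    using T y by (auto simp: positive_op_def)
qed

end

text \<open>Moving \<open>T\<close> to the other side leaves \<open>U (e k)\<close> to be expanded,
  which is a finite sum. The set \<open>R\<close> joins its index set with the support of row
  \<open>i\<close>, so that expansion and matrix product become the same sum.\<close>

lemma mmul_op_matrix:
  assumes T: "positive_op H T" "T ` D \<subseteq> D" and U: "positive_op H U" "U ` D \<subseteq> D"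
  shows "mmul (op_matrix H e T) (op_matrix H e U) i k = hinner H (T (U (e k))) (e i)"
proof -
  obtain S where S: "finite S" "expands H e S (U (e k))"
    using D_expands U e_D by blast
  define R where "R = S \<union> {j. op_matrix H e T i j \<noteq> 0}"
  have R: "finite R"
    using S rcf_op_matrix[OF T] by (simp add: R_def rcf_def)
  have c: "U (e k) \<in> carrier H" "T (e i) \<in> carrier H"
    using T_carrier[OF T] T_carrier[OF U] by auto
  have "hinner H (T (U (e k))) (e i) = hinner H (U (e k)) (T (e i))"
    using c by (intro positive_op_selfadjoint[OF T(1)]) auto
  also have "\<dots> = (\<Sum>j\<in>R. hinner H (U (e k)) (e j) * hinner H (e j) (T (e i)))"
    using expands_mono[OF onz S(2) R] c by (auto simp: R_def expands_def)
  also have "\<dots> = (\<Sum>j\<in>R. op_matrix H e T i j * op_matrix H e U j k)"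
    using positive_op_selfadjoint[OF T(1), symmetric] by (simp add: op_matrix_def mult.commute)
  also have "\<dots> = mmul (op_matrix H e T) (op_matrix H e U) i k"
    using R by (intro mmul_superset[symmetric]) (auto simp: R_def)
  finally show ?thesis ..
qed

text \<open>Only \<open>\<xi>\<close> is expanded, twice, after the operators have been moved across
  by self-adjointness; so the one finite set \<open>S\<close> serves both sums of the quadratic
  form.\<close>

lemma inner_op_op:
  assumes T: "positive_op H T" "T ` D \<subseteq> D" and U: "positive_op H U" "U ` D \<subseteq> D"
    and S: "expands H e S \<xi>" and \<xi>: "\<xi> \<in> carrier H"
  shows "hinner H (T (U \<xi>)) \<xi> = qform S (mmul (op_matrix H e T) (op_matrix H e U)) (\<lambda>i. hinner H \<xi> (e i))"
proof -
  have c: "T (U x) \<in> carrier H" "U (T x) \<in> carrier H" "U x \<in> carrier H" "T x \<in> carrier H" if "x \<in> carrier H" for x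
    using T_carrier[OF T] T_carrier[OF U] that by auto
  have adj: "hinner H (T (U x)) y = hinner H x (U (T y))" if "x \<in> carrier H" "y \<in> carrier H" for x y
    using that c positive_op_selfadjoint[OF T(1), of "U x" y] positive_op_selfadjoint[OF U(1), of x "T y"] by simp
  have "hinner H (T (U \<xi>)) \<xi> = cnj (hinner H \<xi> (T (U \<xi>)))"
    using inner_commute c \<xi> by blast
  also have "\<dots> = (\<Sum>i\<in>S. cnj (hinner H \<xi> (e i)) * cnj (hinner H (e i) (T (U \<xi>))))"
    unfolding expandsD[OF S c(1)[OF \<xi>]] by simp
  also have "\<dots> = (\<Sum>i\<in>S. cnj (hinner H \<xi> (e i)) * hinner H \<xi> (U (T (e i))))"
    using inner_commute[OF c(1)[OF \<xi>] e_carrier, symmetric] adj[OF \<xi> e_carrier] by simp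
  also have "\<dots> = (\<Sum>i\<in>S. cnj (hinner H \<xi> (e i)) * (\<Sum>j\<in>S. hinner H \<xi> (e j) * hinner H (e j) (U (T (e i)))))"
    using expandsD[OF S c(2)[OF e_carrier]] by simp
  also have "\<dots> = qform S (mmul (op_matrix H e T) (op_matrix H e U)) (\<lambda>i. hinner H \<xi> (e i))"
    by (simp add: qform_def mmul_op_matrix[OF T U] adj sum_distrib_left mult_ac)
  finally show ?thesis .
qed

text \<open>Summing inside the inner product leaves the Gram matrix of the frame, which is
  \<open>idm index\<close> because \<open>index\<close> omits exactly the zero vectors.\<close>

lemma mpovm_op_matrix:
  assumes E: "povm H I E" and D: "\<And>k. k \<in> I \<Longrightarrow> E k ` D \<subseteq> D"
  shows "mpovm index I (\<lambda>k. op_matrix H e (E k))"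
proof -
  have pos: "positive_op H (E k)" if "k \<in> I" for k
    using E that by (simp add: povm_def)
  have "(\<Sum>k\<in>I. op_matrix H e (E k) i j) = idm index i j" for i j
  proof -
    have "(\<Sum>k\<in>I. op_matrix H e (E k) i j) = hinner H (\<Oplus>k\<in>I. E k (e j)) (e i)"
      unfolding op_matrix_def using E pos D T_carrier
      by (intro inner_finsum_left[symmetric]) (auto simp: povm_def)
    also have "\<dots> = hinner H (e j) (e i)"
      using E by (simp add: povm_def)
    also have "\<dots> = idm index i j"
      using onz by (auto simp: idm_def orthonormal_or_zero_def)
    finally show ?thesis .
  qed
  then show ?thesis
    using E pos D rcf_op_matrix psd_op_matrix by (simp add: mpovm_def povm_def)
qed

lemma mfam_op_matrix:
  assumes "hfam b H X Y E" "\<And>x y. x \<in> X \<Longrightarrow> y \<in> Y \<Longrightarrow> E x y ` D \<subseteq> D"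
  shows "mfam b index X Y (\<lambda>x y. op_matrix H e (E x y))"
  using assms by (auto simp: hfam_def mfam_def intro!: mpovm_op_matrix)

lemma sum_coefficients:
  assumes "expands H e S \<xi>" "\<xi> \<in> carrier H" "hnorm H \<xi> = 1"
  shows "(\<Sum>i\<in>S. (cmod (hinner H \<xi> (e i)))\<^sup>2) = 1"
proof -
  have "of_real (\<Sum>i\<in>S. (cmod (hinner H \<xi> (e i)))\<^sup>2) = (\<Sum>i\<in>S. hinner H \<xi> (e i) * cnj (hinner H \<xi> (e i)))"
    by (simp add: complex_norm_square del: of_real_power)
  also have "\<dots> = (\<Sum>i\<in>S. hinner H \<xi> (e i) * hinner H (e i) \<xi>)"
    using assms(2) inner_commute[OF e_carrier assms(2)] by simp
  also have "\<dots> = of_real ((hnorm H \<xi>)\<^sup>2)"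
    unfolding inner_self_eq_hnorm[OF assms(2), symmetric] using expandsD[OF assms(1,2)] ..
  also have "\<dots> = 1"
    using assms(3) by simp
  finally show ?thesis
    unfolding of_real_eq_1_iff .
qed

end

section \<open>Matrix models of operator realisations\<close>

text \<open>The span of the orbit of \<open>\<xi>\<close> need not be dense in \<open>H\<close>, but
  it contains the state and is invariant, so commutation and values survive the passage to it.
  Finitely many operators have countably many words, so \<open>nat\<close> can index the
  frame.\<close>

lemma qc_model_of_realizable:
  assumes "qc_realizable TYPE('h) b V2 W1 V1 W2 \<Gamma>"
    and fin: "finite V2" "finite W1" "finite V1" "finite W2"
  shows "\<exists>(N :: nat set) S x A B. qc_model b N S x V2 W1 V1 W2 A B (entry \<Gamma>)"
proof -
  obtain H :: "'h hilbert" and \<xi> E F where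
    E: "hfam b H V2 V1 E" and F: "hfam b H W1 W2 F" and model: "commuting_model H \<xi> V2 W1 V1 W2 E F \<Gamma>"
    using assms(1) unfolding qc_realizable_def by blast
  interpret hilbert_space H
    using model by (simp add: commuting_model_def)
  have \<xi>: "\<xi> \<in> carrier H" "hnorm H \<xi> = 1"
    using model by (auto simp: commuting_model_def)
  define Ops where "Ops = (\<Union>v2\<in>V2. E v2 ` V1) \<union> (\<Union>w1\<in>W1. F w1 ` W2)"
  have Ops_pos: "positive_op H T" if "T \<in> Ops" for T
    using that E F by (auto simp: Ops_def hfam_def povm_def)
  have Ops: "bounded_op H T" "T y \<in> carrier H" if "T \<in> Ops" "y \<in> carrier H" for T y
    using Ops_pos[OF that(1)] that(2) by (auto simp: positive_op_def bounded_op_def)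
  define X where "X = (\<lambda>ts. foldr (\<lambda>T y. T y) ts \<xi>) ` lists Ops"
  have "foldr (\<lambda>T y. T y) ts \<xi> \<in> carrier H" if "ts \<in> lists Ops" for ts
    using that by (induction ts) (auto simp: \<xi> Ops)
  then have X: "X \<subseteq> carrier H"
    by (auto simp: X_def)
  have \<xi>X: "\<xi> \<in> X"
    unfolding X_def by (rule image_eqI[of _ _ "[]"]) auto
  have XT: "T ` X \<subseteq> X" if "T \<in> Ops" for T
  proof
    fix y assume "y \<in> T ` X"
    then obtain ts where ts: "ts \<in> lists Ops" "y = T (foldr (\<lambda>T y. T y) ts \<xi>)"
      by (auto simp: X_def)
    then show "y \<in> X"
      unfolding X_def using that by (intro image_eqI[of _ _ "T # ts"]) auto
  qed
  have "countable Ops"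
    unfolding Ops_def using fin by (intro uncountable_infinite countable_finite) auto
  then have "countable X"
    by (simp add: X_def countable_lists)
  then have range: "range (from_nat_into X) = X"
    using \<xi>X by (intro range_from_nat_into) auto
  define e where "e = gram_schmidt H (from_nat_into X)"
  have c: "from_nat_into X n \<in> carrier H" for n
    using range X by blast
  have onz: "orthonormal_or_zero H e"
    unfolding e_def by (rule gram_schmidt_properties(1)[OF c])
  have expX: "\<exists>S. finite S \<and> expands H e S y" if yX: "y \<in> X" for y
  proof -
    obtain n where "y = from_nat_into X n"
      using range yX by blast
    then show ?thesis
      using gram_schmidt_properties(2)[of "from_nat_into X" n, OF c] by (intro exI[of _ "{..n}"]) (simp add: e_def)
  qed
  have expD: "\<exists>S. finite S \<and> expands H e S y" if "y \<in> lspan H X" for y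
    using lspan_expands[OF onz X expX that] .
  interpret invariant_frame H e "lspan H X"
  proof
    show "e i \<in> lspan H X" for i
      using gram_schmidt_properties(3)[of "from_nat_into X" i, OF c] range by (simp add: e_def)
  qed (use onz expD lspan_closed[OF X] in auto)
  have inv: "T ` lspan H X \<subseteq> lspan H X" if "T \<in> Ops" for T
    using lspan_invariant[OF X _ XT[OF that]] Ops(1)[OF that \<xi>(1)] by blast
  define A where "A v2 v1 = op_matrix H e (E v2 v1)" for v2 v1
  define B where "B w1 w2 = op_matrix H e (F w1 w2)" for w1 w2
  have EO: "E v2 v1 \<in> Ops" if "v2 \<in> V2" "v1 \<in> V1" for v2 v1
    using that by (auto simp: Ops_def)
  have FO: "F w1 w2 \<in> Ops" if "w1 \<in> W1" "w2 \<in> W2" for w1 w2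
    using that by (auto simp: Ops_def)
  obtain S0 where S0: "finite S0" "expands H e S0 \<xi>"
    using expX[OF \<xi>X] by blast
  \<comment> \<open>Zero frame vectors are removed because a model requires \<open>S\<close> to lie
    in its index set.\<close>
  define S where "S = {i \<in> S0. e i \<noteq> \<zero>\<^bsub>H\<^esub>}"
  have S: "expands H e S \<xi>" "finite S" "S \<subseteq> index"
    unfolding S_def using expands_nonzero[OF onz S0(2,1)] S0 by auto
  have "qc_model b index S (\<lambda>i. hinner H \<xi> (e i)) V2 W1 V1 W2 A B (entry \<Gamma>)"
    unfolding qc_model_def
  proof (intro conjI ballI allI impI)
    show "mfam b index V2 V1 A"
      unfolding A_def using mfam_op_matrix[OF E inv[OF EO]] .
    show "mfam b index W1 W2 B"
      unfolding B_def using mfam_op_matrix[OF F inv[OF FO]] .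
    show "(\<Sum>i\<in>S. (cmod (hinner H \<xi> (e i)))\<^sup>2) = 1"
      by (rule sum_coefficients[OF S(1) \<xi>])
    show "hinner H \<xi> (e i) = 0" if "i \<notin> S" for i
      using expands_outside[OF onz S(1) that] .
    fix v2 v1 w1 w2 assume *: "v2 \<in> V2" "v1 \<in> V1" "w1 \<in> W1" "w2 \<in> W2"
    note EF = Ops_pos[OF EO[OF *(1,2)]] inv[OF EO[OF *(1,2)]] Ops_pos[OF FO[OF *(3,4)]] inv[OF FO[OF *(3,4)]]
    have comm: "E v2 v1 (F w1 w2 x) = F w1 w2 (E v2 v1 x)" if "x \<in> carrier H" for x
      using model * that by (auto simp: commuting_model_def)
    show "mmul (A v2 v1) (B w1 w2) = mmul (B w1 w2) (A v2 v1)"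
      unfolding A_def B_def
      by (intro ext) (simp add: mmul_op_matrix[OF EF] mmul_op_matrix[OF EF(3,4,1,2)] comm)
    show "entry \<Gamma> (v1, w2) (v2, w1) = qform S (mmul (A v2 v1) (B w1 w2)) (\<lambda>i. hinner H \<xi> (e i))"
      using model * inner_op_op[OF EF S(1) \<xi>(1)] by (auto simp: commuting_model_def A_def B_def)
  qed (use S in auto)
  then show ?thesis by blast
qed

section \<open>Finite dimensional frames and tensor product realisations\<close>

lemma (in hilbert_space) finite_dimensional_frame:
  assumes "finite_dimensional H"
  shows "\<exists>(e :: nat \<Rightarrow> 'h) n. orthonormal_or_zero H e \<and> (\<forall>y\<in>carrier H. expands H e {..<n} y)"
proof -
  obtain n b where b: "\<forall>i<n. b i \<in> carrier H"
    and span: "\<forall>x\<in>carrier H. \<exists>c. x = (\<Oplus>\<^bsub>H\<^esub>i\<in>{..<n::nat}. c i \<odot>\<^bsub>H\<^esub> b i)"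
    using assms unfolding finite_dimensional_def by blast
  \<comment> \<open>Padding with zero vectors makes the finite spanning family a sequence to which
    Gram-Schmidt applies.\<close>
  define x where "x i = (if i < n then b i else \<zero>\<^bsub>H\<^esub>)" for i
  have x: "x i \<in> carrier H" for i
    using b by (simp add: x_def)
  note gs = gram_schmidt_properties[of x, OF x]
  have be: "expands H (gram_schmidt H x) {..<n} (b i)" if "i < n" for i
  proof -
    have "{..i} \<subseteq> {..<n}"
      using that by auto
    with that show ?thesis
      using expands_mono[OF gs(1) gs(2)[of i], of "{..<n}"] by (simp add: x_def)
  qed
  have "expands H (gram_schmidt H x) {..<n} y" if y: "y \<in> carrier H" for y
  proof -
    obtain c where c: "y = (\<Oplus>\<^bsub>H\<^esub>i\<in>{..<n}. c i \<odot>\<^bsub>H\<^esub> b i)"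
      using span y by blast
    show ?thesis
      unfolding c using b by (intro expands_finsum[OF gs(1)] expands_smult[OF gs(1)] be) auto
  qed
  with gs(1) show ?thesis by blast
qed

text \<open>Principal submatrices inherit all conditions. Along the slices
  \<open>i \<mapsto> (i, j)\<close> and \<open>i \<mapsto> (j, i)\<close> of a Kronecker product
  with an identity they recover the local POVMs, whose positivity \<open>tensor_split\<close> does
  not state.\<close>

lemma mpovm_restrict:
  fixes g :: "'i \<Rightarrow> 'j"
  assumes m: "mpovm P I C" and g: "inj g" and N: "\<And>i. g i \<in> P \<longleftrightarrow> i \<in> N"
    and A: "\<And>k i j. C k (g i) (g j) = A k i j"
  shows "mpovm N I A"
proof -
  have "rcf N (A k)" if "k \<in> I" for k
  proof -
    have r: "rcf P (C k)"
      using m that by (simp add: mpovm_def)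
    have "finite (g -` {q. C k (g i) q \<noteq> 0})" "finite (g -` {q. C k q (g i) \<noteq> 0})" for i
      using r g finite_vimageI unfolding rcf_def by blast+
    then have "finite {j. A k i j \<noteq> 0}" "finite {j. A k j i \<noteq> 0}" for i
      by (simp_all add: vimage_def A)
    moreover have "i \<in> N \<and> j \<in> N" if "A k i j \<noteq> 0" for i j
      using r that unfolding rcf_def by (metis A N)
    ultimately show ?thesis by (simp add: rcf_def)
  qed
  moreover have "psd (A k)" if "k \<in> I" for k
    unfolding psd_def
  proof (intro allI impI)
    fix S x assume S: "finite (S :: 'i set)"
    have "bij_betw g S (g ` S)"
      using g by (meson bij_betw_imageI inj_on_subset subset_UNIV)
    from qform_reindex[OF this, of "C k" "\<lambda>p. x (inv_into UNIV g p)"]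
    have "qform S (A k) x = qform (g ` S) (C k) (\<lambda>p. x (inv_into UNIV g p))"
      using g by (simp add: A)
    then show "qform S (A k) x \<in> \<real>\<^sub>\<ge>\<^sub>0"
      using m that S by (simp add: mpovm_def psd_def)
  qed
  moreover have "(\<Sum>k\<in>I. A k i j) = idm N i j" for i j
  proof -
    have "(\<Sum>k\<in>I. C k (g i) (g j)) = idm P (g i) (g j)"
      using m by (simp add: mpovm_def)
    then show ?thesis
      using g N by (simp add: A idm_def inj_eq)
  qed
  ultimately show ?thesis
    using m by (simp add: mpovm_def)
qed

lemma mpovm_kron_rightD: "mpovm (N \<times> M) I (\<lambda>k. kron (A k) (idm M)) \<Longrightarrow> j \<in> M \<Longrightarrow> mpovm N I A"
  by (erule mpovm_restrict[where g = "\<lambda>i. (i, j)"]) (auto simp: inj_def kron_def idm_def)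

lemma mpovm_kron_leftD: "mpovm (N \<times> M) I (\<lambda>k. kron (idm N) (A k)) \<Longrightarrow> j \<in> N \<Longrightarrow> mpovm M I A"
  by (erule mpovm_restrict[where g = "\<lambda>i. (j, i)"]) (auto simp: inj_def kron_def idm_def)

lemma mpovm_cong: "mpovm N I A \<Longrightarrow> (\<And>k. k \<in> I \<Longrightarrow> A k = B k) \<Longrightarrow> mpovm N I B"
  by (simp add: mpovm_def)

lemma q_model_of_realizable:
  assumes "q_realizable TYPE('h) b V2 W1 V1 W2 \<Gamma>"
  shows "\<exists>(N :: nat set) (M :: nat set) x A B. q_model b N M x V2 W1 V1 W2 A B (entry \<Gamma>)"
proof -
  obtain H :: "'h hilbert" and \<xi> E F where
    E: "hfam b H V2 V1 E" and F: "hfam b H W1 W2 F" and model: "commuting_model H \<xi> V2 W1 V1 W2 E F \<Gamma>"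
    and split: "tensor_split H V2 V1 E W1 W2 F"
    using assms(1) unfolding q_realizable_def by blast
  obtain K L :: "'h hilbert" and \<tau> E' F' where
    KL: "hilbert_space K" "finite_dimensional K" "hilbert_space L" "finite_dimensional L"
    and tens: "fd_tensor K L H \<tau>"
    and E': "\<forall>i\<in>V2. \<forall>j\<in>V1. bounded_op K (E' i j) \<and>
           (\<forall>x\<in>carrier K. \<forall>y\<in>carrier L. E i j (\<tau> x y) = \<tau> (E' i j x) y)"
    and F': "\<forall>k\<in>W1. \<forall>l\<in>W2. bounded_op L (F' k l) \<and>
           (\<forall>x\<in>carrier K. \<forall>y\<in>carrier L. F k l (\<tau> x y) = \<tau> x (F' k l y))"
    using split unfolding tensor_split_def by (elim exE conjE) (rule that)
  interpret K: hilbert_space K by fact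
  interpret L: hilbert_space L by fact
  interpret hilbert_space H
    using model by (simp add: commuting_model_def)
  have \<xi>: "\<xi> \<in> carrier H" "hnorm H \<xi> = 1"
    using model by (auto simp: commuting_model_def)
  have \<tau>c: "\<tau> x y \<in> carrier H" if "x \<in> carrier K" "y \<in> carrier L" for x y
    using tens that unfolding fd_tensor_def by blast
  have \<tau>i: "hinner H (\<tau> x y) (\<tau> x' y') = hinner K x x' * hinner L y y'"
    if "x \<in> carrier K" "y \<in> carrier L" "x' \<in> carrier K" "y' \<in> carrier L" for x y x' y'
    using tens that unfolding fd_tensor_def by blast
  have \<tau>span: "\<exists>(n::nat) x y. (\<forall>i<n. x i \<in> carrier K \<and> y i \<in> carrier L) \<and>
      z = (\<Oplus>\<^bsub>H\<^esub>i\<in>{..<n}. \<tau> (x i) (y i))" if "z \<in> carrier H" for z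
    using tens that unfolding fd_tensor_def by (elim conjE) (rule bspec)
  obtain f :: "nat \<Rightarrow> 'h" and n where f: "orthonormal_or_zero K f" "\<And>y. y \<in> carrier K \<Longrightarrow> expands K f {..<n} y"
    using K.finite_dimensional_frame[OF KL(2)] by blast
  obtain g :: "nat \<Rightarrow> 'h" and m where g: "orthonormal_or_zero L g" "\<And>y. y \<in> carrier L \<Longrightarrow> expands L g {..<m} y"
    using L.finite_dimensional_frame[OF KL(4)] by blast
  have fc: "f i \<in> carrier K" and gc: "g j \<in> carrier L" for i j
    using f(1) g(1) by (auto simp: orthonormal_or_zero_def)
  \<comment> \<open>Products of the local frames. A zero vector in either factor gives a zero
    product, so the nonzero ones are indexed by \<open>N \<times> M\<close>.\<close>
  define e where "e p = \<tau> (f (fst p)) (g (snd p))" for p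
  have ec: "e p \<in> carrier H" for p
    using \<tau>c[OF fc gc] by (simp add: e_def)
  have ei: "hinner H (e p) (e q) = hinner K (f (fst p)) (f (fst q)) * hinner L (g (snd p)) (g (snd q))" for p q
    using \<tau>i[OF fc gc fc gc] by (simp add: e_def)
  have onz: "orthonormal_or_zero H e"
    unfolding orthonormal_or_zero_def
  proof (intro conjI allI impI ec)
    fix p q :: "nat \<times> nat" assume "p \<noteq> q"
    then have "fst p \<noteq> fst q \<or> snd p \<noteq> snd q"
      by (auto simp: prod_eq_iff)
    then show "hinner H (e p) (e q) = 0"
      using f(1) g(1) by (auto simp: ei orthonormal_or_zero_def)
  next
    fix p
    have "hinner K (f (fst p)) (f (fst p)) = 1 \<or> hinner K (f (fst p)) (f (fst p)) = 0"
      "hinner L (g (snd p)) (g (snd p)) = 1 \<or> hinner L (g (snd p)) (g (snd p)) = 0"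
      using f(1) g(1) by (auto simp: orthonormal_or_zero_def)
    then have "hinner H (e p) (e p) = 1 \<or> hinner H (e p) (e p) = 0"
      by (auto simp: ei)
    then show "hinner H (e p) (e p) = 1 \<or> e p = \<zero>\<^bsub>H\<^esub>"
      using inner_definite[OF ec] by blast
  qed
  define N where "N = {i. f i \<noteq> \<zero>\<^bsub>K\<^esub>}"
  define M where "M = {j. g j \<noteq> \<zero>\<^bsub>L\<^esub>}"
  have ff: "hinner K (f i') (f i) = idm N i i'" for i i'
    using f(1) by (auto simp: orthonormal_or_zero_def idm_def N_def)
  have gg: "hinner L (g j') (g j) = idm M j j'" for j j'
    using g(1) by (auto simp: orthonormal_or_zero_def idm_def M_def)
  have e_zero: "e p \<noteq> \<zero>\<^bsub>H\<^esub> \<longleftrightarrow> p \<in> N \<times> M" for p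
  proof -
    have "e p = \<zero>\<^bsub>H\<^esub> \<longleftrightarrow> hinner H (e p) (e p) = 0"
      using inner_definite[OF ec[of p]] ec[of p] by (metis inner_zero_left)
    then show ?thesis
      by (cases p) (auto simp: ei ff gg idm_def)
  qed
  have "N \<subseteq> {..<n}"
  proof
    fix i assume "i \<in> N"
    then have "hinner K (f i) (f i) \<noteq> 0"
      by (simp add: ff idm_def)
    then show "i \<in> {..<n}"
      using K.expands_outside[OF f(1) f(2)[OF fc]] by blast
  qed
  have "M \<subseteq> {..<m}"
  proof
    fix j assume "j \<in> M"
    then have "hinner L (g j) (g j) \<noteq> 0"
      by (simp add: gg idm_def)
    then show "j \<in> {..<m}"
      using L.expands_outside[OF g(1) g(2)[OF gc]] by blast
  qed
  have fin: "finite N" "finite M"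
    using \<open>N \<subseteq> {..<n}\<close> \<open>M \<subseteq> {..<m}\<close> finite_subset by blast+
  \<comment> \<open>Both sides of the expansion are additive in the test vector \<open>z\<close>, so
    elementary tensors suffice; for these the expansions in the two factors multiply.\<close>
  have exp_tens: "expands H e ({..<n} \<times> {..<m}) (\<tau> x y)" if xy: "x \<in> carrier K" "y \<in> carrier L" for x y
    unfolding expands_def
  proof
    fix z assume zc: "z \<in> carrier H"
    obtain r :: nat and x' y' where x'y': "\<forall>i<r. x' i \<in> carrier K \<and> y' i \<in> carrier L"
      and z: "z = (\<Oplus>\<^bsub>H\<^esub>i\<in>{..<r}. \<tau> (x' i) (y' i))"
      using \<tau>span[OF zc] by (elim exE conjE) (rule that)
    have c: "\<tau> (x' i) (y' i) \<in> carrier H" if "i < r" for i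
      using that x'y' \<tau>c by blast
    have el: "hinner H (\<tau> x y) (\<tau> (x' l) (y' l)) =
      (\<Sum>p\<in>{..<n} \<times> {..<m}. hinner H (\<tau> x y) (e p) * hinner H (e p) (\<tau> (x' l) (y' l)))" if l: "l < r" for l
    proof -
      have x': "x' l \<in> carrier K" "y' l \<in> carrier L"
        using x'y' l by auto
      have "hinner H (\<tau> x y) (\<tau> (x' l) (y' l)) =
        (\<Sum>i<n. hinner K x (f i) * hinner K (f i) (x' l)) * (\<Sum>j<m. hinner L y (g j) * hinner L (g j) (y' l))"
        using \<tau>i[OF xy x'] K.expandsD[OF f(2)[OF xy(1)] x'(1)] L.expandsD[OF g(2)[OF xy(2)] x'(2)] by simp
      also have "\<dots> = (\<Sum>p\<in>{..<n} \<times> {..<m}. hinner H (\<tau> x y) (e p) * hinner H (e p) (\<tau> (x' l) (y' l)))"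
        using xy x' fc gc by (simp add: e_def \<tau>i sum.cartesian_product' sum_product mult_ac)
      finally show ?thesis .
    qed
    have "hinner H (\<tau> x y) z = (\<Sum>l<r. hinner H (\<tau> x y) (\<tau> (x' l) (y' l)))"
      unfolding z using c \<tau>c[OF xy] by (intro inner_finsum_right) auto
    also have "\<dots> = (\<Sum>l<r. \<Sum>p\<in>{..<n} \<times> {..<m}. hinner H (\<tau> x y) (e p) * hinner H (e p) (\<tau> (x' l) (y' l)))"
      using el by (intro sum.cong) auto
    also have "\<dots> = (\<Sum>p\<in>{..<n} \<times> {..<m}. \<Sum>l<r. hinner H (\<tau> x y) (e p) * hinner H (e p) (\<tau> (x' l) (y' l)))"
      by (rule sum.swap)
    also have "\<dots> = (\<Sum>p\<in>{..<n} \<times> {..<m}. hinner H (\<tau> x y) (e p) * hinner H (e p) z)"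
      unfolding z using c ec
      by (intro sum.cong refl) (subst inner_finsum_right, auto simp: sum_distrib_left)
    finally show "hinner H (\<tau> x y) z = (\<Sum>p\<in>{..<n} \<times> {..<m}. hinner H (\<tau> x y) (e p) * hinner H (e p) z)" .
  qed
  have exp: "expands H e ({..<n} \<times> {..<m}) z" if zc: "z \<in> carrier H" for z
  proof -
    obtain r :: nat and x y where xy: "\<forall>i<r. x i \<in> carrier K \<and> y i \<in> carrier L"
      and z: "z = (\<Oplus>\<^bsub>H\<^esub>i\<in>{..<r}. \<tau> (x i) (y i))"
      using \<tau>span[OF zc] by (elim exE conjE) (rule that)
    show ?thesis
      unfolding z using xy \<tau>c by (intro expands_finsum[OF onz] exp_tens) auto
  qed
  \<comment> \<open>In finite dimension every vector has a finite expansion, so the whole carrier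
    serves as the invariant domain.\<close>
  interpret invariant_frame H e "carrier H"
  proof
    show "\<exists>S. finite S \<and> expands H e S y" if "y \<in> carrier H" for y
      using exp[OF that] by (intro exI[of _ "{..<n} \<times> {..<m}"]) simp
  qed (simp_all add: onz ec)
  have index: "index = N \<times> M"
    using e_zero by blast
  define A where "A v2 v1 = op_matrix K f (E' v2 v1)" for v2 v1
  define B where "B w1 w2 = op_matrix L g (F' w1 w2)" for w1 w2
  have Epos: "positive_op H (E v2 v1)" if "v2 \<in> V2" "v1 \<in> V1" for v2 v1
    using E that by (auto simp: hfam_def povm_def)
  have Fpos: "positive_op H (F w1 w2)" if "w1 \<in> W1" "w2 \<in> W2" for w1 w2
    using F that by (auto simp: hfam_def povm_def)
  have inv: "T ` carrier H \<subseteq> carrier H" if "positive_op H T" for T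
    using that by (auto simp: positive_op_def bounded_op_def)
  have EA: "op_matrix H e (E v2 v1) = kron (A v2 v1) (idm M)" if "v2 \<in> V2" "v1 \<in> V1" for v2 v1
  proof (intro ext)
    fix p q :: "nat \<times> nat"
    have "E' v2 v1 \<in> carrier K \<rightarrow> carrier K"
      using E' that unfolding bounded_op_def by blast
    then have "E' v2 v1 (f (fst q)) \<in> carrier K"
      using fc by (rule Pi_mem)
    then show "op_matrix H e (E v2 v1) p q = kron (A v2 v1) (idm M) p q"
      using E' that fc gc by (simp add: op_matrix_def e_def \<tau>i A_def kron_def gg)
  qed
  have FB: "op_matrix H e (F w1 w2) = kron (idm N) (B w1 w2)" if "w1 \<in> W1" "w2 \<in> W2" for w1 w2
  proof (intro ext)
    fix p q :: "nat \<times> nat"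
    have "F' w1 w2 \<in> carrier L \<rightarrow> carrier L"
      using F' that unfolding bounded_op_def by blast
    then have "F' w1 w2 (g (snd q)) \<in> carrier L"
      using gc by (rule Pi_mem)
    then show "op_matrix H e (F w1 w2) p q = kron (idm N) (B w1 w2) p q"
      using F' that fc gc by (simp add: op_matrix_def e_def \<tau>i B_def kron_def ff)
  qed
  have S: "expands H e (N \<times> M) \<xi>"
  proof -
    have "{p \<in> {..<n} \<times> {..<m}. e p \<noteq> \<zero>\<^bsub>H\<^esub>} = N \<times> M"
      using e_zero \<open>N \<subseteq> {..<n}\<close> \<open>M \<subseteq> {..<m}\<close> by blast
    then show ?thesis
      using expands_nonzero[OF onz exp[OF \<xi>(1)]] by simp
  qed
  have unit: "(\<Sum>p\<in>N \<times> M. (cmod (hinner H \<xi> (e p)))\<^sup>2) = 1"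
    by (rule sum_coefficients[OF S \<xi>])
  \<comment> \<open>A unit vector forces nonempty index sets; the slices through \<open>j0\<close>
    and \<open>i0\<close> then give the local families \<open>A\<close> and
    \<open>B\<close>.\<close>
  then have "N \<times> M \<noteq> {}"
    by auto
  then obtain i0 j0 where i0: "i0 \<in> N" and j0: "j0 \<in> M"
    by blast
  have "mfam b (N \<times> M) V2 V1 (\<lambda>v2 v1. op_matrix H e (E v2 v1))"
    using mfam_op_matrix[OF E inv[OF Epos]] by (simp add: index)
  then have famA: "mfam b N V2 V1 A"
    unfolding mfam_def
    by (intro conjI ballI impI; elim conjE) (rule mpovm_kron_rightD[OF mpovm_cong j0], blast, blast intro: EA)+
  have "mfam b (N \<times> M) W1 W2 (\<lambda>w1 w2. op_matrix H e (F w1 w2))"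
    using mfam_op_matrix[OF F inv[OF Fpos]] by (simp add: index)
  then have famB: "mfam b M W1 W2 B"
    unfolding mfam_def
    by (intro conjI ballI impI; elim conjE) (rule mpovm_kron_leftD[OF mpovm_cong i0], blast, blast intro: FB)+
  have "q_model b N M (\<lambda>p. hinner H \<xi> (e p)) V2 W1 V1 W2 A B (entry \<Gamma>)"
    unfolding q_model_def
  proof (intro conjI ballI allI impI famA famB fin unit)
    show "hinner H \<xi> (e p) = 0" if "p \<notin> N \<times> M" for p
      using expands_outside[OF onz S that] .
    fix v2 v1 w1 w2 assume *: "v2 \<in> V2" "v1 \<in> V1" "w1 \<in> W1" "w2 \<in> W2"
    have rcf: "rcf N (A v2 v1)" "rcf M (B w1 w2)"
      using famA famB * by (auto simp: mfam_def mpovm_def)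
    note EF = Epos[OF *(1,2)] inv[OF Epos[OF *(1,2)]] Fpos[OF *(3,4)] inv[OF Fpos[OF *(3,4)]]
    have "entry \<Gamma> (v1, w2) (v2, w1) = hinner H (E v2 v1 (F w1 w2 \<xi>)) \<xi>"
      using model * by (auto simp: commuting_model_def)
    also have "\<dots> = qform (N \<times> M) (mmul (kron (A v2 v1) (idm M)) (kron (idm N) (B w1 w2))) (\<lambda>p. hinner H \<xi> (e p))"
      using inner_op_op[OF EF S \<xi>(1)] EA FB * by simp
    also have "mmul (kron (A v2 v1) (idm M)) (kron (idm N) (B w1 w2)) = kron (A v2 v1) (B w1 w2)"
      using rcf by (simp add: mmul_kron[of N _ M] mmul_idm_left mmul_idm_right)
    finally show "entry \<Gamma> (v1, w2) (v2, w1) = qform (N \<times> M) (kron (A v2 v1) (B w1 w2)) (\<lambda>p. hinner H \<xi> (e p))" .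
  qed
  then show ?thesis by blast
qed

section \<open>No-signalling correlations and their entries\<close>

text \<open>The value 0 off \<open>Y\<close> puts the image into \<open>diag Y\<close>; on finite
  sets the prescribed entries are recovered by \<open>entry_mk_map\<close>.\<close>

definition mk_map :: "'x set \<Rightarrow> 'y set \<Rightarrow> ('y \<Rightarrow> 'x \<Rightarrow> complex) \<Rightarrow> ('x \<Rightarrow> complex) \<Rightarrow> 'y \<Rightarrow> complex" where
  "mk_map X Y p a y = (if y \<in> Y then \<Sum>x\<in>X. p y x * a x else 0)"

definition stochastic :: "'x set \<Rightarrow> 'y set \<Rightarrow> ('y \<Rightarrow> 'x \<Rightarrow> complex) \<Rightarrow> bool" where
  "stochastic X Y p \<longleftrightarrow> (\<forall>x\<in>X. (\<forall>y\<in>Y. p y x \<in> \<real>\<^sub>\<ge>\<^sub>0) \<and> (\<Sum>y\<in>Y. p y x) = 1)"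

definition no_signalling ::
  "'v set \<Rightarrow> 'w set \<Rightarrow> 'v set \<Rightarrow> 'w set \<Rightarrow> ('v, 'w) entries \<Rightarrow> bool" where
  "no_signalling V2 W1 V1 W2 p \<longleftrightarrow> stochastic (V2 \<times> W1) (V1 \<times> W2) p \<and>
     (\<forall>v2\<in>V2. \<forall>v1\<in>V1. \<forall>w1\<in>W1. \<forall>w1'\<in>W1. (\<Sum>w2\<in>W2. p (v1, w2) (v2, w1)) = (\<Sum>w2\<in>W2. p (v1, w2) (v2, w1'))) \<and>
     (\<forall>w1\<in>W1. \<forall>w2\<in>W2. \<forall>v2\<in>V2. \<forall>v2'\<in>V2. (\<Sum>v1\<in>V1. p (v1, w2) (v2, w1)) = (\<Sum>v1\<in>V1. p (v1, w2) (v2', w1)))"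

lemma diag_unit_in_diag: "x \<in> X \<Longrightarrow> diag_unit x \<in> diag X"
  by (auto simp: diag_def diag_unit_def)

lemma channel_mk_map:
  fixes p :: "'y \<Rightarrow> 'x \<Rightarrow> complex"
  assumes "finite X" "finite Y" "stochastic X Y p"
  shows "channel X Y (mk_map X Y p)"
  unfolding channel_def
proof (intro conjI ballI allI impI)
  fix a :: "'x \<Rightarrow> complex" and y assume "\<forall>x\<in>X. a x \<in> \<real>\<^sub>\<ge>\<^sub>0" "y \<in> Y"
  then show "mk_map X Y p a y \<in> \<real>\<^sub>\<ge>\<^sub>0"
    using assms(3) by (auto simp: mk_map_def stochastic_def intro!: nonneg_Reals_sum nonneg_Reals_mult_I)
next
  fix a :: "'x \<Rightarrow> complex"
  have "(\<Sum>y\<in>Y. mk_map X Y p a y) = (\<Sum>y\<in>Y. \<Sum>x\<in>X. p y x * a x)"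
    by (simp add: mk_map_def)
  also have "\<dots> = (\<Sum>x\<in>X. \<Sum>y\<in>Y. p y x * a x)"
    by (rule sum.swap)
  also have "\<dots> = (\<Sum>x\<in>X. a x)"
    using assms(3) by (simp add: stochastic_def flip: sum_distrib_right)
  finally show "(\<Sum>y\<in>Y. mk_map X Y p a y) = (\<Sum>x\<in>X. a x)" .
qed (auto simp: diag_def mk_map_def fun_eq_iff sum.distrib sum_distrib_left algebra_simps)

lemma entry_mk_map: "finite X \<Longrightarrow> x \<in> X \<Longrightarrow> y \<in> Y \<Longrightarrow> entry (mk_map X Y p) y x = p y x"
  by (simp add: entry_def mk_map_def diag_unit_def if_distrib[of "\<lambda>t. _ * t"] cong: if_cong)

lemma channel_stochastic:
  assumes "finite X" "channel X Y \<Phi>"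
  shows "stochastic X Y (entry \<Phi>)"
  unfolding stochastic_def
proof (intro ballI conjI)
  fix x assume x: "x \<in> X"
  then have d: "diag_unit x \<in> diag X"
    by (rule diag_unit_in_diag)
  show "entry \<Phi> y x \<in> \<real>\<^sub>\<ge>\<^sub>0" if "y \<in> Y" for y
  proof -
    have "\<forall>x'\<in>X. diag_unit x x' \<in> \<real>\<^sub>\<ge>\<^sub>0"
      by (simp add: diag_unit_def)
    with assms(2) d that show ?thesis
      unfolding channel_def entry_def by blast
  qed
  have "(\<Sum>y\<in>Y. entry \<Phi> y x) = (\<Sum>x'\<in>X. diag_unit x x')"
    using assms(2) d unfolding channel_def entry_def by blast
  then show "(\<Sum>y\<in>Y. entry \<Phi> y x) = 1"
    using x assms(1) by (simp add: diag_unit_def)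
qed

lemma ns_corr_iff:
  assumes "finite V2" "finite W1"
  shows "\<Gamma> \<in> ns_corr V2 W1 V1 W2 \<longleftrightarrow>
    channel (V2 \<times> W1) (V1 \<times> W2) \<Gamma> \<and> no_signalling V2 W1 V1 W2 (entry \<Gamma>)"
proof -
  have "channel (V2 \<times> W1) (V1 \<times> W2) \<Gamma> \<Longrightarrow> stochastic (V2 \<times> W1) (V1 \<times> W2) (entry \<Gamma>)"
    using assms by (intro channel_stochastic) auto
  then show ?thesis
    unfolding ns_corr_def no_signalling_def mem_Collect_eq by argo
qed

text \<open>\<open>mk_map\<close> reproduces its table only on the index sets, so properties of
  tables have to be transferred along agreement there.\<close>

lemma no_signalling_cong:
  assumes p: "no_signalling V2 W1 V1 W2 p"
    and q: "\<And>v2 w1 v1 w2. v2 \<in> V2 \<Longrightarrow> w1 \<in> W1 \<Longrightarrow> v1 \<in> V1 \<Longrightarrow> w2 \<in> W2 \<Longrightarrow> q (v1, w2) (v2, w1) = p (v1, w2) (v2, w1)"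
  shows "no_signalling V2 W1 V1 W2 q"
  unfolding no_signalling_def
proof (intro conjI ballI)
  have "(\<Sum>y\<in>V1 \<times> W2. q y x) = (\<Sum>y\<in>V1 \<times> W2. p y x)" if "x \<in> V2 \<times> W1" for x
    using that q by (intro sum.cong) auto
  then show "stochastic (V2 \<times> W1) (V1 \<times> W2) q"
    using p q unfolding no_signalling_def stochastic_def by auto
next
  fix v2 v1 w1 w1' assume *: "v2 \<in> V2" "v1 \<in> V1" "w1 \<in> W1" "w1' \<in> W1"
  have "(\<Sum>w2\<in>W2. q (v1, w2) (v2, w)) = (\<Sum>w2\<in>W2. p (v1, w2) (v2, w))" if "w \<in> W1" for w
    using that * q by (intro sum.cong) auto
  with p * show "(\<Sum>w2\<in>W2. q (v1, w2) (v2, w1)) = (\<Sum>w2\<in>W2. q (v1, w2) (v2, w1'))"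
    unfolding no_signalling_def by metis
next
  fix w1 w2 v2 v2' assume *: "w1 \<in> W1" "w2 \<in> W2" "v2 \<in> V2" "v2' \<in> V2"
  have "(\<Sum>v1\<in>V1. q (v1, w2) (v, w1)) = (\<Sum>v1\<in>V1. p (v1, w2) (v, w1))" if "v \<in> V2" for v
    using that * q by (intro sum.cong) auto
  with p * show "(\<Sum>v1\<in>V1. q (v1, w2) (v2, w1)) = (\<Sum>v1\<in>V1. q (v1, w2) (v2', w1))"
    unfolding no_signalling_def by metis
qed

lemma ns_corr_mk_map:
  assumes fin: "finite V2" "finite W1" "finite V1" "finite W2"
    and p: "no_signalling V2 W1 V1 W2 p"
  shows "mk_map (V2 \<times> W1) (V1 \<times> W2) p \<in> ns_corr V2 W1 V1 W2"
  unfolding ns_corr_iff[OF fin(1,2)]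
proof
  show "channel (V2 \<times> W1) (V1 \<times> W2) (mk_map (V2 \<times> W1) (V1 \<times> W2) p)"
    using fin p by (intro channel_mk_map) (auto simp: no_signalling_def)
  show "no_signalling V2 W1 V1 W2 (entry (mk_map (V2 \<times> W1) (V1 \<times> W2) p))"
    using fin by (intro no_signalling_cong[OF p]) (simp add: entry_mk_map)
qed

lemma ns_corr_no_signalling:
  "finite V2 \<Longrightarrow> finite W1 \<Longrightarrow> \<Gamma> \<in> ns_corr V2 W1 V1 W2 \<Longrightarrow> no_signalling V2 W1 V1 W2 (entry \<Gamma>)"
  by (simp add: ns_corr_iff)

text \<open>By no-signalling the marginal \<open>\<alpha>\<close> of \<open>p2\<close> does not
  depend on \<open>w2\<close>, and the marginal \<open>\<beta>\<close> of \<open>p1\<close> does not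
  depend on \<open>v2\<close>. Summing out \<open>w3\<close> and \<open>v1\<close> therefore cuts
  the loop, and the total mass factors into the sum of \<open>\<alpha>\<close> times the sum of
  \<open>\<beta>\<close>, each equal to 1.\<close>

lemma no_signalling_compose:
  assumes p1: "no_signalling V2 W1 V1 W2 p1" and p2: "no_signalling V3 W2 V2 W3 p2"
    and nonvoid: "V2 = {} \<Longrightarrow> W2 = {} \<Longrightarrow> V3 \<times> W1 = {}"
  shows "no_signalling V3 W1 V1 W3 (compose_entries V2 W2 p2 p1)"
proof -
  let ?q = "compose_entries V2 W2 p2 p1"
  \<comment> \<open>Reference points at which the marginals are evaluated. For an empty set the
    choice is arbitrary, but \<open>\<alpha>\<close> and \<open>\<beta>\<close> are related to the
    marginals only when elements exist.\<close>
  define w\<^sub>0 where "w\<^sub>0 = (SOME w. w \<in> W2)"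
  define v\<^sub>0 where "v\<^sub>0 = (SOME v. v \<in> V2)"
  define \<alpha> where "\<alpha> v3 v2 = (\<Sum>w3\<in>W3. p2 (v2, w3) (v3, w\<^sub>0))" for v3 v2
  define \<beta> where "\<beta> w1 w2 = (\<Sum>v1\<in>V1. p1 (v1, w2) (v\<^sub>0, w1))" for w1 w2
  have \<alpha>: "(\<Sum>w3\<in>W3. p2 (v2, w3) (v3, w2)) = \<alpha> v3 v2" if "v3 \<in> V3" "v2 \<in> V2" "w2 \<in> W2" for v3 v2 w2
    using p2 that someI[of "\<lambda>w. w \<in> W2" w2] unfolding \<alpha>_def w\<^sub>0_def no_signalling_def by blast
  have \<beta>: "(\<Sum>v1\<in>V1. p1 (v1, w2) (v2, w1)) = \<beta> w1 w2" if "w1 \<in> W1" "v2 \<in> V2" "w2 \<in> W2" for w1 v2 w2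
    using p1 that someI[of "\<lambda>v. v \<in> V2" v2] unfolding \<beta>_def v\<^sub>0_def no_signalling_def by blast
  have sum_w3: "(\<Sum>w3\<in>W3. ?q (v1, w3) (v3, w1)) = (\<Sum>v2\<in>V2. \<Sum>w2\<in>W2. \<alpha> v3 v2 * p1 (v1, w2) (v2, w1))"
    if "v3 \<in> V3" for v1 v3 w1
  proof -
    have "(\<Sum>w3\<in>W3. ?q (v1, w3) (v3, w1)) =
      (\<Sum>v2\<in>V2. \<Sum>w3\<in>W3. \<Sum>w2\<in>W2. p2 (v2, w3) (v3, w2) * p1 (v1, w2) (v2, w1))"
      unfolding compose_entries_def fst_conv snd_conv by (rule sum.swap)
    also have "\<dots> = (\<Sum>v2\<in>V2. \<Sum>w2\<in>W2. \<Sum>w3\<in>W3. p2 (v2, w3) (v3, w2) * p1 (v1, w2) (v2, w1))"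
      by (intro sum.cong refl sum.swap)
    also have "\<dots> = (\<Sum>v2\<in>V2. \<Sum>w2\<in>W2. \<alpha> v3 v2 * p1 (v1, w2) (v2, w1))"
      using that by (intro sum.cong refl) (simp add: \<alpha> flip: sum_distrib_right)
    finally show ?thesis .
  qed
  have sum_v1: "(\<Sum>v1\<in>V1. ?q (v1, w3) (v3, w1)) = (\<Sum>v2\<in>V2. \<Sum>w2\<in>W2. p2 (v2, w3) (v3, w2) * \<beta> w1 w2)"
    if "w1 \<in> W1" for w3 v3 w1
  proof -
    have "(\<Sum>v1\<in>V1. ?q (v1, w3) (v3, w1)) =
      (\<Sum>v2\<in>V2. \<Sum>v1\<in>V1. \<Sum>w2\<in>W2. p2 (v2, w3) (v3, w2) * p1 (v1, w2) (v2, w1))"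
      unfolding compose_entries_def fst_conv snd_conv by (rule sum.swap)
    also have "\<dots> = (\<Sum>v2\<in>V2. \<Sum>w2\<in>W2. \<Sum>v1\<in>V1. p2 (v2, w3) (v3, w2) * p1 (v1, w2) (v2, w1))"
      by (intro sum.cong refl sum.swap)
    also have "\<dots> = (\<Sum>v2\<in>V2. \<Sum>w2\<in>W2. p2 (v2, w3) (v3, w2) * \<beta> w1 w2)"
      using that by (intro sum.cong refl) (simp add: \<beta> flip: sum_distrib_left)
    finally show ?thesis .
  qed
  have st1: "(\<Sum>v1\<in>V1. \<Sum>w2\<in>W2. p1 (v1, w2) (v2, w1)) = 1" if "v2 \<in> V2" "w1 \<in> W1" for v2 w1
    using p1 that unfolding no_signalling_def stochastic_def sum.cartesian_product' by blast
  have st2: "(\<Sum>v2\<in>V2. \<Sum>w3\<in>W3. p2 (v2, w3) (v3, w2)) = 1" if "v3 \<in> V3" "w2 \<in> W2" for v3 w2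
    using p2 that unfolding no_signalling_def stochastic_def sum.cartesian_product' by blast
  have stoch: "stochastic (V3 \<times> W1) (V1 \<times> W3) ?q"
    unfolding stochastic_def
  proof (intro ballI conjI)
    fix x y assume "x \<in> V3 \<times> W1" "y \<in> V1 \<times> W3"
    then show "?q y x \<in> \<real>\<^sub>\<ge>\<^sub>0"
      using p1 p2 unfolding compose_entries_def no_signalling_def stochastic_def
      by (intro nonneg_Reals_sum nonneg_Reals_mult_I) auto
  next
    fix x assume "x \<in> V3 \<times> W1"
    then obtain v3 w1 where x: "x = (v3, w1)" "v3 \<in> V3" "w1 \<in> W1"
      by blast
    \<comment> \<open>If one of the two sets were empty, an empty sum would equal 1 unless the other
      is empty too; the case of both being empty is excluded by hypothesis.\<close>
    have "V2 \<noteq> {}" "W2 \<noteq> {}"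
    proof -
      have "W2 = {}" if "V2 = {}"
        using st2[OF x(2)] that by auto
      moreover have "V2 = {}" if "W2 = {}"
        using st1[OF _ x(3)] that by auto
      moreover have "V3 \<times> W1 \<noteq> {}"
        using x by blast
      ultimately show "V2 \<noteq> {}" "W2 \<noteq> {}"
        using nonvoid by blast+
    qed
    then obtain v w where vw: "v \<in> V2" "w \<in> W2"
      by blast
    have \<alpha>1: "(\<Sum>v2\<in>V2. \<alpha> v3 v2) = 1"
      using st2[OF x(2) vw(2)] \<alpha>[OF x(2) _ vw(2)] by simp
    have \<beta>1: "(\<Sum>w2\<in>W2. \<beta> w1 w2) = 1"
      using st1[OF vw(1) x(3)] \<beta>[OF x(3) vw(1)] by (subst (asm) sum.swap) simp
    have "(\<Sum>y\<in>V1 \<times> W3. ?q y x) = (\<Sum>w3\<in>W3. \<Sum>v1\<in>V1. ?q (v1, w3) (v3, w1))"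
      unfolding x(1) sum.cartesian_product' by (rule sum.swap)
    also have "\<dots> = (\<Sum>w3\<in>W3. \<Sum>v2\<in>V2. \<Sum>w2\<in>W2. p2 (v2, w3) (v3, w2) * \<beta> w1 w2)"
      using sum_v1[OF x(3)] by simp
    also have "\<dots> = (\<Sum>v2\<in>V2. \<Sum>w3\<in>W3. \<Sum>w2\<in>W2. p2 (v2, w3) (v3, w2) * \<beta> w1 w2)"
      by (rule sum.swap)
    also have "\<dots> = (\<Sum>v2\<in>V2. \<Sum>w2\<in>W2. \<Sum>w3\<in>W3. p2 (v2, w3) (v3, w2) * \<beta> w1 w2)"
      by (intro sum.cong refl sum.swap)
    also have "\<dots> = (\<Sum>v2\<in>V2. \<Sum>w2\<in>W2. \<alpha> v3 v2 * \<beta> w1 w2)"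
      using x by (intro sum.cong refl) (simp add: \<alpha> flip: sum_distrib_right)
    also have "\<dots> = (\<Sum>v2\<in>V2. \<alpha> v3 v2) * (\<Sum>w2\<in>W2. \<beta> w1 w2)"
      by (simp add: sum_product)
    finally show "(\<Sum>y\<in>V1 \<times> W3. ?q y x) = 1"
      by (simp add: \<alpha>1 \<beta>1)
  qed
  \<comment> \<open>With \<open>w3\<close> summed out, \<open>\<alpha> v3 v2\<close> does not
    involve \<open>w2\<close>; for each \<open>v2\<close> the sum over \<open>w2\<close> is then a
    marginal of \<open>p1\<close>, which ignores \<open>w1\<close>. The other condition is the
    mirror image, with \<open>\<beta>\<close>.\<close>
  have "(\<Sum>w3\<in>W3. ?q (v1, w3) (v3, w1)) = (\<Sum>w3\<in>W3. ?q (v1, w3) (v3, w1'))"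
    if "v3 \<in> V3" "v1 \<in> V1" "w1 \<in> W1" "w1' \<in> W1" for v3 v1 w1 w1'
  proof -
    have "(\<Sum>w2\<in>W2. \<alpha> v3 v2 * p1 (v1, w2) (v2, w1)) = (\<Sum>w2\<in>W2. \<alpha> v3 v2 * p1 (v1, w2) (v2, w1'))"
      if "v2 \<in> V2" for v2
    proof -
      have "(\<Sum>w2\<in>W2. p1 (v1, w2) (v2, w1)) = (\<Sum>w2\<in>W2. p1 (v1, w2) (v2, w1'))"
        using p1 that \<open>v1 \<in> V1\<close> \<open>w1 \<in> W1\<close> \<open>w1' \<in> W1\<close> unfolding no_signalling_def by blast
      then show ?thesis
        by (simp flip: sum_distrib_left)
    qed
    then show ?thesis
      unfolding sum_w3[OF that(1)] by (rule sum.cong[OF refl])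
  qed
  moreover have "(\<Sum>v1\<in>V1. ?q (v1, w3) (v3, w1)) = (\<Sum>v1\<in>V1. ?q (v1, w3) (v3', w1))"
    if "w1 \<in> W1" "w3 \<in> W3" "v3 \<in> V3" "v3' \<in> V3" for w1 w3 v3 v3'
  proof -
    have "(\<Sum>v2\<in>V2. p2 (v2, w3) (v3, w2) * \<beta> w1 w2) = (\<Sum>v2\<in>V2. p2 (v2, w3) (v3', w2) * \<beta> w1 w2)"
      if "w2 \<in> W2" for w2
    proof -
      have "(\<Sum>v2\<in>V2. p2 (v2, w3) (v3, w2)) = (\<Sum>v2\<in>V2. p2 (v2, w3) (v3', w2))"
        using p2 that \<open>w3 \<in> W3\<close> \<open>v3 \<in> V3\<close> \<open>v3' \<in> V3\<close> unfolding no_signalling_def by blast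
      then show ?thesis
        by (simp flip: sum_distrib_right)
    qed
    then have "(\<Sum>w2\<in>W2. \<Sum>v2\<in>V2. p2 (v2, w3) (v3, w2) * \<beta> w1 w2) =
        (\<Sum>w2\<in>W2. \<Sum>v2\<in>V2. p2 (v2, w3) (v3', w2) * \<beta> w1 w2)"
      by (rule sum.cong[OF refl])
    then show ?thesis
      unfolding sum_v1[OF that(1)] by (subst (1 2) sum.swap)
  qed
  ultimately show ?thesis
    using stoch unfolding no_signalling_def by blast
qed

definition dual_entries :: "('y \<Rightarrow> 'x \<Rightarrow> complex) \<Rightarrow> 'x \<Rightarrow> 'y \<Rightarrow> complex" where
  "dual_entries p x y = p y x"

lemma ns_bicorrD:
  assumes "finite V" "finite W" "\<Gamma> \<in> ns_bicorr V W"
  shows "no_signalling V W V W (entry \<Gamma>)" "no_signalling V W V W (dual_entries (entry \<Gamma>))"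
proof -
  show "no_signalling V W V W (entry \<Gamma>)"
    using assms ns_corr_no_signalling by (auto simp: ns_bicorr_def)
  have "dual_map (V \<times> W) (V \<times> W) \<Gamma> = mk_map (V \<times> W) (V \<times> W) (dual_entries (entry \<Gamma>))"
    by (simp add: fun_eq_iff dual_map_def mk_map_def dual_entries_def)
  then have "mk_map (V \<times> W) (V \<times> W) (dual_entries (entry \<Gamma>)) \<in> ns_corr V W V W"
    using assms by (simp add: ns_bicorr_def)
  from ns_corr_no_signalling[OF assms(1,2) this] show "no_signalling V W V W (dual_entries (entry \<Gamma>))"
    by (rule no_signalling_cong) (use assms in \<open>simp add: entry_mk_map\<close>)
qed

text \<open>Unitality is the normalisation of the transposed table: the sum of \<open>p y x\<close>
  over \<open>x\<close> is 1.\<close>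

lemma ns_bicorr_mk_map:
  assumes fin: "finite V" "finite W"
    and p: "no_signalling V W V W p" "no_signalling V W V W (dual_entries p)"
  shows "mk_map (V \<times> W) (V \<times> W) p \<in> ns_bicorr V W"
proof -
  have "mk_map (V \<times> W) (V \<times> W) p (diag_one (V \<times> W)) = diag_one (V \<times> W)"
  proof
    fix y
    have "(\<Sum>x\<in>V \<times> W. p y x) = 1" if "y \<in> V \<times> W"
      using p(2) that unfolding no_signalling_def stochastic_def dual_entries_def by blast
    then show "mk_map (V \<times> W) (V \<times> W) p (diag_one (V \<times> W)) y = diag_one (V \<times> W) y"
      by (simp add: mk_map_def diag_one_def)
  qed
  moreover have "dual_map (V \<times> W) (V \<times> W) (mk_map (V \<times> W) (V \<times> W) p) = mk_map (V \<times> W) (V \<times> W) (dual_entries p)"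
    using fin by (auto simp: fun_eq_iff dual_map_def mk_map_def[of _ _ "dual_entries p"] dual_entries_def entry_mk_map intro!: sum.cong)
  ultimately show ?thesis
    using ns_corr_mk_map[OF fin fin] p by (simp add: ns_bicorr_def)
qed

section \<open>Composition, duals and identities\<close>

text \<open>The set \<open>I\<close> of hidden values is arbitrary so that composition can use
  pairs; \<open>loc_realizableI\<close> renumbers a finite \<open>I\<close>. The flag adds
  stochasticity of the transposes, that is, bistochastic kernels.\<close>

definition loc_model ::
  "bool \<Rightarrow> 'k set \<Rightarrow> ('k \<Rightarrow> real) \<Rightarrow> ('k \<Rightarrow> 'v cmat) \<Rightarrow> ('k \<Rightarrow> 'w cmat) \<Rightarrow>
   'v set \<Rightarrow> 'w set \<Rightarrow> 'v set \<Rightarrow> 'w set \<Rightarrow> ('v, 'w) entries \<Rightarrow> bool" where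
  "loc_model b I l P Q V2 W1 V1 W2 p \<longleftrightarrow>
     (\<forall>i\<in>I. l i \<ge> 0) \<and> sum l I = 1 \<and>
     (\<forall>i\<in>I. stochastic V2 V1 (P i) \<and> stochastic W1 W2 (Q i) \<and>
        (b \<longrightarrow> stochastic V1 V2 (dual_entries (P i)) \<and> stochastic W2 W1 (dual_entries (Q i)))) \<and>
     (\<forall>v2\<in>V2. \<forall>w1\<in>W1. \<forall>v1\<in>V1. \<forall>w2\<in>W2.
        p (v1, w2) (v2, w1) = (\<Sum>i\<in>I. complex_of_real (l i) * (P i v1 v2 * Q i w2 w1)))"

definition loc_realizable ::
  "bool \<Rightarrow> 'v set \<Rightarrow> 'w set \<Rightarrow> 'v set \<Rightarrow> 'w set \<Rightarrow> ('v, 'w) entries \<Rightarrow> bool" where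
  "loc_realizable b V2 W1 V1 W2 p \<longleftrightarrow> (\<exists>(n::nat) l P Q. loc_model b {..<n} l P Q V2 W1 V1 W2 p)"

lemma loc_realizableI:
  fixes I :: "'k set"
  assumes I: "finite I" and m: "loc_model b I l P Q V2 W1 V1 W2 p"
  shows "loc_realizable b V2 W1 V1 W2 p"
proof -
  obtain h where h: "bij_betw h {..<card I} I"
    using ex_bij_betw_nat_finite[OF I] by (auto simp: atLeast0LessThan)
  have "h i \<in> I" if "i < card I" for i
    using bij_betwE[OF h] that by auto
  then have "loc_model b {..<card I} (l \<circ> h) (P \<circ> h) (Q \<circ> h) V2 W1 V1 W2 p"
    using m sum.reindex_bij_betw[OF h, of l]
      sum.reindex_bij_betw[OF h, of "\<lambda>i. complex_of_real (l i) * (P i v1 v2 * Q i w2 w1)" for v1 v2 w1 w2]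
    by (simp add: loc_model_def)
  then show ?thesis
    unfolding loc_realizable_def by blast
qed

definition compose_kernel :: "'y set \<Rightarrow> ('z \<Rightarrow> 'y \<Rightarrow> complex) \<Rightarrow> ('y \<Rightarrow> 'x \<Rightarrow> complex) \<Rightarrow> 'z \<Rightarrow> 'x \<Rightarrow> complex" where
  "compose_kernel Y q p z x = (\<Sum>y\<in>Y. q z y * p y x)"

lemma stochastic_compose:
  assumes p: "stochastic X Y p" and q: "stochastic Y Z q"
  shows "stochastic X Z (compose_kernel Y q p)"
  unfolding stochastic_def
proof (intro ballI conjI)
  fix x assume x: "x \<in> X"
  show "compose_kernel Y q p z x \<in> \<real>\<^sub>\<ge>\<^sub>0" if "z \<in> Z" for z
    using p q x that unfolding compose_kernel_def stochastic_def
    by (intro nonneg_Reals_sum nonneg_Reals_mult_I) auto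
  have "(\<Sum>z\<in>Z. compose_kernel Y q p z x) = (\<Sum>y\<in>Y. \<Sum>z\<in>Z. q z y * p y x)"
    unfolding compose_kernel_def by (rule sum.swap)
  also have "\<dots> = (\<Sum>y\<in>Y. p y x)"
    using q by (simp add: stochastic_def flip: sum_distrib_right)
  finally show "(\<Sum>z\<in>Z. compose_kernel Y q p z x) = 1"
    using p x by (simp add: stochastic_def)
qed

lemma dual_compose_kernel: "dual_entries (compose_kernel Y q p) = compose_kernel Y (dual_entries p) (dual_entries q)"
  by (simp add: fun_eq_iff dual_entries_def compose_kernel_def mult.commute)

text \<open>Hidden values are drawn independently, so weights multiply. The kernels compose in
  opposite orders: on the \<open>V\<close> side the second model acts first, on the \<open>W\<close>
  side the first.\<close>

lemma loc_realizable_compose: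
  assumes m1: "loc_realizable b V2 W1 V1 W2 p1" and m2: "loc_realizable b V3 W2 V2 W3 p2"
  shows "loc_realizable b V3 W1 V1 W3 (compose_entries V2 W2 p2 p1)"
proof -
  obtain n :: nat and l P Q where m1: "loc_model b {..<n} l P Q V2 W1 V1 W2 p1"
    using m1 unfolding loc_realizable_def by blast
  obtain n' :: nat and l' P' Q' where m2: "loc_model b {..<n'} l' P' Q' V3 W2 V2 W3 p2"
    using m2 unfolding loc_realizable_def by blast
  let ?l = "\<lambda>k. l' (fst k) * l (snd k)"
  let ?P = "\<lambda>k. compose_kernel V2 (P (snd k)) (P' (fst k))"
  let ?Q = "\<lambda>k. compose_kernel W2 (Q' (fst k)) (Q (snd k))"
  have "loc_model b ({..<n'} \<times> {..<n}) ?l ?P ?Q V3 W1 V1 W3 (compose_entries V2 W2 p2 p1)"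
    unfolding loc_model_def
  proof (intro conjI ballI impI)
    fix k assume "k \<in> {..<n'} \<times> {..<n}"
    then have k: "fst k \<in> {..<n'}" "snd k \<in> {..<n}"
      by auto
    show "0 \<le> ?l k"
      using m1 m2 k unfolding loc_model_def by simp
    show "stochastic V3 V1 (?P k)" "stochastic W1 W3 (?Q k)"
      using m1 m2 k unfolding loc_model_def by (auto intro!: stochastic_compose)
    assume b
    then show "stochastic V1 V3 (dual_entries (?P k))" "stochastic W3 W1 (dual_entries (?Q k))"
      using m1 m2 k unfolding loc_model_def dual_compose_kernel by (auto intro!: stochastic_compose)
  next
    have "(\<Sum>k\<in>{..<n'} \<times> {..<n}. ?l k) = (\<Sum>i<n'. l' i) * (\<Sum>j<n. l j)"
      by (simp add: sum.cartesian_product' sum_product)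
    then show "(\<Sum>k\<in>{..<n'} \<times> {..<n}. ?l k) = 1"
      using m1 m2 by (simp add: loc_model_def)
  next
    fix v3 w1 v1 w3 assume *: "v3 \<in> V3" "w1 \<in> W1" "v1 \<in> V1" "w3 \<in> W3"
    let ?t = "\<lambda>k v2 w2. (complex_of_real (l' (fst k)) * (P' (fst k) v2 v3 * Q' (fst k) w3 w2)) *
        (complex_of_real (l (snd k)) * (P (snd k) v1 v2 * Q (snd k) w2 w1))"
    have "compose_entries V2 W2 p2 p1 (v1, w3) (v3, w1) =
      (\<Sum>v2\<in>V2. \<Sum>w2\<in>W2. (\<Sum>i<n'. complex_of_real (l' i) * (P' i v2 v3 * Q' i w3 w2)) *
        (\<Sum>j<n. complex_of_real (l j) * (P j v1 v2 * Q j w2 w1)))"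
      unfolding compose_entries_def fst_conv snd_conv using m1 m2 *
      by (intro sum.cong refl) (simp add: loc_model_def)
    also have "\<dots> = (\<Sum>v2\<in>V2. \<Sum>w2\<in>W2. \<Sum>k\<in>{..<n'} \<times> {..<n}. ?t k v2 w2)"
      by (simp add: sum_product sum.cartesian_product')
    also have "\<dots> = (\<Sum>v2\<in>V2. \<Sum>k\<in>{..<n'} \<times> {..<n}. \<Sum>w2\<in>W2. ?t k v2 w2)"
      by (intro sum.cong refl sum.swap)
    also have "\<dots> = (\<Sum>k\<in>{..<n'} \<times> {..<n}. \<Sum>v2\<in>V2. \<Sum>w2\<in>W2. ?t k v2 w2)"
      by (rule sum.swap)
    also have "\<dots> = (\<Sum>k\<in>{..<n'} \<times> {..<n}. complex_of_real (?l k) * (?P k v1 v3 * ?Q k w3 w1))"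
      unfolding compose_kernel_def sum_product
      by (intro sum.cong refl) (simp add: sum_distrib_left mult_ac)
    finally show "compose_entries V2 W2 p2 p1 (v1, w3) (v3, w1) =
      (\<Sum>k\<in>{..<n'} \<times> {..<n}. complex_of_real (?l k) * (?P k v1 v3 * ?Q k w3 w1))" .
  qed
  then show ?thesis
    by (rule loc_realizableI[rotated]) simp
qed

lemma loc_corr_iff:
  assumes fin: "finite V2" "finite W1" "finite V1" "finite W2"
  shows "\<Gamma> \<in> loc_corr V2 W1 V1 W2 \<longleftrightarrow> \<Gamma> \<in> ns_corr V2 W1 V1 W2 \<and> loc_realizable False V2 W1 V1 W2 (entry \<Gamma>)"
proof
  assume "\<Gamma> \<in> loc_corr V2 W1 V1 W2"
  then obtain n :: nat and l \<Phi> \<Psi> where ns: "\<Gamma> \<in> ns_corr V2 W1 V1 W2"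
    and l: "\<forall>i<n. l i \<ge> 0" "(\<Sum>i<n. l i) = 1"
    and ch: "\<forall>i<n. channel V2 V1 (\<Phi> i) \<and> channel W1 W2 (\<Psi> i)"
    and e: "\<forall>v2\<in>V2. \<forall>w1\<in>W1. \<forall>v1\<in>V1. \<forall>w2\<in>W2. entry \<Gamma> (v1, w2) (v2, w1) =
             (\<Sum>i<n. complex_of_real (l i) * (entry (\<Phi> i) v1 v2 * entry (\<Psi> i) w2 w1))"
    unfolding loc_corr_def by blast
  have "loc_model False {..<n} l (\<lambda>i. entry (\<Phi> i)) (\<lambda>i. entry (\<Psi> i)) V2 W1 V1 W2 (entry \<Gamma>)"
    using l ch e fin by (auto simp: loc_model_def intro: channel_stochastic)
  with ns show "\<Gamma> \<in> ns_corr V2 W1 V1 W2 \<and> loc_realizable False V2 W1 V1 W2 (entry \<Gamma>)"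
    unfolding loc_realizable_def by blast
next
  assume R: "\<Gamma> \<in> ns_corr V2 W1 V1 W2 \<and> loc_realizable False V2 W1 V1 W2 (entry \<Gamma>)"
  then obtain n :: nat and l P Q where m: "loc_model False {..<n} l P Q V2 W1 V1 W2 (entry \<Gamma>)"
    unfolding loc_realizable_def by blast
  define \<Phi> where "\<Phi> i = mk_map V2 V1 (P i)" for i
  define \<Psi> where "\<Psi> i = mk_map W1 W2 (Q i)" for i
  have "\<forall>i<n. channel V2 V1 (\<Phi> i) \<and> channel W1 W2 (\<Psi> i)"
    using m fin by (simp add: loc_model_def \<Phi>_def \<Psi>_def channel_mk_map)
  moreover have "\<forall>v2\<in>V2. \<forall>w1\<in>W1. \<forall>v1\<in>V1. \<forall>w2\<in>W2. entry \<Gamma> (v1, w2) (v2, w1) =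
             (\<Sum>i<n. complex_of_real (l i) * (entry (\<Phi> i) v1 v2 * entry (\<Psi> i) w2 w1))"
    using m fin by (simp add: loc_model_def \<Phi>_def \<Psi>_def entry_mk_map)
  moreover have "\<forall>i<n. l i \<ge> 0" "(\<Sum>i<n. l i) = 1"
    using m by (auto simp: loc_model_def)
  ultimately show "\<Gamma> \<in> loc_corr V2 W1 V1 W2"
    using R unfolding loc_corr_def by blast
qed

lemma bistochastic_iff:
  "bistochastic V p \<longleftrightarrow> stochastic V V (\<lambda>i j. complex_of_real (p i j)) \<and>
    stochastic V V (dual_entries (\<lambda>i j. complex_of_real (p i j)))"
  unfolding bistochastic_def stochastic_def dual_entries_def
  by (auto simp flip: of_real_sum)

lemma loc_bicorr_iff:
  "\<Gamma> \<in> loc_bicorr V W \<longleftrightarrow> \<Gamma> \<in> ns_bicorr V W \<and> loc_realizable True V W V W (entry \<Gamma>)"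
proof
  assume "\<Gamma> \<in> loc_bicorr V W"
  then obtain n :: nat and l p p' where ns: "\<Gamma> \<in> ns_bicorr V W"
    and l: "\<forall>i<n. l i \<ge> 0" "(\<Sum>i<n. l i) = 1"
    and bi: "\<forall>i<n. bistochastic V (p i) \<and> bistochastic W (p' i)"
    and e: "\<forall>v2\<in>V. \<forall>w1\<in>W. \<forall>v1\<in>V. \<forall>w2\<in>W. entry \<Gamma> (v1, w2) (v2, w1) =
             complex_of_real (\<Sum>i<n. l i * (p i v1 v2 * p' i w2 w1))"
    unfolding loc_bicorr_def by blast
  have "loc_model True {..<n} l (\<lambda>i v w. complex_of_real (p i v w)) (\<lambda>i v w. complex_of_real (p' i v w))
      V W V W (entry \<Gamma>)"
    using l bi e by (simp add: loc_model_def bistochastic_iff)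
  with ns show "\<Gamma> \<in> ns_bicorr V W \<and> loc_realizable True V W V W (entry \<Gamma>)"
    unfolding loc_realizable_def by blast
next
  assume R: "\<Gamma> \<in> ns_bicorr V W \<and> loc_realizable True V W V W (entry \<Gamma>)"
  then obtain n :: nat and l P Q where m: "loc_model True {..<n} l P Q V W V W (entry \<Gamma>)"
    unfolding loc_realizable_def by blast
  define p where "p i v w = Re (P i v w)" for i v w
  define p' where "p' i v w = Re (Q i v w)" for i v w
  \<comment> \<open>Stochastic tables have nonnegative real entries, so passing to real parts loses
    nothing on the index sets.\<close>
  have re1: "P i v1 v2 = complex_of_real (p i v1 v2)" if "i < n" "v1 \<in> V" "v2 \<in> V" for i v1 v2
    using m that by (auto simp: loc_model_def stochastic_def p_def complex_nonneg_of_real)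
  have re2: "Q i w2 w1 = complex_of_real (p' i w2 w1)" if "i < n" "w1 \<in> W" "w2 \<in> W" for i w1 w2
    using m that by (auto simp: loc_model_def stochastic_def p'_def complex_nonneg_of_real)
  have "\<forall>i<n. bistochastic V (p i) \<and> bistochastic W (p' i)"
  proof (intro allI impI)
    fix i assume i: "i < n"
    have "stochastic V V (P i)" "stochastic V V (dual_entries (P i))"
      "stochastic W W (Q i)" "stochastic W W (dual_entries (Q i))"
      using m i by (auto simp: loc_model_def)
    then show "bistochastic V (p i) \<and> bistochastic W (p' i)"
      unfolding bistochastic_iff stochastic_def dual_entries_def
      using re1[OF i] re2[OF i] by simp
  qed
  moreover have "\<forall>v2\<in>V. \<forall>w1\<in>W. \<forall>v1\<in>V. \<forall>w2\<in>W. entry \<Gamma> (v1, w2) (v2, w1) =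
             complex_of_real (\<Sum>i<n. l i * (p i v1 v2 * p' i w2 w1))"
    using m re1 re2 by (simp add: loc_model_def)
  moreover have "\<forall>i<n. l i \<ge> 0" "(\<Sum>i<n. l i) = 1"
    using m by (auto simp: loc_model_def)
  ultimately show "\<Gamma> \<in> loc_bicorr V W"
    using R unfolding loc_bicorr_def by blast
qed

lemma qc_corr_iff:
  "\<Gamma> \<in> qc_corr TYPE('h) V2 W1 V1 W2 \<longleftrightarrow> \<Gamma> \<in> ns_corr V2 W1 V1 W2 \<and> qc_realizable TYPE('h) False V2 W1 V1 W2 \<Gamma>"
  by (simp add: qc_corr_def qc_realizable_def hfam_def)

lemma q_corr_iff:
  "\<Gamma> \<in> q_corr TYPE('h) V2 W1 V1 W2 \<longleftrightarrow> \<Gamma> \<in> ns_corr V2 W1 V1 W2 \<and> q_realizable TYPE('h) False V2 W1 V1 W2 \<Gamma>"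
  by (simp add: q_corr_def q_realizable_def hfam_def)

lemma qc_bicorr_iff:
  "finite V \<Longrightarrow> finite W \<Longrightarrow>
   \<Gamma> \<in> qc_bicorr TYPE('h) V W \<longleftrightarrow> \<Gamma> \<in> ns_bicorr V W \<and> qc_realizable TYPE('h) True V W V W \<Gamma>"
  by (simp add: qc_bicorr_def qc_realizable_def quantum_magic_square_hfam)

lemma q_bicorr_iff:
  "finite V \<Longrightarrow> finite W \<Longrightarrow>
   \<Gamma> \<in> q_bicorr TYPE('h) V W \<longleftrightarrow> \<Gamma> \<in> ns_bicorr V W \<and> q_realizable TYPE('h) True V W V W \<Gamma>"
  by (simp add: q_bicorr_def q_realizable_def quantum_magic_square_hfam)

section \<open>Composition within each type of correlation\<close>

definition compose_corr ::
  "'v set \<Rightarrow> 'w set \<Rightarrow> 'v set \<Rightarrow> 'w set \<Rightarrow> 'v set \<Rightarrow> 'w set \<Rightarrow>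
   ('v, 'w) corr_map \<Rightarrow> ('v, 'w) corr_map \<Rightarrow> ('v, 'w) corr_map" where
  "compose_corr V3 W1 V2 W2 V1 W3 \<Gamma>2 \<Gamma>1 =
     mk_map (V3 \<times> W1) (V1 \<times> W3) (compose_entries V2 W2 (entry \<Gamma>2) (entry \<Gamma>1))"

definition dual_corr :: "'v set \<Rightarrow> 'w set \<Rightarrow> ('v, 'w) corr_map \<Rightarrow> ('v, 'w) corr_map" where
  "dual_corr V W \<Gamma> = mk_map (V \<times> W) (V \<times> W) (dual_entries (entry \<Gamma>))"

definition id_corr :: "'v set \<Rightarrow> 'w set \<Rightarrow> ('v, 'w) corr_map" where
  "id_corr V W = mk_map (V \<times> W) (V \<times> W) (\<lambda>y x. if y = x then 1 else 0)"

lemma entry_compose_corr: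
  "finite V3 \<Longrightarrow> finite W1 \<Longrightarrow> v3 \<in> V3 \<Longrightarrow> w1 \<in> W1 \<Longrightarrow> v1 \<in> V1 \<Longrightarrow> w3 \<in> W3 \<Longrightarrow>
   entry (compose_corr V3 W1 V2 W2 V1 W3 \<Gamma>2 \<Gamma>1) (v1, w3) (v3, w1) =
     compose_entries V2 W2 (entry \<Gamma>2) (entry \<Gamma>1) (v1, w3) (v3, w1)"
  by (simp add: compose_corr_def entry_mk_map)

lemma entry_dual_corr:
  "finite V \<Longrightarrow> finite W \<Longrightarrow> v2 \<in> V \<Longrightarrow> w1 \<in> W \<Longrightarrow> v1 \<in> V \<Longrightarrow> w2 \<in> W \<Longrightarrow>
   entry (dual_corr V W \<Gamma>) (v1, w2) (v2, w1) = entry \<Gamma> (v2, w1) (v1, w2)"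
  by (simp add: dual_corr_def entry_mk_map dual_entries_def)

lemma entry_id_corr:
  "finite V \<Longrightarrow> finite W \<Longrightarrow> v2 \<in> V \<Longrightarrow> w1 \<in> W \<Longrightarrow> v1 \<in> V \<Longrightarrow> w2 \<in> W \<Longrightarrow>
   entry (id_corr V W) (v1, w2) (v2, w1) = (if v1 = v2 \<and> w2 = w1 then 1 else 0)"
  by (simp add: id_corr_def entry_mk_map)

definition entries_agree ::
  "'v set \<Rightarrow> 'w set \<Rightarrow> 'v set \<Rightarrow> 'w set \<Rightarrow> ('v, 'w) entries \<Rightarrow>
   ('v, 'w) entries \<Rightarrow> bool" where
  "entries_agree V2 W1 V1 W2 q p \<longleftrightarrow> (\<forall>v2\<in>V2. \<forall>w1\<in>W1. \<forall>v1\<in>V1. \<forall>w2\<in>W2. q (v1, w2) (v2, w1) = p (v1, w2) (v2, w1))"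

lemma entries_agree_compose_corr:
  "finite V3 \<Longrightarrow> finite W1 \<Longrightarrow> entries_agree V3 W1 V1 W3
     (entry (compose_corr V3 W1 V2 W2 V1 W3 \<Gamma>2 \<Gamma>1)) (compose_entries V2 W2 (entry \<Gamma>2) (entry \<Gamma>1))"
  by (simp add: entries_agree_def entry_compose_corr)

lemma loc_realizable_cong:
  "loc_realizable b V2 W1 V1 W2 p \<Longrightarrow> entries_agree V2 W1 V1 W2 q p \<Longrightarrow> loc_realizable b V2 W1 V1 W2 q"
  by (simp add: loc_realizable_def loc_model_def entries_agree_def)

lemma qc_model_cong:
  "qc_model b N S x V2 W1 V1 W2 A B p \<Longrightarrow> entries_agree V2 W1 V1 W2 q p \<Longrightarrow> qc_model b N S x V2 W1 V1 W2 A B q"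
  by (simp add: qc_model_def entries_agree_def)

lemma q_model_cong:
  "q_model b N M x V2 W1 V1 W2 A B p \<Longrightarrow> entries_agree V2 W1 V1 W2 q p \<Longrightarrow> q_model b N M x V2 W1 V1 W2 A B q"
  by (simp add: q_model_def entries_agree_def)

lemma qc_realizable_compose:
  assumes h: "lepoll (UNIV :: complex set) (UNIV :: 'h set)"
    and fin: "finite V1" "finite W1" "finite V3" "finite W3" "finite V2" "finite W2"
    and r: "qc_realizable TYPE('h) b V2 W1 V1 W2 \<Gamma>1" "qc_realizable TYPE('h) b V3 W2 V2 W3 \<Gamma>2"
  shows "qc_realizable TYPE('h) b V3 W1 V1 W3 (compose_corr V3 W1 V2 W2 V1 W3 \<Gamma>2 \<Gamma>1)"
proof -
  obtain N1 S1 :: "nat set" and x1 A1 B1 where m1: "qc_model b N1 S1 x1 V2 W1 V1 W2 A1 B1 (entry \<Gamma>1)"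
    using qc_model_of_realizable[OF r(1)] fin by blast
  obtain N2 S2 :: "nat set" and x2 A2 B2 where m2: "qc_model b N2 S2 x2 V3 W2 V2 W3 A2 B2 (entry \<Gamma>2)"
    using qc_model_of_realizable[OF r(2)] fin by blast
  show ?thesis
    by (rule qc_realizableI[OF h qc_model_cong[OF qc_model_compose[OF fin m1 m2] entries_agree_compose_corr[OF fin(3,2)]]])
qed

lemma q_realizable_compose:
  assumes h: "lepoll (UNIV :: complex set) (UNIV :: 'h set)"
    and fin: "finite V1" "finite W1" "finite V3" "finite W3" "finite V2" "finite W2"
    and r: "q_realizable TYPE('h) b V2 W1 V1 W2 \<Gamma>1" "q_realizable TYPE('h) b V3 W2 V2 W3 \<Gamma>2"
  shows "q_realizable TYPE('h) b V3 W1 V1 W3 (compose_corr V3 W1 V2 W2 V1 W3 \<Gamma>2 \<Gamma>1)"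
proof -
  obtain N1 M1 :: "nat set" and x1 A1 B1 where m1: "q_model b N1 M1 x1 V2 W1 V1 W2 A1 B1 (entry \<Gamma>1)"
    using q_model_of_realizable[OF r(1)] by blast
  obtain N2 M2 :: "nat set" and x2 A2 B2 where m2: "q_model b N2 M2 x2 V3 W2 V2 W3 A2 B2 (entry \<Gamma>2)"
    using q_model_of_realizable[OF r(2)] by blast
  show ?thesis
    by (rule q_realizableI[OF h q_model_cong[OF q_model_compose[OF fin m1 m2] entries_agree_compose_corr[OF fin(3,2)]]])
qed

lemma loc_realizable_compose_corr:
  assumes "finite V3" "finite W1"
    and r: "loc_realizable b V2 W1 V1 W2 (entry \<Gamma>1)" "loc_realizable b V3 W2 V2 W3 (entry \<Gamma>2)"
  shows "loc_realizable b V3 W1 V1 W3 (entry (compose_corr V3 W1 V2 W2 V1 W3 \<Gamma>2 \<Gamma>1))"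
  by (rule loc_realizable_cong[OF loc_realizable_compose[OF r] entries_agree_compose_corr[OF assms(1,2)]])

lemma ns_corr_compose:
  assumes "finite V1" "finite W1" "finite V3" "finite W3" "finite V2" "finite W2"
    and "V2 = {} \<Longrightarrow> W2 = {} \<Longrightarrow> V3 \<times> W1 = {}"
    and "\<Gamma>1 \<in> ns_corr V2 W1 V1 W2" "\<Gamma>2 \<in> ns_corr V3 W2 V2 W3"
  shows "compose_corr V3 W1 V2 W2 V1 W3 \<Gamma>2 \<Gamma>1 \<in> ns_corr V3 W1 V1 W3"
  unfolding compose_corr_def using assms
  by (intro ns_corr_mk_map no_signalling_compose ns_corr_no_signalling) auto

lemma dual_compose_entries:
  "dual_entries (compose_entries V W p2 p1) = compose_entries V W (dual_entries p1) (dual_entries p2)"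
  by (simp add: fun_eq_iff dual_entries_def compose_entries_def mult.commute)

text \<open>Dualising a composite reverses the order, so the same composition lemma covers the dual.
  Here inner and outer sets coincide, so empty inner sets force empty outer ones.\<close>

lemma ns_bicorr_compose:
  assumes fin: "finite V" "finite W" and G: "\<Gamma>1 \<in> ns_bicorr V W" "\<Gamma>2 \<in> ns_bicorr V W"
  shows "compose_corr V W V W V W \<Gamma>2 \<Gamma>1 \<in> ns_bicorr V W"
proof -
  note n = ns_bicorrD[OF fin G(1)] ns_bicorrD[OF fin G(2)]
  show ?thesis
    unfolding compose_corr_def
    by (intro ns_bicorr_mk_map[OF fin]) (auto simp: dual_compose_entries intro!: no_signalling_compose n)
qed

text \<open>Each entry of the composite is a finite sum of products of entries, hence continuous in
  them, so the composites of the approximants converge.\<close>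

lemma corr_limits_compose:
  assumes fin: "finite V1" "finite W1" "finite V3" "finite W3" "finite V2" "finite W2"
    and G: "\<Gamma>1 \<in> corr_limits V2 W1 V1 W2 C1" "\<Gamma>2 \<in> corr_limits V3 W2 V2 W3 C2"
    and C: "\<And>\<Gamma>1 \<Gamma>2. \<Gamma>1 \<in> C1 \<Longrightarrow> \<Gamma>2 \<in> C2 \<Longrightarrow> compose_corr V3 W1 V2 W2 V1 W3 \<Gamma>2 \<Gamma>1 \<in> C"
  shows "compose_corr V3 W1 V2 W2 V1 W3 \<Gamma>2 \<Gamma>1 \<in> corr_limits V3 W1 V1 W3 C"
proof -
  obtain s where s: "\<And>n. s n \<in> C1"
    and sl: "\<And>v2 w1 v1 w2. v2 \<in> V2 \<Longrightarrow> w1 \<in> W1 \<Longrightarrow> v1 \<in> V1 \<Longrightarrow> w2 \<in> W2 \<Longrightarrow>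
      (\<lambda>n. entry (s n) (v1, w2) (v2, w1)) \<longlonglongrightarrow> entry \<Gamma>1 (v1, w2) (v2, w1)"
    using G(1) unfolding corr_limits_def by blast
  obtain r where r: "\<And>n. r n \<in> C2"
    and rl: "\<And>v3 w2 v2 w3. v3 \<in> V3 \<Longrightarrow> w2 \<in> W2 \<Longrightarrow> v2 \<in> V2 \<Longrightarrow> w3 \<in> W3 \<Longrightarrow>
      (\<lambda>n. entry (r n) (v2, w3) (v3, w2)) \<longlonglongrightarrow> entry \<Gamma>2 (v2, w3) (v3, w2)"
    using G(2) unfolding corr_limits_def by blast
  have "(\<lambda>n. entry (compose_corr V3 W1 V2 W2 V1 W3 (r n) (s n)) (v1, w3) (v3, w1))
    \<longlonglongrightarrow> entry (compose_corr V3 W1 V2 W2 V1 W3 \<Gamma>2 \<Gamma>1) (v1, w3) (v3, w1)"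
    if "v3 \<in> V3" "w1 \<in> W1" "v1 \<in> V1" "w3 \<in> W3" for v3 w1 v1 w3
    unfolding entry_compose_corr[OF fin(3,2) that] compose_entries_def fst_conv snd_conv
    using that by (intro tendsto_sum tendsto_mult sl rl)
  then show ?thesis
    unfolding corr_limits_def
    by (auto intro!: exI[of _ "\<lambda>n. compose_corr V3 W1 V2 W2 V1 W3 (r n) (s n)"] C s r)
qed

lemma corr_compose:
  assumes h: "lepoll (UNIV :: complex set) (UNIV :: 'h set)"
    and fin: "finite V1" "finite W1" "finite V3" "finite W3" "finite V2" "finite W2"
    and nonvoid: "V2 = {} \<Longrightarrow> W2 = {} \<Longrightarrow> V3 \<times> W1 = {}"
    and G: "\<Gamma>1 \<in> corr TYPE('h) t V2 W1 V1 W2" "\<Gamma>2 \<in> corr TYPE('h) t V3 W2 V2 W3"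
  shows "compose_corr V3 W1 V2 W2 V1 W3 \<Gamma>2 \<Gamma>1 \<in> corr TYPE('h) t V3 W1 V1 W3"
proof -
  note ns = ns_corr_compose[OF fin nonvoid]
  have q: "compose_corr V3 W1 V2 W2 V1 W3 \<Gamma>2 \<Gamma>1 \<in> q_corr TYPE('h) V3 W1 V1 W3"
    if "\<Gamma>1 \<in> q_corr TYPE('h) V2 W1 V1 W2" "\<Gamma>2 \<in> q_corr TYPE('h) V3 W2 V2 W3" for \<Gamma>1 \<Gamma>2
    using that ns q_realizable_compose[OF h fin] by (simp add: q_corr_iff)
  show ?thesis
  proof (cases t)
    case T_loc
    then show ?thesis
      using G ns loc_realizable_compose_corr[OF fin(3,2)] fin by (simp add: loc_corr_iff)
  next
    case T_q
    then show ?thesis using G q by simp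
  next
    case T_qa
    with G have "\<Gamma>1 \<in> corr_limits V2 W1 V1 W2 (q_corr TYPE('h) V2 W1 V1 W2)"
      "\<Gamma>2 \<in> corr_limits V3 W2 V2 W3 (q_corr TYPE('h) V3 W2 V2 W3)"
      by auto
    from corr_limits_compose[OF fin this q] T_qa G ns show ?thesis by simp
  next
    case T_qc
    then show ?thesis using G ns qc_realizable_compose[OF h fin] by (simp add: qc_corr_iff)
  next
    case T_ns
    then show ?thesis using G ns by simp
  qed
qed

lemma bicorr_compose:
  assumes h: "lepoll (UNIV :: complex set) (UNIV :: 'h set)"
    and fin: "finite V" "finite W"
    and G: "\<Gamma>1 \<in> bicorr TYPE('h) t V W" "\<Gamma>2 \<in> bicorr TYPE('h) t V W"
  shows "compose_corr V W V W V W \<Gamma>2 \<Gamma>1 \<in> bicorr TYPE('h) t V W"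
proof -
  note fin' = fin fin fin
  note ns = ns_bicorr_compose[OF fin]
  have q: "compose_corr V W V W V W \<Gamma>2 \<Gamma>1 \<in> q_bicorr TYPE('h) V W"
    if "\<Gamma>1 \<in> q_bicorr TYPE('h) V W" "\<Gamma>2 \<in> q_bicorr TYPE('h) V W" for \<Gamma>1 \<Gamma>2
    using that ns q_realizable_compose[OF h fin'] by (simp add: q_bicorr_iff fin)
  show ?thesis
  proof (cases t)
    case T_loc
    then show ?thesis
      using G ns loc_realizable_compose_corr[OF fin] by (simp add: loc_bicorr_iff)
  next
    case T_q
    then show ?thesis using G q by simp
  next
    case T_qa
    with G have "\<Gamma>1 \<in> corr_limits V W V W (q_bicorr TYPE('h) V W)"
      "\<Gamma>2 \<in> corr_limits V W V W (q_bicorr TYPE('h) V W)"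
      by auto
    from corr_limits_compose[OF fin' this q] T_qa G ns show ?thesis by simp
  next
    case T_qc
    then show ?thesis using G ns qc_realizable_compose[OF h fin'] by (simp add: qc_bicorr_iff fin)
  next
    case T_ns
    then show ?thesis using G ns by simp
  qed
qed

section \<open>From bicorrelations to correlations, and duals of bicorrelations\<close>

lemma hfam_mono: "hfam True H X Y E \<Longrightarrow> hfam False H X Y E"
  by (simp add: hfam_def)

lemma qc_realizable_mono: "qc_realizable TYPE('h) True V2 W1 V1 W2 \<Gamma> \<Longrightarrow> qc_realizable TYPE('h) False V2 W1 V1 W2 \<Gamma>"
  unfolding qc_realizable_def by (blast intro: hfam_mono)

lemma q_realizable_mono: "q_realizable TYPE('h) True V2 W1 V1 W2 \<Gamma> \<Longrightarrow> q_realizable TYPE('h) False V2 W1 V1 W2 \<Gamma>"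
  unfolding q_realizable_def by (blast intro: hfam_mono)

text \<open>Lets the identity bicorrelation also witness reflexivity of
  \<open>arrow\<close>.\<close>

lemma bicorr_subset_corr:
  assumes "finite V" "finite W"
  shows "bicorr TYPE('h) t V W \<subseteq> corr TYPE('h) t V W V W"
proof -
  have ns: "ns_bicorr V W \<subseteq> ns_corr V W V W"
    by (auto simp: ns_bicorr_def)
  have q: "q_bicorr TYPE('h) V W \<subseteq> q_corr TYPE('h) V W V W"
    using subsetD[OF ns] by (auto simp: q_bicorr_iff[OF assms] q_corr_iff q_realizable_mono)
  have qc: "qc_bicorr TYPE('h) V W \<subseteq> qc_corr TYPE('h) V W V W"
    using subsetD[OF ns] by (auto simp: qc_bicorr_iff[OF assms] qc_corr_iff qc_realizable_mono)
  have loc: "loc_bicorr V W \<subseteq> loc_corr V W V W"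
  proof
    fix \<Gamma> assume "\<Gamma> \<in> loc_bicorr V W"
    then obtain n :: nat and l P Q where "\<Gamma> \<in> ns_bicorr V W" "loc_model True {..<n} l P Q V W V W (entry \<Gamma>)"
      by (auto simp: loc_bicorr_iff loc_realizable_def)
    moreover from this(2) have "loc_model False {..<n} l P Q V W V W (entry \<Gamma>)"
      by (simp add: loc_model_def)
    ultimately show "\<Gamma> \<in> loc_corr V W V W"
      using ns assms by (auto simp: loc_corr_iff loc_realizable_def)
  qed
  have "corr_limits V W V W (q_bicorr TYPE('h) V W) \<subseteq> corr_limits V W V W (q_corr TYPE('h) V W V W)"
    using q unfolding corr_limits_def by blast
  with ns q qc loc show ?thesis
    by (cases t) auto
qed

lemma tensor_split_transpose:
  assumes "tensor_split H V V E W W F"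
  shows "tensor_split H V V (\<lambda>i j. E j i) W W (\<lambda>i j. F j i)"
proof -
  obtain K L :: "'a hilbert" and \<tau> E' F' where KL:
    "hilbert_space K" "finite_dimensional K" "hilbert_space L" "finite_dimensional L" "fd_tensor K L H \<tau>"
    "\<forall>i\<in>V. \<forall>j\<in>V. bounded_op K (E' i j) \<and>
       (\<forall>x\<in>carrier K. \<forall>y\<in>carrier L. E i j (\<tau> x y) = \<tau> (E' i j x) y)"
    "\<forall>k\<in>W. \<forall>l\<in>W. bounded_op L (F' k l) \<and>
       (\<forall>x\<in>carrier K. \<forall>y\<in>carrier L. F k l (\<tau> x y) = \<tau> x (F' k l y))"
    using assms unfolding tensor_split_def by (elim exE conjE) (rule that)
  show ?thesis
    unfolding tensor_split_def
    by (rule exI[of _ K], rule exI[of _ L], rule exI[of _ \<tau>], rule exI[of _ "\<lambda>i j. E' j i"],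
        rule exI[of _ "\<lambda>i j. F' j i"]) (use KL in blast)
qed

lemma hfam_transpose: "hfam True H V V E \<Longrightarrow> hfam True H V V (\<lambda>i j. E j i)"
  by (simp add: hfam_def)

lemma commuting_model_dual:
  "finite V \<Longrightarrow> finite W \<Longrightarrow> commuting_model H \<xi> V W V W E F \<Gamma> \<Longrightarrow>
   commuting_model H \<xi> V W V W (\<lambda>i j. E j i) (\<lambda>i j. F j i) (dual_corr V W \<Gamma>)"
  by (simp add: commuting_model_def entry_dual_corr)

lemma dual_entries_dual_entries [simp]: "dual_entries (dual_entries p) = p"
  by (simp add: fun_eq_iff dual_entries_def)

lemma stochastic_id: "finite X \<Longrightarrow> stochastic X X (\<lambda>y x. if y = x then 1 else 0)"
  by (auto simp: stochastic_def)

lemma dual_entries_id: "dual_entries (\<lambda>y x. if y = x then 1 else 0) = (\<lambda>y x. if y = x then 1 else 0)"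
  by (auto simp: fun_eq_iff dual_entries_def)

lemma loc_realizable_dual:
  assumes "finite V" "finite W" "loc_realizable True V W V W (entry \<Gamma>)"
  shows "loc_realizable True V W V W (entry (dual_corr V W \<Gamma>))"
proof -
  obtain n :: nat and l P Q where m: "loc_model True {..<n} l P Q V W V W (entry \<Gamma>)"
    using assms by (auto simp: loc_realizable_def)
  have "loc_model True {..<n} l (\<lambda>i. dual_entries (P i)) (\<lambda>i. dual_entries (Q i)) V W V W (entry (dual_corr V W \<Gamma>))"
    using m assms by (simp add: loc_model_def entry_dual_corr) (simp add: dual_entries_def)
  then show ?thesis
    unfolding loc_realizable_def by blast
qed

lemma ns_bicorr_dual:
  assumes fin: "finite V" "finite W" and "\<Gamma> \<in> ns_bicorr V W"
  shows "dual_corr V W \<Gamma> \<in> ns_bicorr V W"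
proof -
  show ?thesis
    unfolding dual_corr_def using ns_bicorrD[OF assms] by (intro ns_bicorr_mk_map[OF fin]) auto
qed

lemma bicorr_dual:
  assumes fin: "finite V" "finite W" and G: "\<Gamma> \<in> bicorr TYPE('h) t V W"
  shows "dual_corr V W \<Gamma> \<in> bicorr TYPE('h) t V W"
proof -
  note ns = ns_bicorr_dual[OF fin]
  have q: "dual_corr V W \<Gamma> \<in> q_bicorr TYPE('h) V W" if G: "\<Gamma> \<in> q_bicorr TYPE('h) V W" for \<Gamma>
  proof -
    obtain H :: "'h hilbert" and \<xi> E F where m: "hfam True H V V E" "hfam True H W W F"
      "commuting_model H \<xi> V W V W E F \<Gamma>" "tensor_split H V V E W W F"
      using G by (auto simp: q_bicorr_iff fin q_realizable_def)
    note hfam_transpose[OF m(1)] hfam_transpose[OF m(2)] commuting_model_dual[OF fin m(3)] tensor_split_transpose[OF m(4)]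
    then have "q_realizable TYPE('h) True V W V W (dual_corr V W \<Gamma>)"
      unfolding q_realizable_def by blast
    with G ns show ?thesis by (simp add: q_bicorr_iff fin)
  qed
  show ?thesis
  proof (cases t)
    case T_loc
    then show ?thesis using G ns loc_realizable_dual[OF fin] by (simp add: loc_bicorr_iff)
  next
    case T_q
    then show ?thesis using G q by simp
  next
    case T_qa
    with G have "\<Gamma> \<in> corr_limits V W V W (q_bicorr TYPE('h) V W)"
      by simp
    then obtain s where s: "\<And>n. s n \<in> q_bicorr TYPE('h) V W"
      and lim: "\<And>v2 w1 v1 w2. v2 \<in> V \<Longrightarrow> w1 \<in> W \<Longrightarrow> v1 \<in> V \<Longrightarrow> w2 \<in> W \<Longrightarrow>
      (\<lambda>n. entry (s n) (v1, w2) (v2, w1)) \<longlonglongrightarrow> entry \<Gamma> (v1, w2) (v2, w1)"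
      unfolding corr_limits_def by blast
    have "(\<lambda>n. entry (dual_corr V W (s n)) (v1, w2) (v2, w1)) \<longlonglongrightarrow> entry (dual_corr V W \<Gamma>) (v1, w2) (v2, w1)"
      if "v2 \<in> V" "w1 \<in> W" "v1 \<in> V" "w2 \<in> W" for v2 w1 v1 w2
      unfolding entry_dual_corr[OF fin that] using that by (intro lim)
    then have "dual_corr V W \<Gamma> \<in> corr_limits V W V W (q_bicorr TYPE('h) V W)"
      unfolding corr_limits_def by (auto intro!: exI[of _ "\<lambda>n. dual_corr V W (s n)"] q s)
    with T_qa G ns show ?thesis by simp
  next
    case T_qc
    then obtain H :: "'h hilbert" and \<xi> E F where m: "hfam True H V V E" "hfam True H W W F"
      "commuting_model H \<xi> V W V W E F \<Gamma>"
      using G by (auto simp: qc_bicorr_iff fin qc_realizable_def)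
    note hfam_transpose[OF m(1)] hfam_transpose[OF m(2)] commuting_model_dual[OF fin m(3)]
    then have "qc_realizable TYPE('h) True V W V W (dual_corr V W \<Gamma>)"
      unfolding qc_realizable_def by blast
    with T_qc G ns show ?thesis by (simp add: qc_bicorr_iff fin)
  next
    case T_ns
    then show ?thesis using G ns by simp
  qed
qed

section \<open>The identity bicorrelation\<close>

definition scalar_fam :: "'v \<Rightarrow> 'v \<Rightarrow> unit \<Rightarrow> unit \<Rightarrow> complex" where
  "scalar_fam v2 v1 i j = (if v1 = v2 then 1 else 0)"

text \<open>The identity permutation matrix read as a magic square on a one-dimensional space; it
  realises the identity correlation in both the commuting and the tensor product models.\<close>

lemma mfam_scalar_fam:
  assumes "finite V"
  shows "mfam b UNIV V V scalar_fam"
proof -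
  have psd: "psd (\<lambda>i j :: unit. if P then 1 else 0)" for P
  proof -
    have "psd (idm (if P then UNIV else {}) :: unit \<Rightarrow> unit \<Rightarrow> complex)"
      by (rule psd_idm)
    moreover have "idm (if P then UNIV else {}) = (\<lambda>i j :: unit. if P then 1 else 0)"
      by (auto simp: fun_eq_iff idm_def)
    ultimately show ?thesis by simp
  qed
  have "mpovm UNIV V (scalar_fam v)" if "v \<in> V" for v
    using assms that psd by (auto simp: mpovm_def scalar_fam_def[abs_def] rcf_def idm_def)
  moreover have "mpovm UNIV V (\<lambda>v'. scalar_fam v' v)" if "v \<in> V" for v
    using assms that psd by (auto simp: mpovm_def scalar_fam_def[abs_def] rcf_def idm_def)
  ultimately show ?thesis
    by (simp add: mfam_def)
qed

lemma ns_bicorr_id: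
  assumes fin: "finite V" "finite W"
  shows "id_corr V W \<in> ns_bicorr V W"
proof -
  have "no_signalling V W V W (\<lambda>y x. if y = x then 1 else 0)"
    unfolding no_signalling_def stochastic_def
  proof (intro conjI ballI)
    fix v2 v1 w1 w1' assume "w1 \<in> W" "w1' \<in> W"
    then show "(\<Sum>w2\<in>W. if (v1, w2) = (v2, w1) then 1 else 0 :: complex) = (\<Sum>w2\<in>W. if (v1, w2) = (v2, w1') then 1 else 0)"
      using fin by (cases "v1 = v2") auto
  next
    fix w1 w2 v2 v2' assume "v2 \<in> V" "v2' \<in> V"
    then show "(\<Sum>v1\<in>V. if (v1, w2) = (v2, w1) then 1 else 0 :: complex) = (\<Sum>v1\<in>V. if (v1, w2) = (v2', w1) then 1 else 0)"
      using fin by (cases "w1 = w2") auto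
  qed (use fin in auto)
  then show ?thesis
    unfolding id_corr_def by (intro ns_bicorr_mk_map[OF fin]) (simp_all add: dual_entries_id)
qed

lemma bicorr_id:
  assumes h: "lepoll (UNIV :: complex set) (UNIV :: 'h set)" and fin: "finite V" "finite W"
  shows "id_corr V W \<in> bicorr TYPE('h) t V W"
proof -
  note ns = ns_bicorr_id[OF fin]
  have "q_model True UNIV UNIV (\<lambda>_. 1) V W V W scalar_fam scalar_fam (entry (id_corr V W))"
    by (auto simp: q_model_def mfam_scalar_fam fin entry_id_corr qform_def kron_def scalar_fam_def UNIV_Times_UNIV[symmetric]
        simp del: UNIV_Times_UNIV)
  then have q: "id_corr V W \<in> q_bicorr TYPE('h) V W"
    using q_realizableI[OF h] ns by (simp add: q_bicorr_iff fin)
  have "qc_model True UNIV UNIV (\<lambda>_. 1) V W V W scalar_fam scalar_fam (entry (id_corr V W))"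
    by (auto simp: qc_model_def mfam_scalar_fam fin entry_id_corr qform_def mmul_def scalar_fam_def fun_eq_iff)
  then have qc: "id_corr V W \<in> qc_bicorr TYPE('h) V W"
    using qc_realizableI[OF h] ns by (simp add: qc_bicorr_iff fin)
  let ?d = "\<lambda>(i::unit) y x. if y = x then 1 else 0 :: complex"
  have "loc_model True UNIV (\<lambda>_. 1) ?d ?d V W V W (entry (id_corr V W))"
    using fin by (auto simp: loc_model_def entry_id_corr stochastic_id dual_entries_id)
  then have loc: "id_corr V W \<in> loc_bicorr V W"
    using ns loc_realizableI[OF finite] by (auto simp: loc_bicorr_iff)
  have "id_corr V W \<in> corr_limits V W V W (q_bicorr TYPE('h) V W)"
    using q unfolding corr_limits_def by (auto intro: exI[of _ "\<lambda>_. id_corr V W"])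
  with ns q qc loc show ?thesis
    by (cases t) auto
qed

section \<open>The relations between hypergraphs\<close>

lemma fits_id: "is_hypergraph G \<Longrightarrow> fits (id_corr (vset G) (wset G)) G G"
  by (auto simp: fits_def is_hypergraph_def entry_id_corr iff_relation_def)

text \<open>If the edge conditions at \<open>(v1, w1)\<close> and \<open>(v3, w3)\<close> differ,
  then any \<open>(v2, w2)\<close> disagrees with one of them, so one factor of each summand
  vanishes.\<close>

lemma fits_compose:
  assumes G: "is_hypergraph G1" "is_hypergraph G3" and fits: "fits \<Gamma>1 G1 G2" "fits \<Gamma>2 G2 G3"
  shows "fits (compose_corr (vset G3) (wset G1) (vset G2) (wset G2) (vset G1) (wset G3) \<Gamma>2 \<Gamma>1) G1 G3"
  unfolding fits_def
proof (intro ballI impI)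
  fix v3 w1 v1 w3 assume *: "v3 \<in> vset G3" "w1 \<in> wset G1" "v1 \<in> vset G1" "w3 \<in> wset G3"
    and "(v3, w1, v1, w3) \<notin> iff_relation G1 G3"
  then have neq: "((v1, w1) \<in> edges G1) \<noteq> ((v3, w3) \<in> edges G3)"
    by (auto simp: iff_relation_def)
  have "entry \<Gamma>2 (v2, w3) (v3, w2) * entry \<Gamma>1 (v1, w2) (v2, w1) = 0" if "v2 \<in> vset G2" "w2 \<in> wset G2" for v2 w2
  proof (cases "((v1, w1) \<in> edges G1) = ((v2, w2) \<in> edges G2)")
    case True
    with neq have "(v3, w2, v2, w3) \<notin> iff_relation G2 G3"
      by (auto simp: iff_relation_def)
    then show ?thesis using fits(2) * that by (simp add: fits_def)
  next
    case False
    then have "(v2, w1, v1, w2) \<notin> iff_relation G1 G2"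
      by (auto simp: iff_relation_def)
    then show ?thesis using fits(1) * that by (simp add: fits_def)
  qed
  then have "compose_entries (vset G2) (wset G2) (entry \<Gamma>2) (entry \<Gamma>1) (v1, w3) (v3, w1) = 0"
    unfolding compose_entries_def fst_conv snd_conv by (intro sum.neutral ballI)
  then show "entry (compose_corr (vset G3) (wset G1) (vset G2) (wset G2) (vset G1) (wset G3) \<Gamma>2 \<Gamma>1) (v1, w3) (v3, w1) = 0"
    using G * by (simp add: entry_compose_corr is_hypergraph_def)
qed

lemma arrow_refl:
  assumes "lepoll (UNIV :: complex set) (UNIV :: 'h set)" "is_hypergraph G"
  shows "arrow TYPE('h) t G G"
  using assms bicorr_id[OF assms(1), of "vset G" "wset G" t] fits_id[OF assms(2)]
    bicorr_subset_corr[of "vset G" "wset G" t]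
  unfolding arrow_def is_hypergraph_def by blast

text \<open>Nonvoidness of \<open>G2\<close> rules out the case of two empty middle sets, in which
  the composite would lose its mass.\<close>

lemma arrow_trans:
  assumes h: "lepoll (UNIV :: complex set) (UNIV :: 'h set)"
    and G: "is_hypergraph G1" "is_hypergraph G2" "is_hypergraph G3" "nonvoid G2"
    and "arrow TYPE('h) t G1 G2" "arrow TYPE('h) t G2 G3"
  shows "arrow TYPE('h) t G1 G3"
proof -
  obtain \<Gamma>1 \<Gamma>2 where c: "\<Gamma>1 \<in> corr TYPE('h) t (vset G2) (wset G1) (vset G1) (wset G2)" "fits \<Gamma>1 G1 G2"
    "\<Gamma>2 \<in> corr TYPE('h) t (vset G3) (wset G2) (vset G2) (wset G3)" "fits \<Gamma>2 G2 G3"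
    using assms(6,7) unfolding arrow_def by blast
  have "compose_corr (vset G3) (wset G1) (vset G2) (wset G2) (vset G1) (wset G3) \<Gamma>2 \<Gamma>1
      \<in> corr TYPE('h) t (vset G3) (wset G1) (vset G1) (wset G3)"
    using G by (intro corr_compose[OF h] c) (auto simp: is_hypergraph_def nonvoid_def)
  then show ?thesis
    using fits_compose[OF G(1,3) c(2,4)] unfolding arrow_def by blast
qed

lemma bi_equiv_refl:
  assumes "lepoll (UNIV :: complex set) (UNIV :: 'h set)" "is_hypergraph G"
  shows "bi_equiv TYPE('h) t G G"
  using assms bicorr_id[OF assms(1), of "vset G" "wset G" t] fits_id[OF assms(2)]
  unfolding bi_equiv_def is_hypergraph_def by blast

text \<open>Fitting is a condition symmetric in the two edge conditions, so it is preserved when the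
  dual exchanges inputs and outputs.\<close>

lemma bi_equiv_sym:
  assumes G: "is_hypergraph G1" and e: "bi_equiv TYPE('h) t G1 G2"
  shows "bi_equiv TYPE('h) t G2 G1"
proof -
  obtain \<Gamma> where eq: "vset G1 = vset G2" "wset G1 = wset G2"
    and \<Gamma>: "\<Gamma> \<in> bicorr TYPE('h) t (vset G2) (wset G2)" "fits \<Gamma> G1 G2"
    using e unfolding bi_equiv_def by auto
  have fin: "finite (vset G2)" "finite (wset G2)"
    using G eq by (auto simp: is_hypergraph_def)
  have "fits (dual_corr (vset G2) (wset G2) \<Gamma>) G2 G1"
    unfolding fits_def
  proof (intro ballI impI)
    fix v2 w1 v1 w2 assume *: "v2 \<in> vset G1" "w1 \<in> wset G2" "v1 \<in> vset G2" "w2 \<in> wset G1"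
      and "(v2, w1, v1, w2) \<notin> iff_relation G2 G1"
    then have "(v1, w2, v2, w1) \<notin> iff_relation G1 G2"
      by (auto simp: iff_relation_def)
    with \<Gamma>(2) * have "entry \<Gamma> (v2, w1) (v1, w2) = 0"
      by (simp add: fits_def)
    with * eq fin show "entry (dual_corr (vset G2) (wset G2) \<Gamma>) (v1, w2) (v2, w1) = 0"
      by (simp add: entry_dual_corr)
  qed
  with bicorr_dual[OF fin \<Gamma>(1)] eq show ?thesis
    unfolding bi_equiv_def by auto
qed

lemma bi_equiv_trans:
  assumes h: "lepoll (UNIV :: complex set) (UNIV :: 'h set)"
    and G: "is_hypergraph G1" "is_hypergraph G2" "is_hypergraph G3"
    and e: "bi_equiv TYPE('h) t G1 G2" "bi_equiv TYPE('h) t G2 G3"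
  shows "bi_equiv TYPE('h) t G1 G3"
proof -
  have eq: "vset G2 = vset G1" "wset G2 = wset G1" "vset G3 = vset G1" "wset G3 = wset G1"
    using e by (simp_all add: bi_equiv_def)
  obtain \<Gamma>1 where c1: "\<Gamma>1 \<in> bicorr TYPE('h) t (vset G1) (wset G1)" "fits \<Gamma>1 G1 G2"
    using e(1) unfolding bi_equiv_def by blast
  obtain \<Gamma>2 where c2: "\<Gamma>2 \<in> bicorr TYPE('h) t (vset G2) (wset G2)" "fits \<Gamma>2 G2 G3"
    using e(2) unfolding bi_equiv_def by blast
  have "compose_corr (vset G1) (wset G1) (vset G1) (wset G1) (vset G1) (wset G1) \<Gamma>2 \<Gamma>1
      \<in> bicorr TYPE('h) t (vset G1) (wset G1)"
    using G by (intro bicorr_compose[OF h] c1(1) c2(1)[unfolded eq]) (auto simp: is_hypergraph_def)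
  moreover have "fits (compose_corr (vset G1) (wset G1) (vset G1) (wset G1) (vset G1) (wset G1) \<Gamma>2 \<Gamma>1) G1 G3"
    using fits_compose[OF G(1,3) c1(2) c2(2)] by (simp only: eq)
  ultimately show ?thesis
    unfolding bi_equiv_def eq by blast
qed

theorem theorem4p4:
  fixes t :: corr_type
  assumes "lepoll (UNIV :: complex set) (UNIV :: 'h set)"
  shows "preorder_on {G :: ('v, 'w) hypergraph. is_hypergraph G \<and> nonvoid G}
           {(G1, G2). is_hypergraph G1 \<and> nonvoid G1 \<and> is_hypergraph G2 \<and> nonvoid G2 \<and>
                      arrow TYPE('h) t G1 G2}
       \<and> equiv {G :: ('v, 'w) hypergraph. is_hypergraph G}
           {(G1, G2). is_hypergraph G1 \<and> is_hypergraph G2 \<and> bi_equiv TYPE('h) t G1 G2}"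
  unfolding preorder_on_def equiv_def
  by (auto intro!: refl_onI transI symI intro: arrow_refl[OF assms] arrow_trans[OF assms]
      bi_equiv_refl[OF assms] bi_equiv_sym bi_equiv_trans[OF assms])

end
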